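(* Let $n=2^a-1$ for a positive integer $a$, let $\mathcal{U}=\mathrm{GF}(2^a)^*$ (so $|\mathcal{U}|=n$), and let $t\ge1$. Then for every $m$, PinSketch (described in the context) is an average-case $(\mathsf{SDif}(\mathcal{U}),\,m,\,m-t\log(n+1),\,t)$-secure sketch for set difference with storage $t\log(n+1)$. The algorithms $\mathsf{SS}$ and $\mathsf{Rec}$ both run in time polynomial in $t$ and $\log n$.
   Context: Logarithms are base 2. $\mathsf{SDif}(\mathcal{U})$ is the set of all subsets of $\mathcal{U}$ (of any size, given as lists of elements) with distance $\mathsf{dis}(w,w')=|w\triangle w'|$. Storage is the length in bits of the output of $\mathsf{SS}$. PinSketch. $\mathsf{SS}(w)$: let $s_i=\sum_{x\in w}x^i$ (computed in $\mathrm{GF}(2^a)$) and output $(s_1,s_3,s_5,\dots,s_{2t-1})$. $\mathsf{Rec}(w',(s_1,s_3,\dots,s_{2t-1}))$: compute $(s_1',s_3',\dots,s_{2t-1}')=\mathsf{SS}(w')$; let $\sigma_i=s_i'-s_i$; find a set $v\subseteq\mathcal{U}$ with $|v|\le t$ and $\mathsf{SS}(v)=(\sigma_1,\sigma_3,\dots,\sigma_{2t-1})$ (by a BCH syndrome decoding algorithm that works with supports of words and runs in time polynomial in $t$ and $\log n$); output $w'\triangle v$. Average min-entropy: $\tilde{\mathbf{H}}_\infty(A\mid B)=-\log\big(\mathbb{E}_{b\leftarrow B}[\max_a\Pr[A=a\mid B=b]]\big)$. An average-case $(\mathcal{M},m,\tilde m,t)$-secure sketch is a pair of (possibly randomized)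 procedures: $\mathsf{SS}$ maps $w\in\mathcal{M}$ to a bit string; $\mathsf{Rec}$ takes $w'\in\mathcal{M}$ and a bit string; correctness: if $\mathsf{dis}(w,w')\le t$ then $\mathsf{Rec}(w',\mathsf{SS}(w))=w$; security: for any random variables $W$ over $\mathcal{M}$ and $I$ over $\{0,1\}^*$ with $\tilde{\mathbf{H}}_\infty(W\mid I)\ge m$, one has $\tilde{\mathbf{H}}_\infty(W\mid(\mathsf{SS}(W),I))\ge\tilde m$.
   Formalization: The running time of SS and Rec is bounded by a polynomial in t and log n times (1 + the number of elements of the input set), since the set may have up to n elements and all must be read; a bound polynomial in t and log n alone is false for sets of arbitrary size. *)

theory Defs
  imports
    "HOL-Probability.Probability"
    "HOL-Computational_Algebra.Computational_Algebra"
    "HOL-Library.Z2"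
    "HOL-Algebra.Ring"
begin

section \<open>Average min-entropy and average-case secure sketches\<close>

text \<open>A pair of discrete random variables is given by its joint distribution. The supremum is a
  maximum, and values of the second component that have probability 0 do not contribute to the
  expectation.\<close>

definition avg_min_entropy :: "('a \<times> 'b) pmf \<Rightarrow> real" where
  "avg_min_entropy J =
     - log 2 (measure_pmf.expectation (map_pmf snd J)
         (\<lambda>b. SUP a. \<P>(x in measure_pmf J. fst x = a \<bar> snd x = b)))"

text \<open>Randomized procedures return distributions. In the security clause \<open>J\<close> is the joint
  distribution of \<open>(W, I)\<close>, and the coins of the sketch are independent of \<open>(W, I)\<close>.\<close>

definition average_case_secure_sketch ::
  "'w set \<Rightarrow> ('w \<Rightarrow> 'w \<Rightarrow> nat) \<Rightarrow> real \<Rightarrow> real \<Rightarrow> nat \<Rightarrow>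
   ('w \<Rightarrow> bool list pmf) \<Rightarrow> ('w \<Rightarrow> bool list \<Rightarrow> 'w pmf) \<Rightarrow> bool" where
  "average_case_secure_sketch M dis m m' t SS Rec \<longleftrightarrow>
     (\<forall>w\<in>M. \<forall>w'\<in>M. dis w w' \<le> t \<longrightarrow> (\<forall>s\<in>set_pmf (SS w). Rec w' s = return_pmf w)) \<and>
     (\<forall>J :: ('w \<times> bool list) pmf.
        fst ` set_pmf J \<subseteq> M \<longrightarrow> avg_min_entropy J \<ge> m \<longrightarrow>
        avg_min_entropy
          (bind_pmf J (\<lambda>(w, i). map_pmf (\<lambda>s. (w, (s, i))) (SS w))) \<ge> m')"

definition sdif :: "'a set \<Rightarrow> 'a set set" where
  "sdif U = Pow U"

definition sdif_dist :: "'a set \<Rightarrow> 'a set \<Rightarrow> nat" where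
  "sdif_dist w w' = card (sym_diff w w')"


section \<open>The field with \<open>2 ^ a\<close> elements\<close>

text \<open>For \<open>f\<close> irreducible of degree \<open>a\<close> over the two-element field, the field of \<open>2 ^ a\<close> elements
  is represented in the standard way, by the residues of degree less than \<open>a\<close> modulo \<open>f\<close>.\<close>

definition GF :: "bit poly \<Rightarrow> bit poly ring" where
  "GF f = \<lparr>carrier = {p. degree p < degree f},
           monoid.mult = (\<lambda>p q. p * q mod f), one = 1, zero = 0, add = (+)\<rparr>"

definition GF_units :: "bit poly \<Rightarrow> bit poly set" where
  "GF_units f = carrier (GF f) - {\<zero>\<^bsub>GF f\<^esub>}"

lemma card_GF:
  assumes "degree f > 0"
  shows "card (carrier (GF f)) = 2 ^ degree f"
proof -
  let ?a = "degree f"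
  let ?L = "{xs. set xs \<subseteq> (UNIV :: bit set) \<and> length xs = ?a}"
  have UNIVb: "(UNIV :: bit set) = {0, 1}"
    using bit_not_one_iff by blast
  have "bij_betw (\<lambda>p. map (coeff p) [0..<?a]) (carrier (GF f)) ?L"
  proof (rule bij_betwI')
    fix p q assume pq: "p \<in> carrier (GF f)" "q \<in> carrier (GF f)"
    show "(map (coeff p) [0..<?a] = map (coeff q) [0..<?a]) = (p = q)"
    proof
      assume eq: "map (coeff p) [0..<?a] = map (coeff q) [0..<?a]"
      show "p = q"
      proof (rule poly_eqI)
        fix i show "coeff p i = coeff q i"
          using eq pq by (cases "i < ?a") (auto simp: GF_def coeff_eq_0)
      qed
    qed simp
  next
    fix xs assume xs: "xs \<in> ?L"
    have len: "length xs = ?a" using xs by simp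
    have "degree (Poly xs) \<le> ?a - 1"
    proof (rule degree_le, intro allI impI)
      fix i assume "?a - 1 < i"
      then have "length xs \<le> i" using len by simp
      then show "coeff (Poly xs) i = 0" by (simp add: nth_default_beyond)
    qed
    then have "degree (Poly xs) < ?a" using assms by simp
    moreover have "map (coeff (Poly xs)) [0..<?a] = xs"
      using len by (intro nth_equalityI) (simp_all add: nth_default_nth)
    ultimately show "\<exists>p\<in>carrier (GF f). xs = map (coeff p) [0..<?a]"
      by (intro bexI[of _ "Poly xs"]) (simp_all add: GF_def)
  next
    fix p assume "p \<in> carrier (GF f)"
    show "map (coeff p) [0..<?a] \<in> ?L" by simp
  qed
  then have "card (carrier (GF f)) = card ?L"
    by (rule bij_betw_same_card)
  also have "\<dots> = card (UNIV :: bit set) ^ ?a"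
    by (rule card_lists_length_eq) (simp add: UNIVb)
  finally show ?thesis by (simp add: UNIVb numeral_2_eq_2)
qed

lemma field_GF:
  assumes f: "irreducible f"
  shows "field (GF f)"
proof -
  have f0: "f \<noteq> 0" using f by auto
  have d: "degree f > 0"
    using f f0 by (auto simp: irreducible_def is_unit_iff_degree)
  have mod_less: "degree (p mod f) < degree f" for p
    using degree_mod_less'[OF f0] d by (cases "p mod f = 0") auto
  have cring: "cring (GF f)"
  proof (rule cringI)
    show "abelian_group (GF f)"
    proof (rule abelian_groupI)
      fix x assume "x \<in> carrier (GF f)"
      then show "\<exists>y\<in>carrier (GF f). y \<oplus>\<^bsub>GF f\<^esub> x = \<zero>\<^bsub>GF f\<^esub>"
        by (intro bexI[of _ "- x"]) (auto simp: GF_def)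
    qed (use d in \<open>auto simp: GF_def degree_add_less add.assoc add.commute\<close>)
    show "comm_monoid (GF f)"
    proof (rule comm_monoidI)
      fix x y z
      show "x \<otimes>\<^bsub>GF f\<^esub> y \<otimes>\<^bsub>GF f\<^esub> z = x \<otimes>\<^bsub>GF f\<^esub> (y \<otimes>\<^bsub>GF f\<^esub> z)"
        by (simp add: GF_def mod_mult_left_eq mod_mult_right_eq mult.assoc)
    qed (use d mod_less in \<open>auto simp: GF_def mod_poly_less mult.commute\<close>)
  qed (auto simp: GF_def poly_mod_add_left distrib_right)
  have fin: "finite (carrier (GF f))"
    using card_GF[OF d] card.infinite by fastforce
  show ?thesis
  proof (rule cring.cring_fieldI2[OF cring])
    show "\<zero>\<^bsub>GF f\<^esub> \<noteq> \<one>\<^bsub>GF f\<^esub>" by (simp add: GF_def)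
    fix x assume x: "x \<in> carrier (GF f)" "x \<noteq> \<zero>\<^bsub>GF f\<^esub>"
    have "inj_on (\<lambda>y. x \<otimes>\<^bsub>GF f\<^esub> y) (carrier (GF f))"
    proof (rule inj_onI)
      fix y z
      assume yz: "y \<in> carrier (GF f)" "z \<in> carrier (GF f)"
        and "x \<otimes>\<^bsub>GF f\<^esub> y = x \<otimes>\<^bsub>GF f\<^esub> z"
      then have "(x * y - x * z) mod f = 0"
        by (simp add: GF_def poly_mod_diff_left)
      then have "f dvd x * (y - z)"
        by (simp add: mod_eq_0_iff_dvd right_diff_distrib)
      moreover have "\<not> f dvd x"
        using x by (auto simp: GF_def dest: dvd_imp_degree_le)
      ultimately have "f dvd y - z"
        using field_poly_irreducible_imp_prime[OF f] prime_elem_dvd_mult_iff by blast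
      moreover have "degree (y - z) < degree f"
        using yz by (auto simp: GF_def intro: degree_diff_less)
      ultimately show "y = z"
        by (metis dvd_imp_degree_le eq_iff_diff_eq_0 linorder_not_less)
    qed
    moreover have "(\<lambda>y. x \<otimes>\<^bsub>GF f\<^esub> y) ` carrier (GF f) \<subseteq> carrier (GF f)"
      using mod_less by (auto simp: GF_def)
    ultimately have "(\<lambda>y. x \<otimes>\<^bsub>GF f\<^esub> y) ` carrier (GF f) = carrier (GF f)"
      by (rule endo_inj_surj[OF fin, rotated])
    moreover have "\<one>\<^bsub>GF f\<^esub> \<in> carrier (GF f)" using d by (simp add: GF_def)
    ultimately show "\<exists>y\<in>carrier (GF f). x \<otimes>\<^bsub>GF f\<^esub> y = \<one>\<^bsub>GF f\<^esub>"
      by (metis imageE)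
  qed
qed

lemma card_GF_units:
  assumes "degree f > 0"
  shows "card (GF_units f) = 2 ^ degree f - 1"
  using assms card_GF[OF assms] by (simp add: GF_units_def GF_def card_Diff_singleton)


section \<open>PinSketch\<close>

definition power_sum :: "bit poly \<Rightarrow> nat \<Rightarrow> bit poly set \<Rightarrow> bit poly" where
  "power_sum f i w = (\<Oplus>\<^bsub>GF f\<^esub>x\<in>w. x [^]\<^bsub>GF f\<^esub> i)"

text \<open>The list \<open>(s\<^sub>1, s\<^sub>3, \<dots>, s\<^sub>2\<^sub>t\<^sub>-\<^sub>1)\<close>.\<close>

definition syndromes :: "bit poly \<Rightarrow> nat \<Rightarrow> bit poly set \<Rightarrow> bit poly list" where
  "syndromes f t w = map (\<lambda>j. power_sum f (2 * j + 1) w) [0..<t]"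

text \<open>A field element is written as its \<open>a\<close> coefficient bits, lowest degree first.\<close>

definition elem_bits :: "nat \<Rightarrow> bit poly \<Rightarrow> bool list" where
  "elem_bits a x = map (\<lambda>i. coeff x i = 1) [0..<a]"

definition bits_elem :: "bool list \<Rightarrow> bit poly" where
  "bits_elem bs = Poly (map of_bool bs)"

text \<open>Bit strings that are too short are read as if padded with zeros, and surplus bits are
  ignored, so that recovery is total on bit strings.\<close>

definition parse_syndromes :: "nat \<Rightarrow> nat \<Rightarrow> bool list \<Rightarrow> bit poly list" where
  "parse_syndromes a t s = map (\<lambda>j. bits_elem (take a (drop (j * a) s))) [0..<t]"

definition pinsketch_SS :: "bit poly \<Rightarrow> nat \<Rightarrow> bit poly set \<Rightarrow> bool list" where
  "pinsketch_SS f t w = concat (map (elem_bits (degree f)) (syndromes f t w))"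

definition decodes_to :: "bit poly \<Rightarrow> nat \<Rightarrow> bit poly list \<Rightarrow> bit poly set \<Rightarrow> bool" where
  "decodes_to f t \<sigma> v \<longleftrightarrow> v \<subseteq> GF_units f \<and> card v \<le> t \<and> syndromes f t v = \<sigma>"

text \<open>If there is no set to be found, recovery returns its first argument unchanged.\<close>

definition pinsketch_Rec ::
  "bit poly \<Rightarrow> nat \<Rightarrow> bit poly set \<Rightarrow> bool list \<Rightarrow> bit poly set" where
  "pinsketch_Rec f t w' s =
     (let \<sigma> = map2 (\<lambda>x' x. x' \<ominus>\<^bsub>GF f\<^esub> x)
                (syndromes f t w') (parse_syndromes (degree f) t s)
      in if \<exists>v. decodes_to f t \<sigma> v then sym_diff w' (SOME v. decodes_to f t \<sigma> v) else w')"


section \<open>Running time\<close>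

text \<open>
  Running time is measured in a first-order functional language over binary trees, in the style of
  Jones's language F. A program is a list of function bodies. Each function has one argument, which
  is variable 0 of its body; \<open>Let\<close> pushes a new variable 0. Every evaluation step has cost 1. Since
  each step only copies a pointer, allocates one cell, follows one pointer or tests for \<open>Leaf\<close>, this
  measure agrees up to a polynomial with the running time of Turing machines.
\<close>

datatype val = Leaf | Node val val

datatype expr =
    Var nat
  | LeafE
  | NodeE expr expr
  | Left expr
  | Right expr
  | IfNode expr expr expr
  | Let expr expr
  | Call nat expr

type_synonym prog = "expr list"

fun left_of :: "val \<Rightarrow> val" where
  "left_of Leaf = Leaf"
| "left_of (Node u v) = u"

fun right_of :: "val \<Rightarrow> val" where
  "right_of Leaf = Leaf"
| "right_of (Node u v) = v"

text \<open>\<open>eval P env e v k\<close>: under the environment \<open>env\<close>, \<open>e\<close> evaluates to \<open>v\<close> in \<open>k\<close> steps.\<close>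

inductive eval :: "prog \<Rightarrow> val list \<Rightarrow> expr \<Rightarrow> val \<Rightarrow> nat \<Rightarrow> bool" for P :: prog where
  eval_Var: "i < length env \<Longrightarrow> eval P env (Var i) (env ! i) 1"
| eval_LeafE: "eval P env LeafE Leaf 1"
| eval_NodeE: "eval P env e1 v1 k1 \<Longrightarrow> eval P env e2 v2 k2 \<Longrightarrow>
    eval P env (NodeE e1 e2) (Node v1 v2) (k1 + k2 + 1)"
| eval_Left: "eval P env e v k \<Longrightarrow> eval P env (Left e) (left_of v) (k + 1)"
| eval_Right: "eval P env e v k \<Longrightarrow> eval P env (Right e) (right_of v) (k + 1)"
| eval_IfNode_True: "eval P env e (Node u v) k \<Longrightarrow> eval P env e1 v1 k1 \<Longrightarrow>
    eval P env (IfNode e e1 e2) v1 (k + k1 + 1)"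
| eval_IfNode_False: "eval P env e Leaf k \<Longrightarrow> eval P env e2 v2 k2 \<Longrightarrow>
    eval P env (IfNode e e1 e2) v2 (k + k2 + 1)"
| eval_Let: "eval P env e1 v1 k1 \<Longrightarrow> eval P (v1 # env) e2 v2 k2 \<Longrightarrow>
    eval P env (Let e1 e2) v2 (k1 + k2 + 1)"
| eval_Call: "eval P env e v k \<Longrightarrow> i < length P \<Longrightarrow> eval P [v] (P ! i) v' k' \<Longrightarrow>
    eval P env (Call i e) v' (k + k' + 1)"

lemma eval_deterministic:
  "eval P env e v k \<Longrightarrow> eval P env e v' k' \<Longrightarrow> v' = v \<and> k' = k"
proof (induction arbitrary: v' k' rule: eval.induct)
  case (eval_Var i env) then show ?case by (auto elim: eval.cases)
next
  case (eval_LeafE env) then show ?case by (auto elim: eval.cases)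
next
  case (eval_NodeE env e1 v1 k1 e2 v2 k2)
  from eval_NodeE.prems eval_NodeE.IH show ?case by (cases rule: eval.cases) blast+
next
  case (eval_Left env e v k)
  from eval_Left.prems eval_Left.IH show ?case by (cases rule: eval.cases) blast+
next
  case (eval_Right env e v k)
  from eval_Right.prems eval_Right.IH show ?case by (cases rule: eval.cases) blast+
next
  case (eval_IfNode_True env e u v k e1 v1 k1 e2)
  from eval_IfNode_True.prems eval_IfNode_True.IH show ?case by (cases rule: eval.cases) blast+
next
  case (eval_IfNode_False env e k e2 v2 k2 e1)
  from eval_IfNode_False.prems eval_IfNode_False.IH show ?case by (cases rule: eval.cases) blast+
next
  case (eval_Let env e1 v1 k1 e2 v2 k2)
  from eval_Let.prems eval_Let.IH show ?case by (cases rule: eval.cases) blast+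
next
  case (eval_Call env e v k i w k2)
  from eval_Call.prems eval_Call.IH show ?case by (cases rule: eval.cases) blast+
qed

text \<open>Function 0 is the main function.\<close>

definition computes_within :: "prog \<Rightarrow> val \<Rightarrow> val \<Rightarrow> real \<Rightarrow> bool" where
  "computes_within P x y T \<longleftrightarrow> (\<exists>k. eval P [x] (Call 0 (Var 0)) y k \<and> real k \<le> T)"

definition enc_list :: "('a \<Rightarrow> val) \<Rightarrow> 'a list \<Rightarrow> val" where
  "enc_list enc xs = foldr (\<lambda>x v. Node (enc x) v) xs Leaf"

definition enc_bool :: "bool \<Rightarrow> val" where
  "enc_bool b = (if b then Node Leaf Leaf else Leaf)"

definition enc_bits :: "bool list \<Rightarrow> val" where
  "enc_bits = enc_list enc_bool"

definition enc_unary :: "nat \<Rightarrow> val" where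
  "enc_unary k = enc_list (\<lambda>_. Leaf) (replicate k ())"

text \<open>A subset is given to a program as a list of its elements, in any order.\<close>

definition enc_elems :: "bit poly \<Rightarrow> bit poly list \<Rightarrow> val" where
  "enc_elems f xs = enc_list (\<lambda>x. enc_bits (elem_bits (degree f) x)) xs"

text \<open>One program has to serve all parameters: it receives the \<open>a + 1\<close> coefficients of the modulus,
  which describe the field, and \<open>t\<close> in unary (which is harmless, as \<open>t\<close> is allowed to enter the
  running time polynomially).\<close>

definition enc_params :: "bit poly \<Rightarrow> nat \<Rightarrow> val" where
  "enc_params f t = Node (enc_bits (elem_bits (degree f + 1) f)) (enc_unary t)"

definition SS_input :: "bit poly \<Rightarrow> nat \<Rightarrow> bit poly list \<Rightarrow> val" where
  "SS_input f t xs = Node (enc_params f t) (enc_elems f xs)"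

definition Rec_input :: "bit poly \<Rightarrow> nat \<Rightarrow> bit poly list \<Rightarrow> bool list \<Rightarrow> val" where
  "Rec_input f t xs s = Node (enc_params f t) (Node (enc_elems f xs) (enc_bits s))"

definition list_of_set :: "'a list \<Rightarrow> 'a set \<Rightarrow> bool" where
  "list_of_set xs w \<longleftrightarrow> distinct xs \<and> set xs = w"

text \<open>The bound \<open>C * (1 + t + log n) ^ d\<close> is the general polynomial bound in \<open>t\<close> and \<open>log n\<close>. It is
  allowed once per element of the input set: the input may have up to \<open>n\<close> elements, and every one of
  them has to be read.\<close>

definition time_bound :: "real \<Rightarrow> nat \<Rightarrow> nat \<Rightarrow> nat \<Rightarrow> nat \<Rightarrow> real" where
  "time_bound C d n t l = C * (1 + real t + log 2 (real n)) ^ d * (1 + real l)"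

definition SS_polytime :: "prog \<Rightarrow> bool" where
  "SS_polytime P \<longleftrightarrow>
     (\<exists>C d. \<forall>f t w xs.
        irreducible f \<longrightarrow> t \<ge> 1 \<longrightarrow> w \<in> sdif (GF_units f) \<longrightarrow> list_of_set xs w \<longrightarrow>
        computes_within P (SS_input f t xs) (enc_bits (pinsketch_SS f t w))
          (time_bound C d (card (GF_units f)) t (length xs)))"

definition Rec_polytime :: "prog \<Rightarrow> bool" where
  "Rec_polytime P \<longleftrightarrow>
     (\<exists>C d. \<forall>f t w' xs s.
        irreducible f \<longrightarrow> t \<ge> 1 \<longrightarrow> w' \<in> sdif (GF_units f) \<longrightarrow> list_of_set xs w' \<longrightarrow>
        (\<exists>ys. list_of_set ys (pinsketch_Rec f t w' s) \<and>
          computes_within P (Rec_input f t xs s) (enc_elems f ys)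
            (time_bound C d (card (GF_units f)) t (length xs))))"

end

theory Submission
  imports "HOL-Algebra.Algebraic_Closure_Type" Defs
begin

text \<open>
  Security is the chain rule for average min-entropy: the sketch takes at most \<open>2\<^sup>a\<^sup>t\<close> values,
  so that it multiplies the expected guessing probability by at most this factor.

  For recovery, let \<open>v\<close> be a set of at most \<open>t\<close> nonzero elements with the given odd syndromes.
  The even ones follow from \<open>s\<^sub>2\<^sub>i = s\<^sub>i\<^sup>2\<close>. A polynomial \<open>c\<close> of degree at most \<open>t\<close> that
  satisfies \<open>\<Sum>\<^sub>k c\<^sub>k s\<^sub>j\<^sub>+\<^sub>k\<^sub>+\<^sub>1 = 0\<close> for all \<open>j < t\<close> vanishes on \<open>v\<close>, because these sums are
  \<open>\<Sum>\<^sub>x x c(x) x\<^sup>j\<close>, taken over \<open>v\<close>, and Vandermonde matrices are invertible. Gaussian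
  elimination finds such a \<open>c\<close> of degree exactly \<open>t\<close>. Each \<open>x\<close> in \<open>v\<close> is then an eigenvalue of
  the companion matrix \<open>M\<close> of \<open>c\<close>, with eigenvector \<open>(x, x\<^sup>2, \<dots>, x\<^sup>t)\<close>, and the vector of
  syndromes \<open>(s\<^sub>1, \<dots>, s\<^sub>t)\<close> is the sum of these eigenvectors. The matrix
  \<open>Tr (\<beta> M) = \<beta> M + (\<beta> M)\<^sup>2 + (\<beta> M)\<^sup>4 + \<dots>\<close> has the eigenvalues \<open>Tr (\<beta> x)\<close>, which are 0 or 1, so
  it splits the sum over \<open>v\<close> into the sums over two parts of \<open>v\<close>. When \<open>\<beta>\<close> has run through a
  basis of the field, the parts are singletons by the nondegeneracy of the trace, and the first
  coordinates of the vectors are the elements of \<open>v\<close>. Roots of \<open>c\<close> outside \<open>v\<close> do no harm, as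
  they do not contribute to the syndromes. Everything is deterministic, and no division is
  needed.
\<close>

section \<open>Executing programs\<close>

text \<open>Three views of the field are linked: residues modulo \<open>f\<close>, bit strings, and
  their values in an algebraic closure. The closure is a field as a type class, so that sums,
  polynomials and root bounds are available there without carriers, and bit strings of the right
  length are equal as soon as their values are. A bound polynomial in \<open>log n\<close> rules out
  trying all field elements as roots of the locator. Splitting vectors of power sums instead of the
  locator itself avoids polynomial gcds and a case distinction on the actual number of errors. Since
  the recovery program must answer on every bit string, the list functions are total and mirror the
  tree programs case by case; time bounds then need only upper bounds on lengths. Uniqueness of the
  decoded set needs no separate minimum distance argument: the decoder maps the syndromes of every
  admissible set back to that very set, so two such sets with the same syndromes coincide. For the
  same reason, a candidate that fails the final comparison shows that there is nothing to be
  found.\<close>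

text \<open>As evaluation is deterministic, it is a partial function, whose equations the simplifier can run.\<close>

definition run :: "prog \<Rightarrow> val list \<Rightarrow> expr \<Rightarrow> (val \<times> nat) option" where
  "run P env e = (if \<exists>p. eval P env e (fst p) (snd p)
     then Some (SOME p. eval P env e (fst p) (snd p)) else None)"

definition call :: "prog \<Rightarrow> nat \<Rightarrow> val \<Rightarrow> (val \<times> nat) option" where
  "call P i v = (if i < length P then run P [v] (P ! i) else None)"

lemma run_eq_Some: "run P env e = Some (v, k) \<longleftrightarrow> eval P env e v k"
proof
  assume "run P env e = Some (v, k)"
  then have ex: "\<exists>p. eval P env e (fst p) (snd p)"
    and "(SOME p. eval P env e (fst p) (snd p)) = (v, k)"
    by (auto simp: run_def split: if_splits)
  then show "eval P env e v k" using someI_ex[OF ex] by simp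
next
  assume ev: "eval P env e v k"
  then have ex: "\<exists>p. eval P env e (fst p) (snd p)" by (intro exI[of _ "(v, k)"]) simp
  have "(SOME p. eval P env e (fst p) (snd p)) = (v, k)"
    using eval_deterministic[OF ev someI_ex[OF ex]] by (metis prod.collapse)
  then show "run P env e = Some (v, k)" using ex by (simp add: run_def)
qed

lemma option_pair_eqI: "(\<And>v k. a = Some (v, k) \<longleftrightarrow> b = Some (v, k)) \<Longrightarrow> a = b"
  by (metis option.exhaust prod.exhaust)

inductive_cases eval_elims:
  "eval P env (Var i) v k" "eval P env LeafE v k" "eval P env (NodeE e1 e2) v k"
  "eval P env (Left e) v k" "eval P env (Right e) v k" "eval P env (IfNode e e1 e2) v k"
  "eval P env (expr.Let e1 e2) v k" "eval P env (Call i e) v k"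

text \<open>Existentials are nested and equations oriented the way unfolding
  \<open>Option.bind\<close> produces them, so that both sides of each equation in
  \<open>run_simps\<close> are rewritten to matching formulas. A single equivalence for
  \<open>IfNode\<close> covers both of its evaluation rules.\<close>

lemma eval_iffs:
  "eval P env (Var i) v k \<longleftrightarrow> i < length env \<and> env ! i = v \<and> 1 = k"
  "eval P env LeafE v k \<longleftrightarrow> Leaf = v \<and> 1 = k"
  "eval P env (NodeE e1 e2) v k \<longleftrightarrow> (\<exists>v1 k1. eval P env e1 v1 k1 \<and>
     (\<exists>v2 k2. eval P env e2 v2 k2 \<and> Node v1 v2 = v \<and> k1 + k2 + 1 = k))"
  "eval P env (Left e) v k \<longleftrightarrow> (\<exists>v1 k1. eval P env e v1 k1 \<and> left_of v1 = v \<and> k1 + 1 = k)"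
  "eval P env (Right e) v k \<longleftrightarrow> (\<exists>v1 k1. eval P env e v1 k1 \<and> right_of v1 = v \<and> k1 + 1 = k)"
  "eval P env (IfNode e e1 e2) v k \<longleftrightarrow> (\<exists>v1 k1. eval P env e v1 k1 \<and>
     (\<exists>v2 k2. (if v1 = Leaf then eval P env e2 v2 k2 else eval P env e1 v2 k2) \<and>
        v2 = v \<and> k1 + k2 + 1 = k))"
  "eval P env (expr.Let e1 e2) v k \<longleftrightarrow> (\<exists>v1 k1. eval P env e1 v1 k1 \<and>
     (\<exists>v2 k2. eval P (v1 # env) e2 v2 k2 \<and> v2 = v \<and> k1 + k2 + 1 = k))"
  "eval P env (Call i e) v k \<longleftrightarrow> (\<exists>v1 k1. eval P env e v1 k1 \<and> i < length P \<and>
     (\<exists>v2 k2. eval P [v1] (P ! i) v2 k2 \<and> v2 = v \<and> k1 + k2 + 1 = k))"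
  subgoal by (auto elim: eval_elims intro: eval.intros simp del: One_nat_def)
  subgoal by (auto elim: eval_elims intro: eval.intros simp del: One_nat_def)
  subgoal by (rule iffI, force elim: eval_elims, clarify, intro eval.intros)
  subgoal by (rule iffI, force elim: eval_elims, clarify, intro eval.intros)
  subgoal by (rule iffI, force elim: eval_elims, clarify, intro eval.intros)
  subgoal
    apply (rule iffI, force elim: eval_elims, clarify)
    subgoal for v1 k1 by (cases v1; simp del: add_Suc_right One_nat_def; blast intro: eval.intros)
    done
  subgoal by (rule iffI, force elim: eval_elims, clarify, intro eval.intros)
  subgoal by (rule iffI, force elim: eval_elims, clarify, intro eval.intros)
  done

lemma run_simps [simp]:
  "run P env (Var i) = (if i < length env then Some (env ! i, 1) else None)"
  "run P env LeafE = Some (Leaf, 1)"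
  "run P env (NodeE e1 e2) = Option.bind (run P env e1) (\<lambda>(v1, k1).
     Option.bind (run P env e2) (\<lambda>(v2, k2). Some (Node v1 v2, k1 + k2 + 1)))"
  "run P env (Left e) = Option.bind (run P env e) (\<lambda>(v, k). Some (left_of v, k + 1))"
  "run P env (Right e) = Option.bind (run P env e) (\<lambda>(v, k). Some (right_of v, k + 1))"
  "run P env (IfNode e e1 e2) = Option.bind (run P env e) (\<lambda>(v, k).
     Option.bind (if v = Leaf then run P env e2 else run P env e1)
       (\<lambda>(v1, k1). Some (v1, k + k1 + 1)))"
  "run P env (expr.Let e1 e2) = Option.bind (run P env e1) (\<lambda>(v1, k1).
     Option.bind (run P (v1 # env) e2) (\<lambda>(v2, k2). Some (v2, k1 + k2 + 1)))"
  "run P env (Call i e) = Option.bind (run P env e) (\<lambda>(v, k).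
     Option.bind (call P i v) (\<lambda>(v', k'). Some (v', k + k' + 1)))"
  by (rule option_pair_eqI, simp add: run_eq_Some bind_eq_Some_conv eval_iffs call_def
        if_distrib[of "\<lambda>x. x = Some _"] cong: if_cong del: One_nat_def; blast?)+

section \<open>Decoding on bit strings\<close>

notation (input) Node (infixr ";;" 65) and NodeE (infixr ",," 65)

type_synonym vec = "bool list list"
type_synonym mat = "bool list list list"

text \<open>The result has the shorter of the two lengths. In particular \<open>bxor x x\<close> is
  the zero string of the length of \<open>x\<close>, which is how zeros are made without knowing the
  degree.\<close>

fun bxor :: "bool list \<Rightarrow> bool list \<Rightarrow> bool list" where
  "bxor (b # x) (c # y) = (b \<noteq> c) # bxor x y"
| "bxor _ _ = []"

text \<open>Multiplication by the indeterminate modulo \<open>f\<close>, which has one bit more than \<open>x\<close>. The outer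
  \<^const>\<open>bxor\<close> with a zero string only serves to cut off the top bit.\<close>

definition bshift :: "bool list \<Rightarrow> bool list \<Rightarrow> bool list" where
  "bshift f x = bxor (bxor x x) (if x \<noteq> [] \<and> last x then bxor f (False # x) else False # x)"

text \<open>Horner's scheme in \<open>y\<close>: its lowest bit comes first, so the rest of
  \<open>y\<close> is multiplied first and the product is then shifted.\<close>

fun bmul :: "bool list \<Rightarrow> bool list \<Rightarrow> bool list \<Rightarrow> bool list" where
  "bmul f x [] = bxor x x"
| "bmul f x (b # y) =
     (if b then bxor (bshift f (bmul f x y)) x else bshift f (bmul f x y))"

fun vadd :: "vec \<Rightarrow> vec \<Rightarrow> vec" where
  "vadd (x # u) (y # v) = bxor x y # vadd u v"
| "vadd _ _ = []"

definition smul :: "bool list \<Rightarrow> bool list \<Rightarrow> vec \<Rightarrow> vec" where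
  "smul f c v = map (bmul f c) v"

text \<open>The zero vector is passed along because an empty combination does not reveal its
  length.\<close>

fun lincomb :: "bool list \<Rightarrow> vec \<Rightarrow> vec \<Rightarrow> mat \<Rightarrow> vec" where
  "lincomb f zv (c # cs) (r # rs) = vadd (smul f c r) (lincomb f zv cs rs)"
| "lincomb f zv _ _ = zv"

fun dot :: "bool list \<Rightarrow> bool list \<Rightarrow> vec \<Rightarrow> vec \<Rightarrow> bool list" where
  "dot f z (c # u) (d # v) = bxor (bmul f c d) (dot f z u v)"
| "dot f z _ _ = z"

definition matmul :: "bool list \<Rightarrow> vec \<Rightarrow> mat \<Rightarrow> mat \<Rightarrow> mat" where
  "matmul f zv A B = map (\<lambda>r. lincomb f zv r B) A"

fun madd :: "mat \<Rightarrow> mat \<Rightarrow> mat" where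
  "madd (u # A) (v # B) = vadd u v # madd A B"
| "madd _ _ = []"

definition msmul :: "bool list \<Rightarrow> bool list \<Rightarrow> mat \<Rightarrow> mat" where
  "msmul f c A = map (smul f c) A"

text \<open>The sum of \<open>B\<close> raised to \<open>2\<^sup>0, \<dots>, 2\<^sup>n\<^sup>-\<^sup>1\<close>. The summand \<open>B + B\<close> at the end is the zero matrix.\<close>

fun trmat :: "bool list \<Rightarrow> vec \<Rightarrow> nat \<Rightarrow> mat \<Rightarrow> mat" where
  "trmat f zv 0 B = madd B B"
| "trmat f zv (Suc n) B = madd B (trmat f zv n (matmul f zv B B))"

definition matvec :: "bool list \<Rightarrow> bool list \<Rightarrow> mat \<Rightarrow> vec \<Rightarrow> vec" where
  "matvec f z A v = map (\<lambda>r. dot f z r v) A"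

text \<open>Addition has characteristic 2, so \<open>v = v + v\<close> tests for the zero vector.\<close>

definition consnz :: "vec \<Rightarrow> mat \<Rightarrow> mat" where
  "consnz v L = (if v = vadd v v then L else v # L)"

text \<open>A vector of power sums of a set \<open>u\<close> is split into those of the two subsets of \<open>u\<close> on which the
  eigenvalue of \<open>T\<close> is 1 or 0. Empty subsets are dropped.\<close>

fun splits :: "bool list \<Rightarrow> bool list \<Rightarrow> mat \<Rightarrow> mat \<Rightarrow> mat" where
  "splits f z T [] = []"
| "splits f z T (v # L)
    = consnz (matvec f z T v) (consnz (vadd v (matvec f z T v)) (splits f z T L))"

text \<open>The splitting runs through the traces of \<open>\<alpha>\<^sup>j x\<close>. Cutting the list at length \<open>t\<close> has no effect on
  decodable input, and keeps the running time polynomial on all other input.\<close>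

fun sloop :: "bool list \<Rightarrow> nat \<Rightarrow> bool list \<Rightarrow> vec \<Rightarrow> mat \<Rightarrow> nat \<Rightarrow> bool list \<Rightarrow> mat \<Rightarrow> mat" where
  "sloop f t z zv M 0 b L = L"
| "sloop f t z zv M (Suc n) b L = sloop f t z zv M n (bshift f b)
     (take t (splits f z (trmat f zv (length z) (msmul f b M)) L))"

text \<open>Fraction-free Gaussian elimination. A row is the coefficient vector of a polynomial, and the
  coordinate to be eliminated is its product with the syndromes \<open>S\<close>, which are shifted by one place
  from one coordinate to the next.\<close>

definition elimmap :: "bool list \<Rightarrow> bool list \<Rightarrow> vec \<Rightarrow> vec \<Rightarrow> bool list \<Rightarrow> mat \<Rightarrow> mat" where
  "elimmap f z S p d ws = map (\<lambda>u. vadd (smul f d u) (smul f (dot f z u S) p)) ws"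

fun elim :: "bool list \<Rightarrow> bool list \<Rightarrow> vec \<Rightarrow> mat \<Rightarrow> mat" where
  "elim f z S [] = []"
| "elim f z S (w # ws) =
     (if dot f z w S = bxor (dot f z w S) (dot f z w S) then w # elim f z S ws
      else elimmap f z S w (dot f z w S) ws)"

fun eloop :: "bool list \<Rightarrow> bool list \<Rightarrow> nat \<Rightarrow> vec \<Rightarrow> mat \<Rightarrow> mat" where
  "eloop f z 0 S ws = ws"
| "eloop f z (Suc n) S ws = eloop f z n (tl S) (elim f z S ws)"

fun ident :: "bool list \<Rightarrow> nat \<Rightarrow> mat" where
  "ident z 0 = []"
| "ident z (Suc n) = ((True # tl z) # replicate n z) # map ((#) z) (ident z n)"

text \<open>Started at \<open>x\<close> with the factor \<open>x^2\<close>, this lists the odd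
  powers of \<open>x\<close>, which are its contributions to the odd syndromes.\<close>

fun pows :: "bool list \<Rightarrow> nat \<Rightarrow> bool list \<Rightarrow> bool list \<Rightarrow> vec" where
  "pows f 0 p q = []"
| "pows f (Suc n) p q = p # pows f n (bmul f p q) q"

fun ssum :: "bool list \<Rightarrow> nat \<Rightarrow> vec \<Rightarrow> vec \<Rightarrow> vec" where
  "ssum f t zv [] = zv"
| "ssum f t zv (x # xs) = vadd (pows f t x (bmul f x x)) (ssum f t zv xs)"

definition sqs :: "bool list \<Rightarrow> vec \<Rightarrow> vec" where
  "sqs f v = map (\<lambda>x. bmul f x x) v"

definition hdd :: "'a list list \<Rightarrow> 'a list" where
  "hdd v = (if v = [] then [] else hd v)"

definition lastd :: "'a list list \<Rightarrow> 'a list" where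
  "lastd v = (if v = [] then [] else last v)"

fun inter :: "vec \<Rightarrow> vec \<Rightarrow> vec" where
  "inter [] es = []"
| "inter (x # os) es = x # hdd es # inter os (tl es)"

text \<open>The missing syndromes with even index come from \<open>s\<^sub>2\<^sub>i
    = s\<^sub>i\<^sup>2\<close>. Each round interleaves the odd ones with
  the squares of the list found so far.\<close>

fun full :: "bool list \<Rightarrow> nat \<Rightarrow> vec \<Rightarrow> vec \<Rightarrow> vec" where
  "full f 0 os F = F"
| "full f (Suc n) os F = full f n os (inter os (sqs f F))"

text \<open>The length of the result is that of the first argument, whose bits are ignored.\<close>

fun pad :: "bool list \<Rightarrow> bool list \<Rightarrow> bool list" where
  "pad [] s = []"
| "pad (b # z) s = (s \<noteq> [] \<and> hd s) # pad z (tl s)"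

fun parse :: "bool list \<Rightarrow> nat \<Rightarrow> bool list \<Rightarrow> vec" where
  "parse z 0 s = []"
| "parse z (Suc n) s = pad z s # parse z n (drop (length z) s)"

text \<open>Forcing the length and dropping zeros has no effect on decodable input. On other input
  it ensures that the decoder still returns nonzero field elements.\<close>

fun heads :: "bool list \<Rightarrow> mat \<Rightarrow> vec" where
  "heads z [] = []"
| "heads z (v # L) = (if pad z (hdd v) = z then heads z L else pad z (hdd v) # heads z L)"

fun toggle :: "'a \<Rightarrow> 'a list \<Rightarrow> 'a list" where
  "toggle x [] = [x]"
| "toggle x (y # ys) = (if x = y then ys else y # toggle x ys)"

text \<open>Toggling computes symmetric differences. Started from the empty list it also turns an
  arbitrary list into a distinct one, in which elements of even multiplicity have vanished.\<close>

definition togall :: "'a list \<Rightarrow> 'a list \<Rightarrow> 'a list" where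
  "togall vs L = foldr toggle vs L"

definition unit_elem :: "bool list \<Rightarrow> bool list" where
  "unit_elem z = True # tl z"

text \<open>The row started from the highest monomial is the last one, and it never becomes a pivot on
  decodable input.\<close>

definition locator :: "bool list \<Rightarrow> nat \<Rightarrow> bool list \<Rightarrow> vec \<Rightarrow> vec" where
  "locator f t z F = lastd (eloop f z t F (ident z (Suc t)))"

text \<open>The companion matrix of the locator polynomial, multiplied by the leading coefficient so that no
  inversion is needed. Its eigenvalues are the roots times this coefficient.\<close>

definition compan :: "bool list \<Rightarrow> nat \<Rightarrow> bool list \<Rightarrow> vec \<Rightarrow> mat" where
  "compan f t z c = msmul f (lastd c) (tl (ident z t)) @ [take t c]"

text \<open>The list of classes starts with the whole set, or empty if the power sums vanish. The
  \<open>length z\<close> rounds of splitting correspond to a basis of the field.\<close>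

definition decode :: "bool list \<Rightarrow> nat \<Rightarrow> bool list \<Rightarrow> vec \<Rightarrow> vec \<Rightarrow> vec" where
  "decode f t z zv \<sigma> =
     (let F = full f t \<sigma> \<sigma>
      in togall (heads z (sloop f t z zv (compan f t z (locator f t z F)) (length z)
           (unit_elem z) (consnz (take t F) []))) [])"

text \<open>The modulus has one bit more than a field element, so its tail has the right length to
  produce the zero element.\<close>

definition ss_alg :: "bool list \<Rightarrow> nat \<Rightarrow> vec \<Rightarrow> bool list" where
  "ss_alg f t xs = (let z = bxor (tl f) (tl f) in concat (ssum f t (replicate t z) xs))"

text \<open>The syndromes of the candidate are compared with the given ones, so that undecodable input is
  recognized.\<close>

definition rec_alg :: "bool list \<Rightarrow> nat \<Rightarrow> vec \<Rightarrow> bool list \<Rightarrow> vec" where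
  "rec_alg f t xs s =
     (let z = bxor (tl f) (tl f); zv = replicate t z;
          \<sigma> = vadd (ssum f t zv xs) (parse z t s);
          v = decode f t z zv \<sigma>
      in if ssum f t zv v = \<sigma> then togall v xs else xs)"

section \<open>The programs\<close>

text \<open>Index 0 is kept for the main function. Index 1 is written \<open>Suc 0\<close>, the form
  into which the simplifier brings it.\<close>

abbreviation (input) "i_bxor \<equiv> Suc 0"
abbreviation (input) "i_last \<equiv> 2 :: nat"
abbreviation (input) "i_eq \<equiv> 3 :: nat"
abbreviation (input) "i_take \<equiv> 4 :: nat"
abbreviation (input) "i_pad \<equiv> 5 :: nat"
abbreviation (input) "i_drop \<equiv> 6 :: nat"
abbreviation (input) "i_append \<equiv> 7 :: nat"
abbreviation (input) "i_concat \<equiv> 8 :: nat"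
abbreviation (input) "i_rep \<equiv> 9 :: nat"
abbreviation (input) "i_bshift \<equiv> 10 :: nat"
abbreviation (input) "i_bmul \<equiv> 11 :: nat"
abbreviation (input) "i_vadd \<equiv> 12 :: nat"
abbreviation (input) "i_smul \<equiv> 13 :: nat"
abbreviation (input) "i_lincomb \<equiv> 14 :: nat"
abbreviation (input) "i_dot \<equiv> 15 :: nat"
abbreviation (input) "i_matmul \<equiv> 16 :: nat"
abbreviation (input) "i_madd \<equiv> 17 :: nat"
abbreviation (input) "i_msmul \<equiv> 18 :: nat"
abbreviation (input) "i_trmat \<equiv> 19 :: nat"
abbreviation (input) "i_matvec \<equiv> 20 :: nat"
abbreviation (input) "i_consnz \<equiv> 21 :: nat"
abbreviation (input) "i_splits \<equiv> 22 :: nat"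
abbreviation (input) "i_sloop \<equiv> 23 :: nat"
abbreviation (input) "i_elimmap \<equiv> 24 :: nat"
abbreviation (input) "i_elim \<equiv> 25 :: nat"
abbreviation (input) "i_eloop \<equiv> 26 :: nat"
abbreviation (input) "i_cmap \<equiv> 27 :: nat"
abbreviation (input) "i_ident \<equiv> 28 :: nat"
abbreviation (input) "i_pows \<equiv> 29 :: nat"
abbreviation (input) "i_ssum \<equiv> 30 :: nat"
abbreviation (input) "i_sqs \<equiv> 31 :: nat"
abbreviation (input) "i_inter \<equiv> 32 :: nat"
abbreviation (input) "i_full \<equiv> 33 :: nat"
abbreviation (input) "i_parse \<equiv> 34 :: nat"
abbreviation (input) "i_heads \<equiv> 35 :: nat"
abbreviation (input) "i_toggle \<equiv> 36 :: nat"
abbreviation (input) "i_togall \<equiv> 37 :: nat"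
abbreviation (input) "i_mkctx \<equiv> 38 :: nat"
abbreviation (input) "i_locator \<equiv> 39 :: nat"
abbreviation (input) "i_compan \<equiv> 40 :: nat"
abbreviation (input) "i_decode \<equiv> 41 :: nat"

abbreviation "arg \<equiv> Var 0"
abbreviation "trueE \<equiv> (LeafE ,, LeafE)"
abbreviation "xorE b c \<equiv> IfNode b (IfNode c LeafE trueE) c"
text \<open>Most functions receive a context: the modulus, \<open>t\<close> in unary, the zero element, and the zero vector
  of length \<open>t\<close>. The zero element also serves as a loop counter for the degree.\<close>

abbreviation "modE e \<equiv> Left (Left e)"
abbreviation "cntE e \<equiv> Left (Right (Left e))"
abbreviation "zeroE e \<equiv> Left (Right (Right (Left e)))"
abbreviation "zvecE e \<equiv> Right (Right (Right (Left e)))"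

section \<open>Bodies of the library functions\<close>

definition body_bxor :: expr where
  "body_bxor =
     IfNode (Left arg) (IfNode (Right arg) (xorE (Left (Left arg)) (Left (Right arg)) ,,
       Call i_bxor (Right (Left arg) ,, Right (Right arg))) LeafE) LeafE"

definition body_last :: expr where
  "body_last =
     IfNode (Right arg) (Call i_last (Right arg)) (Left arg)"

definition body_eq :: expr where
  "body_eq =
     IfNode (Left arg)
       (IfNode (Right arg)
         (IfNode (Call i_eq (Left (Left arg) ,, Left (Right arg)))
           (Call i_eq (Right (Left arg) ,, Right (Right arg))) LeafE) LeafE)
       (IfNode (Right arg) LeafE trueE)"

definition body_take :: expr where
  "body_take =
     IfNode (Left arg) (IfNode (Right arg)
       (Left (Right arg) ,, Call i_take (Right (Left arg) ,, Right (Right arg))) LeafE) LeafE"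

definition body_pad :: expr where
  "body_pad =
     IfNode (Left arg)
       (Left (Right arg) ,, Call i_pad (Right (Left arg) ,, Right (Right arg))) LeafE"

definition body_drop :: expr where
  "body_drop =
     IfNode (Left arg) (Call i_drop (Right (Left arg) ,, Right (Right arg))) (Right arg)"

definition body_append :: expr where
  "body_append =
     IfNode (Left arg)
       (Left (Left arg) ,, Call i_append (Right (Left arg) ,, Right arg)) (Right arg)"

definition body_concat :: expr where
  "body_concat =
     IfNode arg (Call i_append (Left arg ,, Call i_concat (Right arg))) LeafE"

definition body_rep :: expr where
  "body_rep =
     IfNode (Right arg)
       (Left arg ,, Call i_rep (Left arg ,, Right (Right arg))) LeafE"

definition body_bshift :: expr where
  "body_bshift =
     Call i_bxor (Call i_bxor (Right arg ,, Right arg) ,,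
       IfNode (Call i_last (Right arg))
         (Call i_bxor (Left arg ,, LeafE ,, Right arg)) (LeafE ,, Right arg))"

definition body_bmul :: expr where
  "body_bmul =
     IfNode (Right (Right arg))
       (expr.Let (Call i_bshift (Left arg ,, Call i_bmul
           (Left arg ,, Left (Right arg) ,, Right (Right (Right arg)))))
         (IfNode (Left (Right (Right (Var 1)))) (Call i_bxor (Var 0 ,, Left (Right (Var 1)))) (Var 0)))
       (Call i_bxor (Left (Right arg) ,, Left (Right arg)))"

definition body_vadd :: expr where
  "body_vadd =
     IfNode (Left arg) (IfNode (Right arg) (Call i_bxor (Left (Left arg) ,, Left (Right arg)) ,,
       Call i_vadd (Right (Left arg) ,, Right (Right arg))) LeafE) LeafE"

definition body_smul :: expr where
  "body_smul =
     IfNode (Right (Right arg))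
       (Call i_bmul (Left arg ,, Left (Right arg) ,, Left (Right (Right arg))) ,,
         Call i_smul (Left arg ,, Left (Right arg) ,, Right (Right (Right arg))))
       LeafE"

definition body_lincomb :: expr where
  "body_lincomb =
     IfNode (Left (Right arg)) (IfNode (Right (Right arg))
       (Call i_vadd (Call i_smul (modE arg ,, Left (Left (Right arg)) ,, Left (Right (Right arg))) ,,
         Call i_lincomb (Left arg ,, Right (Left (Right arg)) ,, Right (Right (Right arg)))))
       (zvecE arg)) (zvecE arg)"

definition body_dot :: expr where
  "body_dot =
     IfNode (Left (Right arg)) (IfNode (Right (Right arg))
       (Call i_bxor (Call i_bmul (modE arg ,, Left (Left (Right arg)) ,, Left (Right (Right arg))) ,,
         Call i_dot (Left arg ,, Right (Left (Right arg)) ,, Right (Right (Right arg)))))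
       (zeroE arg)) (zeroE arg)"

definition body_matmul :: expr where
  "body_matmul =
     IfNode (Left (Right arg))
       (Call i_lincomb (Left arg ,, Left (Left (Right arg)) ,, Right (Right arg)) ,,
         Call i_matmul (Left arg ,, Right (Left (Right arg)) ,, Right (Right arg)))
       LeafE"

definition body_madd :: expr where
  "body_madd =
     IfNode (Left arg) (IfNode (Right arg) (Call i_vadd (Left (Left arg) ,, Left (Right arg)) ,,
       Call i_madd (Right (Left arg) ,, Right (Right arg))) LeafE) LeafE"

definition body_msmul :: expr where
  "body_msmul =
     IfNode (Right (Right arg))
       (Call i_smul (Left arg ,, Left (Right arg) ,, Left (Right (Right arg))) ,,
         Call i_msmul (Left arg ,, Left (Right arg) ,, Right (Right (Right arg))))
       LeafE"

definition body_trmat :: expr where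
  "body_trmat =
     IfNode (Left (Right arg))
       (Call i_madd (Right (Right arg) ,, Call i_trmat (Left arg ,,
         Right (Left (Right arg)) ,,
           Call i_matmul (Left arg ,, Right (Right arg) ,, Right (Right arg)))))
       (Call i_madd (Right (Right arg) ,, Right (Right arg)))"

definition body_matvec :: expr where
  "body_matvec =
     IfNode (Left (Right arg))
       (Call i_dot (Left arg ,, Left (Left (Right arg)) ,, Right (Right arg)) ,,
         Call i_matvec (Left arg ,, Right (Left (Right arg)) ,, Right (Right arg)))
       LeafE"

definition body_consnz :: expr where
  "body_consnz =
     IfNode (Call i_eq (Left arg ,, Call i_vadd (Left arg ,, Left arg))) (Right arg) arg"

definition body_splits :: expr where
  "body_splits =
     IfNode (Right (Right arg))
       (expr.Let (Call i_matvec (Left arg ,, Left (Right arg) ,, Left (Right (Right arg))))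
         (Call i_consnz (Var 0 ,, Call i_consnz
           (Call i_vadd (Left (Right (Right (Var 1))) ,, Var 0) ,,
             Call i_splits (Left (Var 1) ,,
               Left (Right (Var 1)) ,, Right (Right (Right (Var 1)))))))) LeafE"

definition body_sloop :: expr where
  "body_sloop =
     IfNode (Left (Right (Right arg)))
       (Call i_sloop (Left arg ,, Left (Right arg) ,, Right (Left (Right (Right arg))) ,,
         Call i_bshift (modE arg ,, Left (Right (Right (Right arg)))) ,,
           Call i_take (cntE arg ,, Call i_splits (Left arg ,,
             Call i_trmat (Left arg ,, zeroE arg ,, Call i_msmul
               (modE arg ,, Left (Right (Right (Right arg))) ,, Left (Right arg))) ,,
               Right (Right (Right (Right arg)))))))
       (Right (Right (Right (Right arg))))"

definition body_elimmap :: expr where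
  "body_elimmap =
     IfNode (Right (Right arg))
       (Call i_vadd (Call i_smul (modE arg ,, Right (Right (Left (Right arg))) ,, Left (Right (Right arg))) ,,
           Call i_smul (modE arg ,, Call i_dot (Left arg ,,
               Left (Right (Right arg)) ,, Left (Left (Right arg))) ,,
             Left (Right (Left (Right arg))))) ,,
         Call i_elimmap (Left arg ,, Left (Right arg) ,, Right (Right (Right arg))))
       LeafE"

definition body_elim :: expr where
  "body_elim =
     IfNode (Right (Right arg))
       (expr.Let (Call i_dot (Left arg ,, Left (Right (Right arg)) ,, Left (Right arg)))
         (IfNode (Call i_eq (Var 0 ,, Call i_bxor (Var 0 ,, Var 0)))
           (Left (Right (Right (Var 1))) ,, Call i_elim (Left (Var 1) ,,
             Left (Right (Var 1)) ,, Right (Right (Right (Var 1)))))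
           (Call i_elimmap (Left (Var 1) ,, (Left (Right (Var 1)) ,,
             Left (Right (Right (Var 1))) ,, Var 0) ,, Right (Right (Right (Var 1)))))))
       LeafE"

definition body_eloop :: expr where
  "body_eloop =
     IfNode (Left (Right arg))
       (Call i_eloop (Left arg ,, Right (Left (Right arg)) ,,
         Right (Left (Right (Right arg))) ,,
           Call i_elim (Left arg ,, Right (Right arg))))
       (Right (Right (Right arg)))"

definition body_cmap :: expr where
  "body_cmap =
     IfNode (Right arg)
       ((Left arg ,, Left (Right arg)) ,, Call i_cmap (Left arg ,, Right (Right arg)))
       LeafE"

definition body_ident :: expr where
  "body_ident =
     IfNode (Right arg)
       (((trueE ,, Right (Left arg)) ,, Call i_rep (Left arg ,, Right (Right arg))) ,,
         Call i_cmap (Left arg ,, Call i_ident (Left arg ,, Right (Right arg))))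
       LeafE"

definition body_pows :: expr where
  "body_pows =
     IfNode (Left (Right arg))
       (Left (Right (Right arg)) ,, Call i_pows (Left arg ,, Right (Left (Right arg)) ,,
         Call i_bmul (Left arg ,, Right (Right arg)) ,, Right (Right (Right arg))))
       LeafE"

definition body_ssum :: expr where
  "body_ssum =
     IfNode (Right arg)
       (Call i_vadd (Call i_pows (modE arg ,, cntE arg ,, Left (Right arg) ,,
           Call i_bmul (modE arg ,, Left (Right arg) ,, Left (Right arg))) ,,
         Call i_ssum (Left arg ,, Right (Right arg))))
       (zvecE arg)"

definition body_sqs :: expr where
  "body_sqs =
     IfNode (Right arg)
       (Call i_bmul (Left arg ,, Left (Right arg) ,, Left (Right arg)) ,,
         Call i_sqs (Left arg ,, Right (Right arg)))
       LeafE"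

definition body_inter :: expr where
  "body_inter =
     IfNode (Left arg)
       (Left (Left arg) ,, Left (Right arg) ,,
         Call i_inter (Right (Left arg) ,, Right (Right arg)))
       LeafE"

definition body_full :: expr where
  "body_full =
     IfNode (Left (Right arg))
       (Call i_full (Left arg ,, Right (Left (Right arg)) ,, Left (Right (Right arg)) ,,
         Call i_inter (Left (Right (Right arg)) ,,
           Call i_sqs (Left arg ,, Right (Right (Right arg))))))
       (Right (Right (Right arg)))"

definition body_parse :: expr where
  "body_parse =
     IfNode (Left (Right arg))
       (Call i_pad (Left arg ,, Right (Right arg)) ,,
         Call i_parse (Left arg ,, Right (Left (Right arg)) ,,
           Call i_drop (Left arg ,, Right (Right arg))))
       LeafE"

definition body_heads :: expr where
  "body_heads =
     IfNode (Right arg)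
       (expr.Let (Call i_pad (Left arg ,, Left (Left (Right arg))))
         (IfNode (Call i_eq (Var 0 ,, Left (Var 1)))
           (Call i_heads (Left (Var 1) ,, Right (Right (Var 1))))
           (Var 0 ,, Call i_heads (Left (Var 1) ,, Right (Right (Var 1))))))
       LeafE"

definition body_toggle :: expr where
  "body_toggle =
     IfNode (Right arg)
       (IfNode (Call i_eq (Left arg ,, Left (Right arg))) (Right (Right arg))
         (Left (Right arg) ,, Call i_toggle (Left arg ,, Right (Right arg))))
       (Left arg ,, LeafE)"

definition body_togall :: expr where
  "body_togall =
     IfNode (Left arg)
       (Call i_toggle (Left (Left arg) ,, Call i_togall (Right (Left arg) ,, Right arg)))
       (Right arg)"

definition body_mkctx :: expr where
  "body_mkctx =
     expr.Let (Call i_bxor (Right (Left arg) ,, Right (Left arg)))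
       (Left (Var 1) ,, Right (Var 1) ,,
         Var 0 ,, Call i_rep (Var 0 ,, Right (Var 1)))"

definition body_locator :: expr where
  "body_locator =
     Call i_last (Call i_eloop (Left arg ,, cntE arg ,, Right arg ,,
       Call i_ident (zeroE arg ,, LeafE ,, cntE arg)))"

definition body_compan :: expr where
  "body_compan =
     Call i_append (Call i_msmul (modE arg ,, Call i_last (Right arg) ,,
         Right (Call i_ident (zeroE arg ,, cntE arg))) ,,
       Call i_take (cntE arg ,, Right arg) ,, LeafE)"

definition body_decode :: expr where
  "body_decode =
     expr.Let (Call i_full (modE arg ,, cntE arg ,, Right arg ,, Right arg))
       (Call i_togall (Call i_heads (zeroE (Var 1) ,, Call i_sloop (Left (Var 1) ,,
         Call i_compan (Left (Var 1) ,, Call i_locator (Left (Var 1) ,, Var 0)) ,,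
           zeroE (Var 1) ,, (trueE ,, Right (zeroE (Var 1))) ,,
             Call i_consnz (Call i_take (cntE (Var 1) ,, Var 0) ,, LeafE))) ,, LeafE))"

text \<open>With the main function as a parameter, the library and all statements about it serve the
  sketch and the recovery program alike.\<close>

definition prog :: "expr \<Rightarrow> prog" where
  "prog m = m # [body_bxor, body_last, body_eq, body_take, body_pad, body_drop, body_append,
     body_concat, body_rep, body_bshift, body_bmul, body_vadd, body_smul, body_lincomb,
     body_dot, body_matmul, body_madd, body_msmul, body_trmat, body_matvec, body_consnz,
     body_splits, body_sloop, body_elimmap, body_elim, body_eloop, body_cmap, body_ident,
     body_pows, body_ssum, body_sqs, body_inter, body_full, body_parse, body_heads,
     body_toggle, body_togall, body_mkctx, body_locator, body_compan, body_decode]"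

text \<open>Not given to the simplifier, which would unfold recursive bodies forever. Each proof
  unfolds one call by \<open>subst\<close> and runs the calls inside by induction hypotheses and
  earlier rules.\<close>

lemma prog_unfold:
  "call (prog m) i_bxor v = run (prog m) [v] body_bxor"
  "call (prog m) i_last v = run (prog m) [v] body_last"
  "call (prog m) i_eq v = run (prog m) [v] body_eq"
  "call (prog m) i_take v = run (prog m) [v] body_take"
  "call (prog m) i_pad v = run (prog m) [v] body_pad"
  "call (prog m) i_drop v = run (prog m) [v] body_drop"
  "call (prog m) i_append v = run (prog m) [v] body_append"
  "call (prog m) i_concat v = run (prog m) [v] body_concat"
  "call (prog m) i_rep v = run (prog m) [v] body_rep"
  "call (prog m) i_bshift v = run (prog m) [v] body_bshift"
  "call (prog m) i_bmul v = run (prog m) [v] body_bmul"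
  "call (prog m) i_vadd v = run (prog m) [v] body_vadd"
  "call (prog m) i_smul v = run (prog m) [v] body_smul"
  "call (prog m) i_lincomb v = run (prog m) [v] body_lincomb"
  "call (prog m) i_dot v = run (prog m) [v] body_dot"
  "call (prog m) i_matmul v = run (prog m) [v] body_matmul"
  "call (prog m) i_madd v = run (prog m) [v] body_madd"
  "call (prog m) i_msmul v = run (prog m) [v] body_msmul"
  "call (prog m) i_trmat v = run (prog m) [v] body_trmat"
  "call (prog m) i_matvec v = run (prog m) [v] body_matvec"
  "call (prog m) i_consnz v = run (prog m) [v] body_consnz"
  "call (prog m) i_splits v = run (prog m) [v] body_splits"
  "call (prog m) i_sloop v = run (prog m) [v] body_sloop"
  "call (prog m) i_elimmap v = run (prog m) [v] body_elimmap"
  "call (prog m) i_elim v = run (prog m) [v] body_elim"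
  "call (prog m) i_eloop v = run (prog m) [v] body_eloop"
  "call (prog m) i_cmap v = run (prog m) [v] body_cmap"
  "call (prog m) i_ident v = run (prog m) [v] body_ident"
  "call (prog m) i_pows v = run (prog m) [v] body_pows"
  "call (prog m) i_ssum v = run (prog m) [v] body_ssum"
  "call (prog m) i_sqs v = run (prog m) [v] body_sqs"
  "call (prog m) i_inter v = run (prog m) [v] body_inter"
  "call (prog m) i_full v = run (prog m) [v] body_full"
  "call (prog m) i_parse v = run (prog m) [v] body_parse"
  "call (prog m) i_heads v = run (prog m) [v] body_heads"
  "call (prog m) i_toggle v = run (prog m) [v] body_toggle"
  "call (prog m) i_togall v = run (prog m) [v] body_togall"
  "call (prog m) i_mkctx v = run (prog m) [v] body_mkctx"
  "call (prog m) i_locator v = run (prog m) [v] body_locator"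
  "call (prog m) i_compan v = run (prog m) [v] body_compan"
  "call (prog m) i_decode v = run (prog m) [v] body_decode"
  by (simp_all add: call_def prog_def)

lemmas unf_bxor = prog_unfold(1)[unfolded body_bxor_def]
lemmas unf_last = prog_unfold(2)[unfolded body_last_def]
lemmas unf_eq = prog_unfold(3)[unfolded body_eq_def]
lemmas unf_take = prog_unfold(4)[unfolded body_take_def]
lemmas unf_pad = prog_unfold(5)[unfolded body_pad_def]
lemmas unf_drop = prog_unfold(6)[unfolded body_drop_def]
lemmas unf_append = prog_unfold(7)[unfolded body_append_def]
lemmas unf_concat = prog_unfold(8)[unfolded body_concat_def]
lemmas unf_rep = prog_unfold(9)[unfolded body_rep_def]
lemmas unf_bshift = prog_unfold(10)[unfolded body_bshift_def]
lemmas unf_bmul = prog_unfold(11)[unfolded body_bmul_def]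
lemmas unf_vadd = prog_unfold(12)[unfolded body_vadd_def]
lemmas unf_smul = prog_unfold(13)[unfolded body_smul_def]
lemmas unf_lincomb = prog_unfold(14)[unfolded body_lincomb_def]
lemmas unf_dot = prog_unfold(15)[unfolded body_dot_def]
lemmas unf_matmul = prog_unfold(16)[unfolded body_matmul_def]
lemmas unf_madd = prog_unfold(17)[unfolded body_madd_def]
lemmas unf_msmul = prog_unfold(18)[unfolded body_msmul_def]
lemmas unf_trmat = prog_unfold(19)[unfolded body_trmat_def]
lemmas unf_matvec = prog_unfold(20)[unfolded body_matvec_def]
lemmas unf_consnz = prog_unfold(21)[unfolded body_consnz_def]
lemmas unf_splits = prog_unfold(22)[unfolded body_splits_def]
lemmas unf_sloop = prog_unfold(23)[unfolded body_sloop_def]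
lemmas unf_elimmap = prog_unfold(24)[unfolded body_elimmap_def]
lemmas unf_elim = prog_unfold(25)[unfolded body_elim_def]
lemmas unf_eloop = prog_unfold(26)[unfolded body_eloop_def]
lemmas unf_cmap = prog_unfold(27)[unfolded body_cmap_def]
lemmas unf_ident = prog_unfold(28)[unfolded body_ident_def]
lemmas unf_pows = prog_unfold(29)[unfolded body_pows_def]
lemmas unf_ssum = prog_unfold(30)[unfolded body_ssum_def]
lemmas unf_sqs = prog_unfold(31)[unfolded body_sqs_def]
lemmas unf_inter = prog_unfold(32)[unfolded body_inter_def]
lemmas unf_full = prog_unfold(33)[unfolded body_full_def]
lemmas unf_parse = prog_unfold(34)[unfolded body_parse_def]
lemmas unf_heads = prog_unfold(35)[unfolded body_heads_def]
lemmas unf_toggle = prog_unfold(36)[unfolded body_toggle_def]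
lemmas unf_togall = prog_unfold(37)[unfolded body_togall_def]
lemmas unf_mkctx = prog_unfold(38)[unfolded body_mkctx_def]
lemmas unf_locator = prog_unfold(39)[unfolded body_locator_def]
lemmas unf_compan = prog_unfold(40)[unfolded body_compan_def]
lemmas unf_decode = prog_unfold(41)[unfolded body_decode_def]

lemma call_main: "call (prog m) 0 v = run (prog m) [v] m"
  by (simp add: call_def prog_def)

text \<open>The cost is arbitrary for calls that do not terminate.\<close>

definition cost :: "expr \<Rightarrow> nat \<Rightarrow> val \<Rightarrow> nat" where
  "cost m i v = snd (the (call (prog m) i v))"

text \<open>Termination with the right value is proved for an unspecified step count, which
  \<open>cost\<close> then names. Bounds on it are proved separately.\<close>

lemma call_costI: "\<exists>k. call (prog m) i v = Some (r, k) \<Longrightarrow> call (prog m) i v = Some (r, cost m i v)"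
  by (auto simp: cost_def)

lemma cost_leI: "\<exists>r k. call (prog m) i v = Some (r, k) \<and> k \<le> B \<Longrightarrow> cost m i v \<le> B"
  by (auto simp: cost_def)

section \<open>Encoding of bits, elements, vectors and matrices as trees\<close>

lemma enc_list_simps [simp]:
  "enc_list e [] = Leaf"
  "enc_list e (x # xs) = e x ;; enc_list e xs"
  by (simp_all add: enc_list_def)

lemma enc_list_eq_Leaf [simp]: "enc_list e xs = Leaf \<longleftrightarrow> xs = []"
  by (cases xs) auto

lemma enc_bool_simps [simp]: "enc_bool True = Leaf ;; Leaf" "enc_bool False = Leaf"
  by (simp_all add: enc_bool_def)

lemma enc_bool_eq_Leaf [simp]: "enc_bool b = Leaf \<longleftrightarrow> \<not> b"
  by (cases b) auto

lemma right_of_enc_list [simp]: "right_of (enc_list e xs) = enc_list e (tl xs)"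
  by (cases xs) auto

lemma left_of_enc_list_list [simp]:
  "left_of (enc_list (enc_list e) xs) = enc_list e (hdd xs)"
  by (cases xs) (auto simp: hdd_def)

lemma left_of_enc_list_bool [simp]:
  "left_of (enc_list enc_bool s) = enc_bool (s \<noteq> [] \<and> hd s)"
  by (cases s) auto

text \<open>Needed because the programs test equality of trees where the list functions test
  equality of lists.\<close>

lemma inj_enc_list: "inj e \<Longrightarrow> inj (enc_list e)"
proof (rule injI)
  fix xs ys assume "inj e" "enc_list e xs = enc_list e ys"
  then show "xs = ys"
  proof (induction xs arbitrary: ys)
    case Nil then show ?case by (cases ys) auto
  next
    case (Cons x xs) then show ?case by (cases ys) (auto dest: injD)
  qed
qed

lemma inj_enc_bool: "inj enc_bool"
  by (rule injI) (auto simp: enc_bool_def split: if_splits)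

abbreviation enc_el :: "bool list \<Rightarrow> val" where "enc_el \<equiv> enc_list enc_bool"
abbreviation enc_vec :: "vec \<Rightarrow> val" where "enc_vec \<equiv> enc_list enc_el"
abbreviation enc_mat :: "mat \<Rightarrow> val" where "enc_mat \<equiv> enc_list enc_vec"

lemma enc_el_inject [simp]: "enc_el x = enc_el y \<longleftrightarrow> x = y"
  using inj_enc_list[OF inj_enc_bool] by (auto dest: injD)

lemma enc_vec_inject [simp]: "enc_vec x = enc_vec y \<longleftrightarrow> x = y"
  using inj_enc_list[OF inj_enc_list[OF inj_enc_bool]] by (auto dest: injD)

definition enc_ctx :: "bool list \<Rightarrow> nat \<Rightarrow> bool list \<Rightarrow> vec \<Rightarrow> val" where
  "enc_ctx f t z zv = enc_el f ;; enc_unary t ;; enc_el z ;; enc_vec zv"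

lemma enc_ctx_simps [simp]:
  "left_of (enc_ctx f t z zv) = enc_el f"
  "left_of (right_of (enc_ctx f t z zv)) = enc_unary t"
  "left_of (right_of (right_of (enc_ctx f t z zv))) = enc_el z"
  "right_of (right_of (right_of (enc_ctx f t z zv))) = enc_vec zv"
  by (simp_all add: enc_ctx_def)

lemma enc_unary_simps [simp]:
  "enc_unary 0 = Leaf" "enc_unary (Suc n) = Leaf ;; enc_unary n"
  by (simp_all add: enc_unary_def)

text \<open>On the empty list \<open>i_last\<close> returns \<open>Leaf\<close>. Folding with this
  equation and the next one presents the result as an encoding again, with default value
  \<open>False\<close> or \<open>[]\<close>.\<close>

lemma enc_bool_last: "enc_bool (s \<noteq> [] \<and> last s) = (if s = [] then Leaf else enc_bool (last s))"
  by simp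

lemma enc_list_lastd: "enc_list e (lastd xs) = (if xs = [] then Leaf else enc_list e (last xs))"
  by (simp add: lastd_def)

section \<open>Values returned by the library functions\<close>

context
  fixes m :: expr
begin

abbreviation (input) returns :: "nat \<Rightarrow> val \<Rightarrow> val \<Rightarrow> bool" where
  "returns i v r \<equiv> call (prog m) i v = Some (r, cost m i v)"

lemma call_bxor [simp]:
  "returns i_bxor (enc_el x ;; enc_el y)
     (enc_el (bxor x y))"
  by (rule call_costI, induction x y rule: bxor.induct; subst unf_bxor; auto)

lemma call_last:
  "returns i_last (enc_list e xs)
     (if xs = [] then Leaf else e (last xs))"
  by (rule call_costI, induction xs; subst unf_last; auto)

lemmas call_last_bool [simp] = call_last[of enc_bool, folded enc_bool_last]
lemmas call_last_list [simp] = call_last[of "enc_list e" for e, folded enc_list_lastd]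

lemma call_eq [simp]:
  "returns i_eq (u ;; v)
     (enc_bool (u = v))"
proof (rule call_costI, induction u arbitrary: v)
  case Leaf
  show ?case by (subst unf_eq) auto
next
  case (Node u1 u2)
  show ?case
  proof (cases v)
    case Leaf
    then show ?thesis by (subst unf_eq) auto
  next
    case (Node v1 v2)
    from Node.IH(1)[of v1] Node.IH(2)[of v2] show ?thesis unfolding Node by (subst unf_eq) auto
  qed
qed

lemma call_take [simp]:
  "returns i_take (enc_unary n ;; enc_list e xs)
     (enc_list e (take n xs))"
proof (rule call_costI, induction n arbitrary: xs)
  case (Suc n)
  from Suc[of "tl xs"] show ?case by (cases xs; subst unf_take) auto
qed (subst unf_take, simp)

lemma call_pad [simp]:
  "returns i_pad (enc_el z ;; enc_el s)
     (enc_el (pad z s))"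
  by (rule call_costI, induction z s rule: pad.induct; subst unf_pad; auto)

lemma call_drop [simp]:
  "returns i_drop (enc_list e ns ;; enc_list e' xs)
     (enc_list e' (drop (length ns) xs))"
proof (rule call_costI, induction ns arbitrary: xs)
  case (Cons n ns)
  from Cons[of "tl xs"] show ?case by (subst unf_drop) (auto simp: drop_Suc)
qed (subst unf_drop, simp)

lemma call_append [simp]:
  "returns i_append (enc_list e xs ;; enc_list e ys)
     (enc_list e (xs @ ys))"
  by (rule call_costI, induction xs; subst unf_append; auto)

lemma call_concat [simp]:
  "returns i_concat (enc_list (enc_list e) xs)
     (enc_list e (concat xs))"
  by (rule call_costI, induction xs; subst unf_concat; auto)

lemma call_rep:
  "returns i_rep (e x ;; enc_unary n)
     (enc_list e (replicate n x))"
  by (rule call_costI, induction n; subst unf_rep; auto)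

lemmas call_rep_el [simp] = call_rep[of enc_el]

lemma call_bshift [simp]:
  "returns i_bshift (enc_el f ;; enc_el x)
     (enc_el (bshift f x))"
  using call_bxor[of f "False # x"] call_bxor[of "bxor x x" "False # x"]
  by (intro call_costI, subst unf_bshift) (auto simp: bshift_def)

lemma call_bmul [simp]:
  "returns i_bmul (enc_el f ;; enc_el x ;; enc_el y)
     (enc_el (bmul f x y))"
proof (rule call_costI, induction y)
  case (Cons b y)
  then show ?case by (cases b; subst unf_bmul) auto
qed (subst unf_bmul, simp)

lemma call_vadd [simp]:
  "returns i_vadd (enc_vec u ;; enc_vec v)
     (enc_vec (vadd u v))"
  by (rule call_costI, induction u v rule: vadd.induct; subst unf_vadd; auto simp: hdd_def)

lemma call_smul [simp]:
  "returns i_smul (enc_el f ;; enc_el c ;; enc_vec v)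
     (enc_vec (smul f c v))"
  by (rule call_costI, induction v; subst unf_smul; auto simp: smul_def)

lemma call_lincomb [simp]:
  "returns i_lincomb (enc_ctx f t z zv ;; enc_vec cs ;; enc_mat rs)
     (enc_vec (lincomb f zv cs rs))"
  by (rule call_costI, induction f zv cs rs rule: lincomb.induct; subst unf_lincomb; auto)

lemma call_dot [simp]:
  "returns i_dot (enc_ctx f t z zv ;; enc_vec u ;; enc_vec v)
     (enc_el (dot f z u v))"
  by (rule call_costI, induction u v rule: vadd.induct; subst unf_dot; auto)

lemma call_matmul [simp]:
  "returns i_matmul (enc_ctx f t z zv ;; enc_mat A ;; enc_mat B)
     (enc_mat (matmul f zv A B))"
  by (rule call_costI, induction A; subst unf_matmul; auto simp: matmul_def)

lemma call_madd [simp]: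
  "returns i_madd (enc_mat A ;; enc_mat B)
     (enc_mat (madd A B))"
  by (rule call_costI, induction A B rule: madd.induct; subst unf_madd; auto)

lemma call_msmul [simp]:
  "returns i_msmul (enc_el f ;; enc_el c ;; enc_mat A)
     (enc_mat (msmul f c A))"
  by (rule call_costI, induction A; subst unf_msmul; auto simp: msmul_def)

lemma call_trmat [simp]:
  "returns i_trmat (enc_ctx f t z zv ;; enc_list e ns ;; enc_mat B)
     (enc_mat (trmat f zv (length ns) B))"
proof (rule call_costI, induction ns arbitrary: B)
  case (Cons n ns)
  from Cons[of "matmul f zv B B"] show ?case by (subst unf_trmat) auto
qed (subst unf_trmat, simp)

lemma call_matvec [simp]:
  "returns i_matvec (enc_ctx f t z zv ;; enc_mat A ;; enc_vec v)
     (enc_vec (matvec f z A v))"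
  by (rule call_costI, induction A; subst unf_matvec; auto simp: matvec_def)

lemma call_consnz [simp]:
  "returns i_consnz (enc_vec v ;; enc_mat L)
     (enc_mat (consnz v L))"
  by (rule call_costI, subst unf_consnz; auto simp: consnz_def)

lemma call_splits [simp]:
  "returns i_splits (enc_ctx f t z zv ;; enc_mat T ;; enc_mat L)
     (enc_mat (splits f z T L))"
  by (rule call_costI, induction L; subst unf_splits; auto)

lemma call_sloop [simp]:
  "returns i_sloop (enc_ctx f t z zv ;; enc_mat M ;; enc_list e ns ;; enc_el b ;; enc_mat L)
     (enc_mat (sloop f t z zv M (length ns) b L))"
proof (rule call_costI, induction ns arbitrary: b L)
  case (Cons n ns)
  from Cons[of "bshift f b" "take t (splits f z (trmat f zv (length z) (msmul f b M)) L)"]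
  show ?case by (subst unf_sloop) auto
qed (subst unf_sloop, simp)

lemma call_elimmap [simp]:
  "returns i_elimmap (enc_ctx f t z zv ;; (enc_vec S ;; enc_vec p ;; enc_el d) ;; enc_mat ws)
     (enc_mat (elimmap f z S p d ws))"
  by (rule call_costI, induction ws; subst unf_elimmap; auto simp: elimmap_def)

lemma call_elim [simp]:
  "returns i_elim (enc_ctx f t z zv ;; enc_vec S ;; enc_mat ws)
     (enc_mat (elim f z S ws))"
  by (rule call_costI, induction ws; subst unf_elim; auto)

lemma call_eloop [simp]:
  "returns i_eloop (enc_ctx f t z zv ;; enc_unary n ;; enc_vec S ;; enc_mat ws)
     (enc_mat (eloop f z n S ws))"
proof (rule call_costI, induction n arbitrary: S ws)
  case (Suc n)
  from Suc[of "tl S" "elim f z S ws"] show ?case by (subst unf_eloop) auto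
qed (subst unf_eloop, simp)

lemma call_cmap [simp]:
  "returns i_cmap (enc_el z ;; enc_mat A)
     (enc_mat (map ((#) z) A))"
  by (rule call_costI, induction A; subst unf_cmap; auto)

lemma call_ident [simp]:
  "returns i_ident (enc_el z ;; enc_unary n)
     (enc_mat (ident z n))"
  by (rule call_costI, induction n; subst unf_ident; auto)

lemma call_pows [simp]:
  "returns i_pows (enc_el f ;; enc_unary n ;; enc_el p ;; enc_el q)
     (enc_vec (pows f n p q))"
proof (rule call_costI, induction n arbitrary: p)
  case (Suc n)
  from Suc[of "bmul f p q"] show ?case by (subst unf_pows) auto
qed (subst unf_pows, simp)

lemma call_ssum [simp]:
  "returns i_ssum (enc_ctx f t z zv ;; enc_vec xs)
     (enc_vec (ssum f t zv xs))"
  by (rule call_costI, induction xs; subst unf_ssum; auto simp: hdd_def)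

lemma call_sqs [simp]:
  "returns i_sqs (enc_el f ;; enc_vec v)
     (enc_vec (sqs f v))"
  by (rule call_costI, induction v; subst unf_sqs; auto simp: sqs_def hdd_def)

lemma call_inter [simp]:
  "returns i_inter (enc_vec u ;; enc_vec v)
     (enc_vec (inter u v))"
  by (rule call_costI, induction u v rule: inter.induct; subst unf_inter; auto simp: hdd_def)

lemma call_full [simp]:
  "returns i_full (enc_el f ;; enc_unary n ;; enc_vec u ;; enc_vec F)
     (enc_vec (full f n u F))"
proof (rule call_costI, induction n arbitrary: F)
  case (Suc n)
  from Suc[of "inter u (sqs f F)"] show ?case by (subst unf_full) auto
qed (subst unf_full, simp)

lemma call_parse [simp]:
  "returns i_parse (enc_el z ;; enc_unary n ;; enc_el s)
     (enc_vec (parse z n s))"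
proof (rule call_costI, induction n arbitrary: s)
  case (Suc n)
  from Suc[of "drop (length z) s"] show ?case by (subst unf_parse) auto
qed (subst unf_parse, simp)

lemma call_heads [simp]:
  "returns i_heads (enc_el z ;; enc_mat L)
     (enc_vec (heads z L))"
  by (rule call_costI, induction L; subst unf_heads; auto)

lemma call_toggle [simp]:
  "returns i_toggle (enc_el x ;; enc_vec L)
     (enc_vec (toggle x L))"
  by (rule call_costI, induction L; subst unf_toggle; auto simp: hdd_def)

lemma call_togall [simp]:
  "returns i_togall (enc_vec vs ;; enc_vec L)
     (enc_vec (togall vs L))"
  by (rule call_costI, induction vs; subst unf_togall; auto simp: togall_def hdd_def)

lemma call_mkctx [simp]:
  "returns i_mkctx (enc_el f ;; enc_unary t)
     (enc_ctx f t (bxor (tl f) (tl f)) (replicate t (bxor (tl f) (tl f))))"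
  by (rule call_costI, subst unf_mkctx) (auto simp: enc_ctx_def)

lemma call_locator [simp]:
  "returns i_locator (enc_ctx f t z zv ;; enc_vec F)
     (enc_vec (locator f t z F))"
  using call_ident[of z "Suc t"]
      by (intro call_costI, subst unf_locator) (auto simp: locator_def simp del: ident.simps)

lemma call_compan [simp]:
  "returns i_compan (enc_ctx f t z zv ;; enc_vec c)
     (enc_mat (compan f t z c))"
  using call_append[of enc_vec "msmul f (lastd c) (tl (ident z t))" "[take t c]"]
  by (intro call_costI, subst unf_compan) (auto simp: compan_def)

lemma call_decode [simp]:
  "returns i_decode (enc_ctx f t z zv ;; enc_vec S)
     (enc_vec (decode f t z zv S))"
proof -
  define F where "F = full f t S S"
  define M where "M = compan f t z (locator f t z F)"
  define L where "L = consnz (take t F) []"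
  define H where "H = heads z (sloop f t z zv M (length z) (unit_elem z) L)"
  \<comment> \<open>In the body of \<open>i_decode\<close> the empty lists and the unit element
    occur as bare trees, which the rules about encoded lists do not match. Matching instances are
    supplied here.\<close>
  note call_consnz[of "take t F" "[]", unfolded enc_list_simps(1), folded L_def, simp]
    call_sloop[of f t z zv M enc_bool z "unit_elem z" L,
      unfolded unit_elem_def enc_list_simps enc_bool_simps, folded unit_elem_def, simp]
    call_togall[of H "[]", unfolded enc_list_simps(1), simp]
    F_def[symmetric, simp] M_def[symmetric, simp] H_def[symmetric, simp]
  show ?thesis
      by (rule call_costI, subst unf_decode) (simp add: decode_def Let_def L_def[symmetric])
qed

end

section \<open>The two main functions\<close>

definition body_ss_main :: expr where
  "body_ss_main = expr.Let (Call i_mkctx (Left arg))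
     (Call i_concat (Call i_ssum (Var 0 ,, Right (Var 1))))"

text \<open>In the innermost body, \<open>Var 0\<close> to \<open>Var 3\<close> are the decoded set,
  the difference of the syndromes, the context and the whole input.\<close>

definition body_rec_main :: expr where
  "body_rec_main = expr.Let (Call i_mkctx (Left arg))
     (expr.Let (Call i_vadd (Call i_ssum (Var 0 ,, Left (Right (Var 1))) ,,
         Call i_parse (Left (Right (Right (Var 0))) ,,
           Left (Right (Var 0)) ,, Right (Right (Var 1)))))
       (expr.Let (Call i_decode (Var 1 ,, Var 0))
         (IfNode (Call i_eq (Call i_ssum (Var 2 ,, Var 0) ,, Var 1))
           (Call i_togall (Var 0 ,, Left (Right (Var 3))))
           (Left (Right (Var 3))))))"

definition ss_main :: expr where "ss_main = body_ss_main"
definition rec_main :: expr where "rec_main = body_rec_main"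

lemma unf_ss_main: "call (prog ss_main) 0 v = run (prog ss_main) [v] body_ss_main"
  and unf_rec_main: "call (prog rec_main) 0 v = run (prog rec_main) [v] body_rec_main"
  by (simp_all add: call_main ss_main_def rec_main_def)

lemma call_ss_main: "call (prog ss_main) 0 ((enc_el f ;; enc_unary t) ;; enc_vec xs) =
  Some (enc_el (ss_alg f t xs), cost ss_main 0 ((enc_el f ;; enc_unary t) ;; enc_vec xs))"
  by (rule call_costI, subst unf_ss_main) (simp add: body_ss_main_def ss_alg_def Let_def)

lemma call_rec_main:
  "call (prog rec_main) 0 ((enc_el f ;; enc_unary t) ;; enc_vec xs ;; enc_el s) =
  Some (enc_vec (rec_alg f t xs s),
    cost rec_main 0 ((enc_el f ;; enc_unary t) ;; enc_vec xs ;; enc_el s))"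
proof -
  define z where "z = bxor (tl f) (tl f)"
  define ctx where "ctx = enc_ctx f t z (replicate t z)"
  have ctx: "left_of (right_of (right_of ctx)) = enc_el z" "left_of (right_of ctx) = enc_unary t"
    by (simp_all add: ctx_def)
  show ?thesis
    by (rule call_costI, subst unf_rec_main)
      (simp add: body_rec_main_def rec_alg_def Let_def z_def[symmetric])
qed

section \<open>Running times\<close>

text \<open>An opaque power: linear arithmetic then treats \<open>pw N k\<close> as an atom.\<close>

definition pw :: "nat \<Rightarrow> nat \<Rightarrow> nat" where "pw N k = N ^ k"

text \<open>The factor \<open>Suc n\<close> counts \<open>n\<close> rounds and the base case, and
  the strict bound \<open>n < N\<close> absorbs the latter. Each enclosing loop thus raises the
  exponent of \<open>N\<close> by one.\<close>

lemma loop_bound: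
  assumes "T \<le> Suc n * c" "n < N"
  shows "c = d \<Longrightarrow> T \<le> d * N" "c = d * N \<Longrightarrow> T \<le> d * pw N 2"
    "c = d * pw N k \<Longrightarrow> k' = Suc k \<Longrightarrow> T \<le> d * pw N k'"
proof -
  have "Suc n * c \<le> N * c" using assms(2) by (intro mult_right_mono) auto
  then have T: "T \<le> N * c" using assms(1) by (rule order_trans[rotated])
  then show "c = d \<Longrightarrow> T \<le> d * N" "c = d * N \<Longrightarrow> T \<le> d * pw N 2"
    "c = d * pw N k \<Longrightarrow> k' = Suc k \<Longrightarrow> T \<le> d * pw N k'"
    by (simp_all add: pw_def power2_eq_square ac_simps)
qed

text \<open>Only lengths are bounded, without any demand that rows have equal length or elements the
  right one, so that the time bounds cover undecodable input as well.\<close>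

definition vb :: "nat \<Rightarrow> vec \<Rightarrow> bool" where
  "vb N v \<longleftrightarrow> length v < N \<and> (\<forall>x\<in>set v. length x < N)"

definition mb :: "nat \<Rightarrow> mat \<Rightarrow> bool" where
  "mb N A \<longleftrightarrow> length A < N \<and> (\<forall>v\<in>set A. vb N v)"

text \<open>Sizes of trees matter only for the cost of the equality test.\<close>

lemma size_enc_el: "size (enc_el x) \<le> 2 * length x"
  by (induction x) (auto simp: enc_bool_def)

lemma size_enc_vec:
  assumes "\<forall>x\<in>set v. length x < N"
  shows "size (enc_vec v) \<le> length v * (2 * N)"
  using assms
proof (induction v)
  case (Cons x v)
  have "size (enc_el x) + 1 \<le> 2 * N" using size_enc_el[of x] Cons.prems by simp
  then show ?case using Cons by simp
qed simp

section \<open>Lengths of intermediate results\<close>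

lemma length_bxor [simp]: "length (bxor x y) = min (length x) (length y)"
  by (induction x y rule: bxor.induct) auto

lemma length_bshift_le: "length (bshift f x) \<le> length x"
  by (auto simp: bshift_def)

lemma length_bmul_le: "length (bmul f x y) \<le> length x"
proof (induction y)
  case (Cons b y) then show ?case using length_bshift_le[of f "bmul f x y"] by auto
qed simp

lemma length_bmul_less: "length x < N \<Longrightarrow> length (bmul f x y) < N"
  using length_bmul_le[of f x y] by simp

lemma length_pad [simp]: "length (pad z s) = length z"
  by (induction z s rule: pad.induct) auto

lemma length_vadd [simp]: "length (vadd u v) = min (length u) (length v)"
  by (induction u v rule: vadd.induct) auto

lemma length_hdd: "vb N v \<Longrightarrow> length (hdd v) < N"
  by (cases v) (auto simp: hdd_def vb_def)

lemma length_lastd: "vb N v \<Longrightarrow> length (lastd v) < N"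
  by (auto simp: lastd_def vb_def)

lemma vb_lastd: "mb N A \<Longrightarrow> vb N (lastd A)"
  by (auto simp: lastd_def vb_def mb_def)

lemma vb_Cons [simp]: "vb N (x # v) \<longleftrightarrow> vb N v \<and> Suc (length v) < N \<and> length x < N"
  by (auto simp: vb_def)

lemma mb_Cons [simp]: "mb N (v # A) \<longleftrightarrow> mb N A \<and> Suc (length A) < N \<and> vb N v"
  by (auto simp: mb_def)

lemma vb_vadd: "vb N u \<Longrightarrow> vb N (vadd u v)"
  by (induction u v rule: vadd.induct) (auto simp: vb_def)

lemma vb_smul: "length c < N \<Longrightarrow> length v < N \<Longrightarrow> vb N (smul f c v)"
  by (auto simp: vb_def smul_def length_bmul_less)

lemma vb_lincomb: "vb N zv \<Longrightarrow> vb N cs \<Longrightarrow> mb N rs \<Longrightarrow> vb N (lincomb f zv cs rs)"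
  by (induction f zv cs rs rule: lincomb.induct)
    (auto intro!: vb_vadd vb_smul, auto simp: vb_def)

lemma length_dot: "length z < N \<Longrightarrow> vb N u \<Longrightarrow> length (dot f z u v) < N"
  by (induction u v rule: vadd.induct) (auto simp: min_less_iff_disj)

lemma mb_matmul: "vb N zv \<Longrightarrow> mb N A \<Longrightarrow> mb N B \<Longrightarrow> mb N (matmul f zv A B)"
  by (auto simp: mb_def matmul_def intro: vb_lincomb[unfolded mb_def])

lemma mb_madd: "mb N A \<Longrightarrow> mb N (madd A B)"
proof (induction A B rule: madd.induct)
  case (1 u A v B)
  have "length (madd A B) \<le> length A" for A B :: mat by (induction A B rule: madd.induct) auto
  from this[of A B] 1 show ?case by (auto simp: vb_vadd)
qed (auto simp: mb_def)

lemma mb_msmul: "length c < N \<Longrightarrow> mb N A \<Longrightarrow> mb N (msmul f c A)"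
  by (auto simp: mb_def msmul_def vb_def smul_def length_bmul_less)

lemma mb_trmat: "mb N B \<Longrightarrow> mb N (trmat f zv n B)"
  by (cases n) (auto intro: mb_madd)

lemma vb_matvec: "length z < N \<Longrightarrow> mb N A \<Longrightarrow> vb N (matvec f z A v)"
  by (auto simp: mb_def vb_def matvec_def intro!: length_dot)

lemma vb_splits:
  "length z < N \<Longrightarrow> mb N T \<Longrightarrow> \<forall>v\<in>set L. vb N v \<Longrightarrow> \<forall>v\<in>set (splits f z T L). vb N v"
  by (induction L) (auto simp: consnz_def vb_matvec vb_vadd)

lemma mb_elimmap:
  "length d < N \<Longrightarrow> mb N ws \<Longrightarrow> mb N (elimmap f z S p d ws)"
  by (auto simp: mb_def elimmap_def intro!: vb_vadd vb_smul) (auto simp: vb_def)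

lemma mb_elim: "length z < N \<Longrightarrow> mb N ws \<Longrightarrow> mb N (elim f z S ws)"
proof (induction ws)
  case (Cons w ws)
  have "length (elim f z S ws) \<le> length ws" for ws
    by (induction ws) (auto simp: elimmap_def)
  from this[of ws] Cons show ?case by (auto intro!: mb_elimmap length_dot)
qed (auto simp: mb_def)

lemma mb_eloop: "length z < N \<Longrightarrow> mb N ws \<Longrightarrow> mb N (eloop f z n S ws)"
  by (induction n arbitrary: S ws) (auto intro: mb_elim)

lemma vb_tl: "vb N v \<Longrightarrow> vb N (tl v)"
  by (cases v) (auto simp: vb_def)

lemma mb_tl: "mb N A \<Longrightarrow> mb N (tl A)"
  by (cases A) (auto simp: mb_def)

lemma mb_ident:
  assumes "length z < N" "Suc 0 < N" "n < N"
  shows "mb N (ident z n)"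
proof -
  have "length (ident z n) = n" for n by (induction n) auto
  moreover have "v \<in> set (ident z n) \<Longrightarrow> length v = n" for v n
    by (induction n arbitrary: v) auto
  moreover have "\<forall>v\<in>set (ident z n). \<forall>x\<in>set v. length x < N" for n
    using assms(1,2) by (induction n) auto
  ultimately show ?thesis using assms by (auto simp: mb_def vb_def)
qed

lemma vb_pows: "n < N \<Longrightarrow> length p < N \<Longrightarrow> vb N (pows f n p q)"
proof (induction n arbitrary: p)
  case (Suc n)
  have "length (pows f n p q) = n" for p by (induction n arbitrary: p) auto
  with Suc.IH[of "bmul f p q"] Suc.prems show ?case by (auto simp: length_bmul_less)
qed (auto simp: vb_def)

lemma vb_ssum:
  "t < N \<Longrightarrow> vb N zv \<Longrightarrow> \<forall>x\<in>set xs. length x < N \<Longrightarrow> vb N (ssum f t zv xs)"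
  by (cases xs) (auto intro!: vb_vadd vb_pows)

lemma vb_sqs: "vb N v \<Longrightarrow> vb N (sqs f v)"
  by (auto simp: vb_def sqs_def length_bmul_less)

lemma length_inter: "length (inter u v) = 2 * length u"
  by (induction u v rule: inter.induct) auto

lemma vb_inter: "2 * length u < N \<Longrightarrow> vb N u \<Longrightarrow> vb N v \<Longrightarrow> vb N (inter u v)"
  by (induction u v rule: inter.induct) (auto simp: length_inter length_hdd vb_tl)

lemma vb_full: "2 * length u < N \<Longrightarrow> vb N u \<Longrightarrow> vb N F \<Longrightarrow> vb N (full f n u F)"
  by (induction n arbitrary: F) (auto intro!: vb_inter vb_sqs)

lemma vb_heads: "length z < N \<Longrightarrow> length L < N \<Longrightarrow> vb N (heads z L)"
proof (induction L)
  case (Cons v L)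
  have "length (heads z L) \<le> length L" by (induction L) auto
  with Cons show ?case by auto
qed (auto simp: vb_def)

lemma length_toggle_le: "length (toggle x L) \<le> Suc (length L)"
  by (induction L) auto

lemma length_togall_le: "length (togall vs L) \<le> length vs + length L"
proof (induction vs)
  case (Cons x vs)
  then show ?case using length_toggle_le[of x "togall vs L"] by (simp add: togall_def)
qed (simp add: togall_def)

lemma set_toggle_subset: "set (toggle x L) \<subseteq> insert x (set L)"
  by (induction L) auto

lemma set_togall_subset: "set (togall vs L) \<subseteq> set vs \<union> set L"
proof (induction vs)
  case (Cons x vs)
  then show ?case using set_toggle_subset[of x "togall vs L"] by (auto simp: togall_def)
qed (simp add: togall_def)

lemma mb_sloop:
  "length z < N \<Longrightarrow> t < N \<Longrightarrow> mb N M \<Longrightarrow> length b < N \<Longrightarrow> mb N L \<Longrightarrow>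
    mb N (sloop f t z zv M n b L)"
proof (induction n arbitrary: b L)
  case (Suc n)
  have "\<forall>v\<in>set (splits f z (trmat f zv (length z) (msmul f b M)) L). vb N v"
    using Suc.prems by (intro vb_splits mb_trmat mb_msmul) (auto simp: mb_def)
  then have "mb N (take t (splits f z (trmat f zv (length z) (msmul f b M)) L))"
    using Suc.prems by (auto simp: mb_def dest: in_set_takeD)
  then show ?case using Suc length_bshift_le[of f b] by auto
qed simp

lemma mb_compan:
  assumes "length z < N" "Suc 0 < N" "t < N" "vb N c"
  shows "mb N (compan f t z c)"
proof -
  have "length (ident z t) = t" by (induction t) auto
  moreover have "mb N (msmul f (lastd c) (tl (ident z t)))"
    using assms by (intro mb_msmul mb_tl mb_ident length_lastd) auto
  moreover have "vb N (take t c)" using assms by (auto simp: vb_def dest: in_set_takeD)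
  ultimately show ?thesis using assms by (auto simp: mb_def compan_def msmul_def)
qed

section \<open>Step counts of the library functions\<close>

context
  fixes m :: expr and N :: nat
  assumes N: "0 < N"
begin

text \<open>These facts are what linear arithmetic needs to absorb lower powers of \<open>N\<close>
  into higher ones.\<close>

lemma pw_chain: "1 \<le> N" "N \<le> pw N 2" "pw N 2 \<le> pw N 3" "pw N 3 \<le> pw N 4" "pw N 4 \<le> pw N 5"
  "pw N 5 \<le> pw N 6" "pw N 6 \<le> pw N 7"
proof -
  have "N ^ 1 \<le> N ^ 2" using N by (intro power_increasing) auto
  then show "N \<le> pw N 2" by (simp add: pw_def)
qed (use N in \<open>auto simp: pw_def intro: power_increasing\<close>)

text \<open>\<open>2 * size u + 1\<close> counts all cells of \<open>u\<close> including its leaves.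
  The size of one argument suffices, as the comparison never descends below a leaf of it.\<close>

lemma cost_eq: "cost m i_eq (u ;; v) \<le> 30 * (2 * size u + 1)"
proof (induction u arbitrary: v)
  case Leaf
  show ?case by (rule cost_leI, subst unf_eq) auto
next
  case (Node u1 u2)
  show ?case
  proof (cases v)
    case Leaf
    then show ?thesis by (intro cost_leI, subst unf_eq) auto
  next
    case (Node v1 v2)
    from Node.IH(1)[of v1] Node.IH(2)[of v2] show ?thesis unfolding Node
      by (intro cost_leI, subst unf_eq) auto
  qed
qed

lemma cost_eq_el: "length x < N \<Longrightarrow> cost m i_eq (enc_el x ;; v) \<le> 150 * N"
  using cost_eq[of "enc_el x" v] size_enc_el[of x] by simp

lemma cost_eq_vec: assumes "vb N u" shows "cost m i_eq (enc_vec u ;; v) \<le> 150 * pw N 2"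
proof -
  have "size (enc_vec u) \<le> length u * (2 * N)"
    using assms by (intro size_enc_vec) (auto simp: vb_def)
  also have "\<dots> \<le> N * (2 * N)" using assms by (intro mult_right_mono) (auto simp: vb_def)
  finally have "size (enc_vec u) \<le> 2 * pw N 2" by (simp add: pw_def power2_eq_square)
  then show ?thesis using cost_eq[of "enc_vec u" v] pw_chain by simp
qed

text \<open>Here and below the numerical constants are merely generous.\<close>

lemma cost_bxor:
  assumes "length x < N"
  shows "cost m i_bxor (enc_el x ;; enc_el y) \<le> 40 * N"
    (is "?T \<le> _")
proof (rule loop_bound(1))
  show "?T \<le> Suc (length x) * 40"
    by (induction x y rule: bxor.induct; rule cost_leI, subst unf_bxor; use pw_chain assms in auto)
qed (use assms in \<open>auto simp: vb_def mb_def\<close>)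

lemma cost_last:
  assumes "length xs < N"
  shows "cost m i_last (enc_list e xs) \<le> 40 * N"
    (is "?T \<le> _")
proof (rule loop_bound(1))
  show "?T \<le> Suc (length xs) * 40"
    by (induction xs; rule cost_leI, subst unf_last; use pw_chain assms in \<open>auto simp: call_last\<close>)
qed (use assms in \<open>auto simp: vb_def mb_def\<close>)

lemma cost_take:
  assumes "n < N"
  shows "cost m i_take (enc_unary n ;; enc_list e xs) \<le> 40 * N"
    (is "?T \<le> _")
proof (rule loop_bound(1))
  show "?T \<le> Suc n * 40"
  proof (induction n arbitrary: xs)
    case 0
    show ?case
      by (rule cost_leI, subst unf_take) (use pw_chain in simp)
  next
    case (Suc n)
    show ?case
      by (rule cost_leI, subst unf_take) (use Suc[of "tl xs"] pw_chain in \<open>cases xs; simp\<close>)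
  qed
qed (use assms in \<open>auto simp: vb_def mb_def\<close>)

lemma cost_pad:
  assumes "length z < N"
  shows "cost m i_pad (enc_el z ;; enc_el x) \<le> 40 * N"
    (is "?T \<le> _")
proof (rule loop_bound(1))
  show "?T \<le> Suc (length z) * 40"
    by (induction z x rule: pad.induct; rule cost_leI, subst unf_pad; use pw_chain assms in auto)
qed (use assms in \<open>auto simp: vb_def mb_def\<close>)

lemma cost_drop:
  assumes "length ns < N"
  shows "cost m i_drop (enc_list e ns ;; enc_list e' xs) \<le> 40 * N"
    (is "?T \<le> _")
proof (rule loop_bound(1))
  show "?T \<le> Suc (length ns) * 40"
  proof (induction ns arbitrary: xs)
    case Nil
    show ?case
      by (rule cost_leI, subst unf_drop) (use pw_chain in simp)
  next
    case (Cons n ns)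
    show ?case
      by (rule cost_leI, subst unf_drop) (use Cons[of "tl xs"] pw_chain in simp)
  qed
qed (use assms in \<open>auto simp: vb_def mb_def\<close>)

lemma cost_append:
  assumes "length xs < N"
  shows "cost m i_append (enc_list e xs ;; enc_list e ys) \<le> 40 * N"
    (is "?T \<le> _")
proof (rule loop_bound(1))
  show "?T \<le> Suc (length xs) * 40"
    by (induction xs; rule cost_leI, subst unf_append; use pw_chain assms in auto)
qed (use assms in \<open>auto simp: vb_def mb_def\<close>)

lemma cost_concat:
  assumes "length xs < N" and "\<forall>x\<in>set xs. length x < N"
  shows "cost m i_concat (enc_list (enc_list e) xs) \<le> 60 * pw N 2"
    (is "?T \<le> _")
proof (rule loop_bound(2))
  show "?T \<le> Suc (length xs) * (60 * N)"
    using assms(2)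
  proof (induction xs)
    case Nil
    show ?case
      by (rule cost_leI, subst unf_concat) (use pw_chain in simp)
  next
    case (Cons x xs)
    have s0: "cost m i_append (enc_list e x ;; enc_list e (concat xs)) \<le> 40 * N"
      by (rule cost_append) (use Cons in auto)
    show ?case
      by (rule cost_leI, subst unf_concat) (use Cons s0 pw_chain in simp)
  qed
qed (use assms in \<open>auto simp: vb_def mb_def\<close>)

lemma cost_rep:
  assumes "n < N"
  shows "cost m i_rep (enc_el x ;; enc_unary n) \<le> 40 * N"
    (is "?T \<le> _")
proof (rule loop_bound(1))
  show "?T \<le> Suc n * 40"
    by (induction n; rule cost_leI, subst unf_rep; use pw_chain assms in auto)
qed (use assms in \<open>auto simp: vb_def mb_def\<close>)

lemma cost_bshift:
  assumes "length f < N" "length x < N"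
  shows "cost m i_bshift (enc_el f ;; enc_el x) \<le> 200 * N"
proof -
  note [simp] = call_bxor[of m f "False # x", unfolded enc_list_simps enc_bool_simps]
    call_bxor[of m "bxor x x" "False # x", unfolded enc_list_simps enc_bool_simps]
  have "cost m i_bxor (enc_el x ;; enc_el x) \<le> 40 * N"
    "cost m i_bxor (enc_el f ;; Leaf ;; enc_el x) \<le> 40 * N"
    "cost m i_bxor (enc_el (bxor x x) ;; enc_el (bxor f (False # x))) \<le> 40 * N"
    "cost m i_bxor (enc_el (bxor x x) ;; Leaf ;; enc_el x) \<le> 40 * N"
    "cost m i_last (enc_el x) \<le> 40 * N"
    using cost_bxor[of x x] cost_bxor[of f "False # x"] cost_bxor[of "bxor x x" "False # x"]
      cost_bxor[of "bxor x x" "bxor f (False # x)"] cost_last[of x enc_bool] assms by auto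
  then show ?thesis by (intro cost_leI, subst unf_bshift) (use pw_chain in auto)
qed

lemma cost_bmul:
  assumes "length f < N" and "length x < N" and "length y < N"
  shows "cost m i_bmul (enc_el f ;; enc_el x ;; enc_el y) \<le> 300 * pw N 2"
    (is "?T \<le> _")
proof (rule loop_bound(2))
  show "?T \<le> Suc (length y) * (300 * N)"
  proof (induction y)
    case Nil
    have s0: "cost m i_bxor (enc_el x ;; enc_el x) \<le> 40 * N"
      by (rule cost_bxor) (use assms in auto)
    show ?case
      by (rule cost_leI, subst unf_bmul) (use s0 pw_chain in simp)
  next
    case (Cons b y)
    have s0: "cost m i_bshift (enc_el f ;; enc_el (bmul f x y)) \<le> 200 * N"
      by (rule cost_bshift) (use assms in \<open>auto simp: length_bmul_less\<close>)
    have s1: "cost m i_bxor (enc_el (bshift f (bmul f x y)) ;; enc_el x) \<le> 40 * N"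
      by (rule cost_bxor)
          (use assms length_bshift_le[of f "bmul f x y"] length_bmul_less[of x N f y] in simp)
    show ?case
      by (rule cost_leI, subst unf_bmul) (use Cons s0 s1 pw_chain in \<open>cases b; simp\<close>)
  qed
qed (use assms in \<open>auto simp: vb_def mb_def\<close>)

lemma cost_vadd:
  assumes "vb N u"
  shows "cost m i_vadd (enc_vec u ;; enc_vec v) \<le> 80 * pw N 2"
    (is "?T \<le> _")
proof (rule loop_bound(2))
  show "?T \<le> Suc (length u) * (80 * N)"
    using assms
  proof (induction u v rule: vadd.induct)
    case (1 x u y v)
    have s0: "cost m i_bxor (enc_el x ;; enc_el y) \<le> 40 * N"
      by (rule cost_bxor) (use 1 in auto)
    show ?case
      by (rule cost_leI, subst unf_vadd) (use 1 s0 pw_chain in simp)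
  next
    case ("2_1" v)
    show ?case
      by (rule cost_leI, subst unf_vadd) (use pw_chain in simp)
  next
    case ("2_2" u)
    show ?case
      by (rule cost_leI, subst unf_vadd) (use pw_chain in \<open>cases u; simp\<close>)
  qed
qed (use assms in \<open>auto simp: vb_def mb_def\<close>)

lemma cost_smul:
  assumes "length f < N" and "length c < N" and "vb N v"
  shows "cost m i_smul (enc_el f ;; enc_el c ;; enc_vec v) \<le> 400 * pw N 3"
    (is "?T \<le> _")
proof (rule loop_bound(3))
  show "?T \<le> Suc (length v) * (400 * pw N 2)"
    using assms(3)
  proof (induction v)
    case Nil
    show ?case
      by (rule cost_leI, subst unf_smul) (use pw_chain in simp)
  next
    case (Cons x v)
    have s0: "cost m i_bmul (enc_el f ;; enc_el c ;; enc_el x) \<le> 300 * pw N 2"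
      by (rule cost_bmul) (use assms(1,2) Cons in auto)
    show ?case
      by (rule cost_leI, subst unf_smul) (use Cons s0 pw_chain in simp)
  qed
qed (use assms in \<open>auto simp: vb_def mb_def\<close>)

lemma cost_lincomb:
  assumes "length f < N" and "vb N cs" and "mb N rs"
  shows "cost m i_lincomb (enc_ctx f t z zv ;; enc_vec cs ;; enc_mat rs) \<le> 600 * pw N 4"
    (is "?T \<le> _")
proof (rule loop_bound(3))
  show "?T \<le> Suc (length cs) * (600 * pw N 3)"
    using assms
  proof (induction f zv cs rs rule: lincomb.induct)
    case (1 f zv c cs r rs)
    have s0: "cost m i_smul (enc_el f ;; enc_el c ;; enc_vec r) \<le> 400 * pw N 3"
      by (rule cost_smul) (use 1 in auto)
    have s1: "cost m i_vadd (enc_vec (smul f c r) ;; enc_vec (lincomb f zv cs rs)) \<le> 80 * pw N 2"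
      by (rule cost_vadd) (use 1 in \<open>auto simp: vb_def[of N r] intro!: vb_smul\<close>)
    show ?case
      by (rule cost_leI, subst unf_lincomb) (use 1 s0 s1 pw_chain in simp)
  next
    case ("2_1" f zv v)
    show ?case
      by (rule cost_leI, subst unf_lincomb) (use pw_chain in simp)
  next
    case ("2_2" f zv v)
    show ?case
      by (rule cost_leI, subst unf_lincomb) (use pw_chain in \<open>cases v; simp\<close>)
  qed
qed (use assms in \<open>auto simp: vb_def mb_def\<close>)

lemma cost_dot:
  assumes "length f < N" and "vb N u" and "vb N v"
  shows "cost m i_dot (enc_ctx f t z zv ;; enc_vec u ;; enc_vec v) \<le> 400 * pw N 3"
    (is "?T \<le> _")
proof (rule loop_bound(3))
  show "?T \<le> Suc (length u) * (400 * pw N 2)"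
    using assms
  proof (induction u v rule: vadd.induct)
    case (1 x u y v)
    have s0: "cost m i_bmul (enc_el f ;; enc_el x ;; enc_el y) \<le> 300 * pw N 2"
      by (rule cost_bmul) (use 1 in auto)
    have s1: "cost m i_bxor (enc_el (bmul f x y) ;; enc_el (dot f z u v)) \<le> 40 * N"
      by (rule cost_bxor) (use 1 in \<open>auto simp: length_bmul_less\<close>)
    show ?case
      by (rule cost_leI, subst unf_dot) (use 1 s0 s1 pw_chain in simp)
  next
    case ("2_1" v)
    show ?case
      by (rule cost_leI, subst unf_dot) (use pw_chain in simp)
  next
    case ("2_2" u)
    show ?case
      by (rule cost_leI, subst unf_dot) (use pw_chain in \<open>cases u; simp\<close>)
  qed
qed (use assms in \<open>auto simp: vb_def mb_def\<close>)

lemma cost_matmul: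
  assumes "length f < N" and "mb N A" and "mb N B"
  shows "cost m i_matmul (enc_ctx f t z zv ;; enc_mat A ;; enc_mat B) \<le> 700 * pw N 5"
    (is "?T \<le> _")
proof (rule loop_bound(3))
  show "?T \<le> Suc (length A) * (700 * pw N 4)"
    using assms(2)
  proof (induction A)
    case Nil
    show ?case
      by (rule cost_leI, subst unf_matmul) (use pw_chain in simp)
  next
    case (Cons r A)
    have s0: "cost m i_lincomb (enc_ctx f t z zv ;; enc_vec r ;; enc_mat B) \<le> 600 * pw N 4"
      by (rule cost_lincomb) (use assms(1,3) Cons in auto)
    show ?case
      by (rule cost_leI, subst unf_matmul) (use Cons s0 pw_chain in simp)
  qed
qed (use assms in \<open>auto simp: vb_def mb_def\<close>)

lemma cost_madd:
  assumes "mb N A"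
  shows "cost m i_madd (enc_mat A ;; enc_mat B) \<le> 200 * pw N 3"
    (is "?T \<le> _")
proof (rule loop_bound(3))
  show "?T \<le> Suc (length A) * (200 * pw N 2)"
    using assms
  proof (induction A B rule: madd.induct)
    case (1 u A v B)
    have s0: "cost m i_vadd (enc_vec u ;; enc_vec v) \<le> 80 * pw N 2"
      by (rule cost_vadd) (use 1 in auto)
    show ?case
      by (rule cost_leI, subst unf_madd) (use 1 s0 pw_chain in simp)
  next
    case ("2_1" v)
    show ?case
      by (rule cost_leI, subst unf_madd) (use pw_chain in simp)
  next
    case ("2_2" u)
    show ?case
      by (rule cost_leI, subst unf_madd) (use pw_chain in \<open>cases u; simp\<close>)
  qed
qed (use assms in \<open>auto simp: vb_def mb_def\<close>)

lemma cost_msmul: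
  assumes "length f < N" and "length c < N" and "mb N A"
  shows "cost m i_msmul (enc_el f ;; enc_el c ;; enc_mat A) \<le> 500 * pw N 4"
    (is "?T \<le> _")
proof (rule loop_bound(3))
  show "?T \<le> Suc (length A) * (500 * pw N 3)"
    using assms(3)
  proof (induction A)
    case Nil
    show ?case
      by (rule cost_leI, subst unf_msmul) (use pw_chain in simp)
  next
    case (Cons r A)
    have s0: "cost m i_smul (enc_el f ;; enc_el c ;; enc_vec r) \<le> 400 * pw N 3"
      by (rule cost_smul) (use assms(1,2) Cons in auto)
    show ?case
      by (rule cost_leI, subst unf_msmul) (use Cons s0 pw_chain in simp)
  qed
qed (use assms in \<open>auto simp: vb_def mb_def\<close>)

lemma cost_trmat:
  assumes "length f < N" and "vb N zv" and "mb N B" and "length ns < N"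
  shows "cost m i_trmat (enc_ctx f t z zv ;; enc_list e ns ;; enc_mat B) \<le> 1000 * pw N 6"
    (is "?T \<le> _")
proof (rule loop_bound(3))
  show "?T \<le> Suc (length ns) * (1000 * pw N 5)"
    using assms(3)
  proof (induction ns arbitrary: B)
    case Nil
    have s0: "cost m i_madd (enc_mat B ;; enc_mat B) \<le> 200 * pw N 3"
      by (rule cost_madd) (use Nil in auto)
    show ?case
      by (rule cost_leI, subst unf_trmat) (use s0 pw_chain in simp)
  next
    case (Cons n ns)
    have s0: "cost m i_madd (enc_mat B ;; enc_mat (trmat f zv (length ns) (matmul f zv B B)))
        \<le> 200 * pw N 3"
      by (rule cost_madd) (use Cons in auto)
    have s1: "cost m i_matmul (enc_ctx f t z zv ;; enc_mat B ;; enc_mat B) \<le> 700 * pw N 5"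
      by (rule cost_matmul) (use assms(1) Cons in auto)
    show ?case
      by (rule cost_leI, subst unf_trmat)
          (use Cons(1)[OF mb_matmul[OF assms(2) Cons(2) Cons(2), of f]] s0 s1 pw_chain in simp)
  qed
qed (use assms in \<open>auto simp: vb_def mb_def\<close>)

lemma cost_matvec:
  assumes "length f < N" and "mb N A" and "vb N v"
  shows "cost m i_matvec (enc_ctx f t z zv ;; enc_mat A ;; enc_vec v) \<le> 500 * pw N 4"
    (is "?T \<le> _")
proof (rule loop_bound(3))
  show "?T \<le> Suc (length A) * (500 * pw N 3)"
    using assms(2)
  proof (induction A)
    case Nil
    show ?case
      by (rule cost_leI, subst unf_matvec) (use pw_chain in simp)
  next
    case (Cons r A)
    have s0: "cost m i_dot (enc_ctx f t z zv ;; enc_vec r ;; enc_vec v) \<le> 400 * pw N 3"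
      by (rule cost_dot) (use assms(1,3) Cons in auto)
    show ?case
      by (rule cost_leI, subst unf_matvec) (use Cons s0 pw_chain in simp)
  qed
qed (use assms in \<open>auto simp: vb_def mb_def\<close>)

lemma cost_consnz:
  assumes "vb N v"
  shows "cost m i_consnz (enc_vec v ;; enc_mat L) \<le> 400 * pw N 2"
  using cost_vadd[OF assms, of v] cost_eq_vec[OF assms, of "enc_vec (vadd v v)"]
  by (intro cost_leI, subst unf_consnz) (use pw_chain in auto)

lemma cost_splits:
  assumes "length f < N" and "length z < N" and "mb N T" and "length L < N" and "\<forall>v\<in>set L. vb N v"
  shows "cost m i_splits (enc_ctx f t z zv ;; enc_mat T ;; enc_mat L) \<le> 1500 * pw N 5"
    (is "?T \<le> _")
proof (rule loop_bound(3))
  show "?T \<le> Suc (length L) * (1500 * pw N 4)"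
    using assms(5)
  proof (induction L)
    case Nil
    show ?case
      by (rule cost_leI, subst unf_splits) (use pw_chain in simp)
  next
    case (Cons v L)
    have s0: "cost m i_matvec (enc_ctx f t z zv ;; enc_mat T ;; enc_vec v) \<le> 500 * pw N 4"
      by (rule cost_matvec) (use assms Cons in auto)
    have s1: "cost m i_vadd (enc_vec v ;; enc_vec (matvec f z T v)) \<le> 80 * pw N 2"
      by (rule cost_vadd) (use Cons in auto)
    have s2: "cost m i_consnz (enc_vec (matvec f z T v) ;;
        enc_mat (consnz (vadd v (matvec f z T v)) (splits f z T L))) \<le> 400 * pw N 2"
      by (rule cost_consnz) (use assms in \<open>auto intro: vb_matvec\<close>)
    have s3: "cost m i_consnz (enc_vec (vadd v (matvec f z T v)) ;; enc_mat (splits f z T L))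
        \<le> 400 * pw N 2"
      by (rule cost_consnz) (use Cons in \<open>auto intro: vb_vadd\<close>)
    show ?case
      by (rule cost_leI, subst unf_splits) (use Cons s0 s1 s2 s3 pw_chain in simp)
  qed
qed (use assms in \<open>auto simp: vb_def mb_def\<close>)

text \<open>The exponent 7 of the whole running time arises here: \<open>N^2\<close> for a product
  of field elements, and one further factor each for scaling a vector, combining rows, multiplying
  matrices, repeated squaring, and the rounds of splitting.\<close>

lemma cost_sloop:
  assumes "length f < N" and "t < N" and "length z < N" and "vb N zv" and "mb N M"
      and "length ns < N" and "length b < N" and "mb N L"
  shows "cost m i_sloop (enc_ctx f t z zv ;; enc_mat M ;; enc_list e ns ;; enc_el b ;; enc_mat L)
      \<le> 3500 * pw N 7"
    (is "?T \<le> _")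
proof (rule loop_bound(3))
  show "?T \<le> Suc (length ns) * (3500 * pw N 6)"
    using assms(7,8)
  proof (induction ns arbitrary: b L)
    case Nil
    show ?case
      by (rule cost_leI, subst unf_sloop) (use pw_chain in simp)
  next
    case (Cons n ns)
    have s0: "mb N (msmul f b M)"
      by (rule mb_msmul) (use assms Cons in auto)
    have s1: "cost m i_bshift (enc_el f ;; enc_el b) \<le> 200 * N"
      by (rule cost_bshift) (use assms Cons in auto)
    have s2: "cost m i_msmul (enc_el f ;; enc_el b ;; enc_mat M) \<le> 500 * pw N 4"
      by (rule cost_msmul) (use assms Cons in auto)
    have s3: "cost m i_trmat (enc_ctx f t z zv ;; enc_el z ;; enc_mat (msmul f b M))
        \<le> 1000 * pw N 6"
      by (rule cost_trmat) (use assms s0 in auto)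
    have s4: "cost m i_splits (enc_ctx f t z zv ;; enc_mat (trmat f zv (length z) (msmul f b M)) ;; enc_mat L) \<le> 1500 * pw N 5"
      by (rule cost_splits) (use assms Cons s0 in \<open>auto simp: mb_def[of N L] intro: mb_trmat\<close>)
    have s5: "cost m i_take (enc_unary t ;; enc_mat (splits f z (trmat f zv (length z) (msmul f b M)) L)) \<le> 40 * N"
      by (rule cost_take) (use assms in auto)
    have s6: "\<forall>v\<in>set (splits f z (trmat f zv (length z) (msmul f b M)) L). vb N v"
      by (rule vb_splits) (use assms Cons s0 in \<open>auto simp: mb_def[of N L] intro: mb_trmat\<close>)
    have s7: "mb N (take t (splits f z (trmat f zv (length z) (msmul f b M)) L))"
      using s6 assms(2) by (auto simp: mb_def dest: in_set_takeD)
    have s8: "length (bshift f b) < N" using length_bshift_le[of f b] Cons by simp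
    show ?case
      by (rule cost_leI, subst unf_sloop) (use Cons(1)[OF s8 s7] s1 s2 s3 s4 s5 pw_chain in simp)
  qed
qed (use assms in \<open>auto simp: vb_def mb_def\<close>)

lemma cost_elimmap:
  assumes "length f < N" and "length z < N" and "vb N S" and "vb N p" and "length d < N"
      and "mb N ws"
  shows "cost m i_elimmap (enc_ctx f t z zv ;; (enc_vec S ;; enc_vec p ;; enc_el d) ;; enc_mat ws)
      \<le> 1500 * pw N 4"
    (is "?T \<le> _")
proof (rule loop_bound(3))
  show "?T \<le> Suc (length ws) * (1500 * pw N 3)"
    using assms(6)
  proof (induction ws)
    case Nil
    show ?case
      by (rule cost_leI, subst unf_elimmap) (use pw_chain in simp)
  next
    case (Cons u ws)
    have s0: "cost m i_smul (enc_el f ;; enc_el d ;; enc_vec u) \<le> 400 * pw N 3"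
      by (rule cost_smul) (use assms Cons in auto)
    have s1: "cost m i_dot (enc_ctx f t z zv ;; enc_vec u ;; enc_vec S) \<le> 400 * pw N 3"
      by (rule cost_dot) (use assms Cons in auto)
    have s2: "cost m i_smul (enc_el f ;; enc_el (dot f z u S) ;; enc_vec p) \<le> 400 * pw N 3"
      by (rule cost_smul) (use assms Cons in \<open>auto intro: length_dot\<close>)
    have s3: "cost m i_vadd (enc_vec (smul f d u) ;; enc_vec (smul f (dot f z u S) p))
        \<le> 80 * pw N 2"
      by (rule cost_vadd) (use assms Cons in \<open>auto simp: vb_def[of N u] intro!: vb_smul\<close>)
    show ?case
      by (rule cost_leI, subst unf_elimmap) (use Cons s0 s1 s2 s3 pw_chain in simp)
  qed
qed (use assms in \<open>auto simp: vb_def mb_def\<close>)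

lemma cost_elim:
  assumes "length f < N" "length z < N" "vb N S" "mb N ws"
  shows "cost m i_elim (enc_ctx f t z zv ;; enc_vec S ;; enc_mat ws) \<le> 2500 * pw N 4"
proof -
  define D where "D = 1000 * pw N 3"
  \<comment> \<open>The recursion stops at the pivot, so \<open>elimmap\<close> is paid for at most
    once and stands as a separate summand instead of being multiplied by the number of rows.\<close>
  have "cost m i_elim (enc_ctx f t z zv ;; enc_vec S ;; enc_mat ws)
      \<le> Suc (length ws) * D + 1500 * pw N 4"
    using assms(4)
  proof (induction ws)
    case Nil
    show ?case by (rule cost_leI, subst unf_elim) (use pw_chain D_def in simp)
  next
    case (Cons w ws)
    define d where "d = dot f z w S"
    have d: "length d < N" unfolding d_def by (rule length_dot) (use assms Cons in auto)
    have "cost m i_dot (enc_ctx f t z zv ;; enc_vec w ;; enc_vec S) \<le> 400 * pw N 3"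
      by (rule cost_dot) (use assms Cons in auto)
    moreover have "cost m i_bxor (enc_el d ;; enc_el d) \<le> 40 * N"
      by (rule cost_bxor) (use d in auto)
    moreover have "cost m i_eq (enc_el d ;; enc_el (bxor d d)) \<le> 150 * N"
      by (rule cost_eq_el) (use d in auto)
    moreover have "cost m i_elimmap (enc_ctx f t z zv ;;
        (enc_vec S ;; enc_vec w ;; enc_el d) ;; enc_mat ws) \<le> 1500 * pw N 4"
      by (rule cost_elimmap) (use assms Cons d in auto)
    ultimately show ?case
      by (intro cost_leI, subst unf_elim) (use Cons pw_chain D_def in \<open>auto simp: d_def\<close>)
  qed
  also have "Suc (length ws) * D \<le> 1000 * pw N 4"
    unfolding D_def by (rule loop_bound(3)[OF order_refl]) (use assms in \<open>simp_all add: mb_def\<close>)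
  finally show ?thesis by simp
qed

lemma cost_eloop:
  assumes "length f < N" and "length z < N" and "vb N S" and "mb N ws" and "n < N"
  shows "cost m i_eloop (enc_ctx f t z zv ;; enc_unary n ;; enc_vec S ;; enc_mat ws)
      \<le> 2600 * pw N 5"
    (is "?T \<le> _")
proof (rule loop_bound(3))
  show "?T \<le> Suc n * (2600 * pw N 4)"
    using assms(3,4)
  proof (induction n arbitrary: S ws)
    case 0
    show ?case
      by (rule cost_leI, subst unf_eloop) (use pw_chain in simp)
  next
    case (Suc n)
    have s0: "cost m i_elim (enc_ctx f t z zv ;; enc_vec S ;; enc_mat ws) \<le> 2500 * pw N 4"
      by (rule cost_elim) (use assms Suc in auto)
    show ?case
      by (rule cost_leI, subst unf_eloop)
          (use Suc(1)[OF vb_tl[OF Suc(2)] mb_elim[OF assms(2) Suc(3), of f S]] s0 pw_chain in simp)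
  qed
qed (use assms in \<open>auto simp: vb_def mb_def\<close>)

lemma cost_cmap:
  assumes "length A < N"
  shows "cost m i_cmap (enc_el z ;; enc_mat A) \<le> 40 * N"
    (is "?T \<le> _")
proof (rule loop_bound(1))
  show "?T \<le> Suc (length A) * 40"
    by (induction A; rule cost_leI, subst unf_cmap; use pw_chain assms in auto)
qed (use assms in \<open>auto simp: vb_def mb_def\<close>)

lemma cost_ident:
  assumes "n < N"
  shows "cost m i_ident (enc_el z ;; enc_unary n) \<le> 200 * pw N 2"
    (is "?T \<le> _")
proof (rule loop_bound(2))
  show "?T \<le> Suc n * (200 * N)"
    using assms
  proof (induction n)
    case 0
    show ?case
      by (rule cost_leI, subst unf_ident) (use pw_chain in simp)
  next
    case (Suc n)
    have s0: "cost m i_rep (enc_el z ;; enc_unary n) \<le> 40 * N"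
      by (rule cost_rep) (use Suc in auto)
    have s1: "length (ident z k) = k" for k by (induction k) auto
    have s2: "cost m i_cmap (enc_el z ;; enc_mat (ident z n)) \<le> 40 * N"
      by (rule cost_cmap) (use s1 Suc in auto)
    show ?case
      by (rule cost_leI, subst unf_ident) (use Suc s0 s2 pw_chain in simp)
  qed
qed (use assms in \<open>auto simp: vb_def mb_def\<close>)

lemma cost_pows:
  assumes "length f < N" and "n < N" and "length p < N" and "length q < N"
  shows "cost m i_pows (enc_el f ;; enc_unary n ;; enc_el p ;; enc_el q) \<le> 400 * pw N 3"
    (is "?T \<le> _")
proof (rule loop_bound(3))
  show "?T \<le> Suc n * (400 * pw N 2)"
    using assms(3)
  proof (induction n arbitrary: p)
    case 0
    show ?case
      by (rule cost_leI, subst unf_pows) (use pw_chain in simp)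
  next
    case (Suc n)
    have s0: "cost m i_bmul (enc_el f ;; enc_el p ;; enc_el q) \<le> 300 * pw N 2"
      by (rule cost_bmul) (use assms Suc in auto)
    show ?case
      by (rule cost_leI, subst unf_pows)
          (use Suc(1)[OF length_bmul_less[OF Suc(2)], of f q] s0 pw_chain in simp)
  qed
qed (use assms in \<open>auto simp: vb_def mb_def\<close>)

text \<open>The length of \<open>xs\<close> is not bounded by \<open>N\<close>, as an input set may
  be as large as the field. It stays a separate factor.\<close>

lemma cost_ssum:
  assumes "length f < N" "t < N" "vb N zv" "\<forall>x\<in>set xs. length x < N"
  shows "cost m i_ssum (enc_ctx f t z zv ;; enc_vec xs) \<le> Suc (length xs) * (900 * pw N 3)"
proof -
  define D where "D = 900 * pw N 3"
  have "cost m i_ssum (enc_ctx f t z zv ;; enc_vec xs) \<le> Suc (length xs) * D"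
    using assms(4)
  proof (induction xs)
    case Nil
    show ?case by (rule cost_leI, subst unf_ssum) (use pw_chain D_def in simp)
  next
    case (Cons x xs)
    have "cost m i_bmul (enc_el f ;; enc_el x ;; enc_el x) \<le> 300 * pw N 2"
      by (rule cost_bmul) (use assms Cons in auto)
    moreover have "cost m i_pows (enc_el f ;; enc_unary t ;;
        enc_el x ;; enc_el (bmul f x x)) \<le> 400 * pw N 3"
      by (rule cost_pows) (use assms Cons in \<open>auto intro: length_bmul_less\<close>)
    moreover have "cost m i_vadd (enc_vec (pows f t x (bmul f x x)) ;;
        enc_vec (ssum f t zv xs)) \<le> 80 * pw N 2"
      by (rule cost_vadd) (use assms Cons in \<open>auto intro: vb_pows\<close>)
    ultimately show ?case
      by (intro cost_leI, subst unf_ssum) (use Cons pw_chain D_def in auto)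
  qed
  then show ?thesis by (simp add: D_def)
qed

lemma cost_sqs:
  assumes "length f < N" and "vb N v"
  shows "cost m i_sqs (enc_el f ;; enc_vec v) \<le> 400 * pw N 3"
    (is "?T \<le> _")
proof (rule loop_bound(3))
  show "?T \<le> Suc (length v) * (400 * pw N 2)"
    using assms(2)
  proof (induction v)
    case Nil
    show ?case
      by (rule cost_leI, subst unf_sqs) (use pw_chain in simp)
  next
    case (Cons x v)
    have s0: "cost m i_bmul (enc_el f ;; enc_el x ;; enc_el x) \<le> 300 * pw N 2"
      by (rule cost_bmul) (use assms(1) Cons in auto)
    show ?case
      by (rule cost_leI, subst unf_sqs) (use Cons s0 pw_chain in simp)
  qed
qed (use assms in \<open>auto simp: vb_def mb_def\<close>)

lemma cost_inter:
  assumes "length u < N"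
  shows "cost m i_inter (enc_vec u ;; enc_vec v) \<le> 40 * N"
    (is "?T \<le> _")
proof (rule loop_bound(1))
  show "?T \<le> Suc (length u) * 40"
    by (induction u v rule: inter.induct; rule cost_leI, subst unf_inter; use pw_chain assms in auto)
qed (use assms in \<open>auto simp: vb_def mb_def\<close>)

lemma cost_full:
  assumes "length f < N" and "n < N" and "2 * length u < N" and "vb N u" and "vb N F"
  shows "cost m i_full (enc_el f ;; enc_unary n ;; enc_vec u ;; enc_vec F) \<le> 500 * pw N 4"
    (is "?T \<le> _")
proof (rule loop_bound(3))
  show "?T \<le> Suc n * (500 * pw N 3)"
    using assms(5)
  proof (induction n arbitrary: F)
    case 0
    show ?case
      by (rule cost_leI, subst unf_full) (use pw_chain in simp)
  next
    case (Suc n)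
    have s0: "cost m i_sqs (enc_el f ;; enc_vec F) \<le> 400 * pw N 3"
      by (rule cost_sqs) (use assms Suc in auto)
    have s1: "cost m i_inter (enc_vec u ;; enc_vec (sqs f F)) \<le> 40 * N"
      by (rule cost_inter) (use assms in auto)
    have s2: "vb N (inter u (sqs f F))"
      by (rule vb_inter) (use assms Suc in \<open>auto intro: vb_sqs\<close>)
    show ?case
      by (rule cost_leI, subst unf_full) (use Suc(1)[OF s2] s0 s1 pw_chain in simp)
  qed
qed (use assms in \<open>auto simp: vb_def mb_def\<close>)

lemma cost_parse:
  assumes "length z < N" and "n < N"
  shows "cost m i_parse (enc_el z ;; enc_unary n ;; enc_el x) \<le> 200 * pw N 2"
    (is "?T \<le> _")
proof (rule loop_bound(2))
  show "?T \<le> Suc n * (200 * N)"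
  proof (induction n arbitrary: x)
    case 0
    show ?case
      by (rule cost_leI, subst unf_parse) (use pw_chain in simp)
  next
    case (Suc n)
    have s0: "cost m i_pad (enc_el z ;; enc_el x) \<le> 40 * N"
      by (rule cost_pad) (use assms in auto)
    have s1: "cost m i_drop (enc_el z ;; enc_el x) \<le> 40 * N"
      by (rule cost_drop) (use assms in auto)
    show ?case
      by (rule cost_leI, subst unf_parse)
          (use Suc(1)[of "drop (length z) x"] s0 s1 pw_chain in simp)
  qed
qed (use assms in \<open>auto simp: vb_def mb_def\<close>)

lemma cost_heads:
  assumes "length z < N" and "length L < N"
  shows "cost m i_heads (enc_el z ;; enc_mat L) \<le> 250 * pw N 2"
    (is "?T \<le> _")
proof (rule loop_bound(2))
  show "?T \<le> Suc (length L) * (250 * N)"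
  proof (induction L)
    case Nil
    show ?case
      by (rule cost_leI, subst unf_heads) (use pw_chain in simp)
  next
    case (Cons v L)
    have s0: "cost m i_pad (enc_el z ;; enc_el (hdd v)) \<le> 40 * N"
      by (rule cost_pad) (use assms in auto)
    have s1: "cost m i_eq (enc_el (pad z (hdd v)) ;; enc_el z) \<le> 150 * N"
      by (rule cost_eq_el) (use assms in auto)
    show ?case
      by (rule cost_leI, subst unf_heads)
          (use Cons s0 s1 pw_chain in \<open>cases "pad z (hdd v) = z"; simp\<close>)
  qed
qed (use assms in \<open>auto simp: vb_def mb_def\<close>)

lemma cost_toggle:
  assumes "length x < N"
  shows "cost m i_toggle (enc_el x ;; enc_vec L) \<le> Suc (length L) * (200 * N)"
proof -
  define D where "D = 200 * N"
  have "cost m i_toggle (enc_el x ;; enc_vec L) \<le> Suc (length L) * D"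
  proof (induction L)
    case Nil
    show ?case by (rule cost_leI, subst unf_toggle) (use pw_chain D_def in simp)
  next
    case (Cons y L)
    have "cost m i_eq (enc_el x ;; enc_el y) \<le> 150 * N" by (rule cost_eq_el) (use assms in auto)
    then show ?case by (intro cost_leI, subst unf_toggle) (use Cons pw_chain D_def in auto)
  qed
  then show ?thesis by (simp add: D_def)
qed

lemma cost_togall:
  assumes "vb N vs"
  shows "cost m i_togall (enc_vec vs ;; enc_vec L) \<le> Suc (length L) * (300 * pw N 3)"
proof -
  define D where "D = Suc (length L) * (250 * pw N 2)"
  have D: "250 * pw N 2 \<le> D" by (simp add: D_def)
  have "cost m i_togall (enc_vec vs ;; enc_vec L) \<le> Suc (length vs) * D"
    using assms
  proof (induction vs)
    case Nil
    show ?case by (rule cost_leI, subst unf_togall) (use pw_chain D in simp)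
  next
    case (Cons x vs)
    have "length (togall vs L) \<le> length vs + length L" by (rule length_togall_le)
    moreover have "Suc (length vs) < N" using Cons by (simp add: vb_def)
    ultimately have "Suc (length (togall vs L)) \<le> N + length L" by simp
    \<comment> \<open>The list grows during the toggling. Bounding the sum of the lengths by a
      product keeps the cost linear in \<open>length L\<close>.\<close>
    also have "\<dots> \<le> Suc (length L) * N" using N by (cases N) auto
    finally have "Suc (length (togall vs L)) * (200 * N) \<le> Suc (length L) * N * (200 * N)"
      by (rule mult_right_mono) simp
    also have "\<dots> = Suc (length L) * (200 * pw N 2)"
      by (simp add: pw_def power2_eq_square algebra_simps)
    finally have "cost m i_toggle (enc_el x ;; enc_vec (togall vs L))
        \<le> Suc (length L) * (200 * pw N 2)"
      using cost_toggle[of x "togall vs L"] Cons by simp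
    moreover have "50 * pw N 2 + Suc (length L) * (200 * pw N 2) \<le> D"
      by (simp add: D_def algebra_simps)
    ultimately show ?case
      by (intro cost_leI, subst unf_togall) (use Cons pw_chain in \<open>simp add: togall_def\<close>)
  qed
  also have "\<dots> \<le> D * N" by (rule loop_bound(1)[OF order_refl]) (use assms in \<open>simp_all add: vb_def\<close>)
  also have "\<dots> = Suc (length L) * (250 * pw N 3)"
    by (simp add: D_def pw_def power3_eq_cube power2_eq_square algebra_simps)
  also have "\<dots> \<le> Suc (length L) * (300 * pw N 3)" by (intro mult_left_mono) auto
  finally show ?thesis .
qed

lemma cost_mkctx:
  assumes "length f < N" "t < N"
  shows "cost m i_mkctx (enc_el f ;; enc_unary t) \<le> 200 * N"
proof -
  have "cost m i_bxor (enc_el (tl f) ;; enc_el (tl f)) \<le> 40 * N"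
    "cost m i_rep (enc_el (bxor (tl f) (tl f)) ;; enc_unary t) \<le> 40 * N"
    using assms by (auto intro!: cost_bxor cost_rep)
  then show ?thesis by (intro cost_leI, subst unf_mkctx) (use pw_chain in simp)
qed

lemma cost_locator:
  assumes "length f < N" "length z < N" "Suc t < N" "vb N F"
  shows "cost m i_locator (enc_ctx f t z zv ;; enc_vec F) \<le> 3000 * pw N 5"
proof -
  have id: "mb N (ident z (Suc t))" using assms by (intro mb_ident) auto
  have "mb N (eloop f z t F (ident z (Suc t)))" using assms id by (intro mb_eloop) auto
  then have "cost m i_last (enc_mat (eloop f z t F (ident z (Suc t)))) \<le> 40 * N"
    by (intro cost_last) (auto simp: mb_def)
  moreover have "cost m i_eloop (enc_ctx f t z zv ;; enc_unary t ;; enc_vec F ;;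
      enc_mat (ident z (Suc t))) \<le> 2600 * pw N 5"
    by (rule cost_eloop) (use assms id in auto)
  moreover have "cost m i_ident (enc_el z ;; Leaf ;; enc_unary t) \<le> 200 * pw N 2"
    using cost_ident[of "Suc t" z] assms by simp
  ultimately show ?thesis
    using call_ident[of m z "Suc t", unfolded enc_unary_simps]
    by (intro cost_leI, subst unf_locator) (use pw_chain in \<open>simp del: ident.simps\<close>)
qed

lemma cost_compan:
  assumes "length f < N" "length z < N" "Suc t < N" "vb N c"
  shows "cost m i_compan (enc_ctx f t z zv ;; enc_vec c) \<le> 2000 * pw N 4"
proof -
  define I where "I = tl (ident z t)"
  have lam: "length (lastd c) < N" using assms by (intro length_lastd)
  have id: "mb N (ident z t)" using assms by (intro mb_ident) auto
  then have I: "mb N I" unfolding I_def by (rule mb_tl)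
  have "cost m i_append (enc_mat (msmul f (lastd c) I) ;; enc_mat [take t c]) \<le> 40 * N"
    using I by (intro cost_append) (auto simp: mb_def msmul_def)
  moreover have "cost m i_msmul (enc_el f ;; enc_el (lastd c) ;; enc_mat I)
      \<le> 500 * pw N 4"
    by (rule cost_msmul) (use assms lam I in auto)
  moreover have "cost m i_last (enc_vec c) \<le> 40 * N"
    using assms by (intro cost_last) (auto simp: vb_def)
  moreover have "cost m i_ident (enc_el z ;; enc_unary t) \<le> 200 * pw N 2"
    using cost_ident[of t z] assms by simp
  moreover have "cost m i_take (enc_unary t ;; enc_vec c) \<le> 40 * N"
    using assms by (intro cost_take) auto
  moreover note call_append[of m enc_vec "msmul f (lastd c) I" "[take t c]", unfolded enc_list_simps]
  ultimately show ?thesis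
    by (intro cost_leI, subst unf_compan) (use pw_chain in \<open>simp add: I_def\<close>)
qed

lemma cost_decode:
  assumes "length f < N" "length z < N" "Suc t < N" "0 < length z" "vb N zv" "vb N S" "2 * length S < N"
  shows "cost m i_decode (enc_ctx f t z zv ;; enc_vec S) \<le> 11000 * pw N 7"
proof -
  define F where "F = full f t S S"
  define c where "c = locator f t z F"
  define M where "M = compan f t z c"
  define L where "L = consnz (take t F) []"
  define K where "K = sloop f t z zv M (length z) (unit_elem z) L"
  define H where "H = heads z K"
  have F: "vb N F" unfolding F_def using assms by (intro vb_full) auto
  have tF: "vb N (take t F)" using F assms by (auto simp: vb_def dest: in_set_takeD)
  have c: "vb N c" unfolding c_def locator_def using assms
    by (intro vb_lastd mb_eloop mb_ident) auto
  have M: "mb N M" unfolding M_def using assms c by (intro mb_compan) auto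
  have L: "mb N L" using tF assms by (auto simp: L_def consnz_def mb_def)
  have u: "length (unit_elem z) < N" using assms by (auto simp: unit_elem_def)
  have K: "mb N K" unfolding K_def using assms M L u by (intro mb_sloop) auto
  have H: "vb N H" unfolding H_def using assms K by (intro vb_heads) (auto simp: mb_def)
  have "cost m i_full (enc_el f ;; enc_unary t ;; enc_vec S ;; enc_vec S)
      \<le> 500 * pw N 4"
    using assms by (intro cost_full) auto
  moreover have "cost m i_locator (enc_ctx f t z zv ;; enc_vec F) \<le> 3000 * pw N 5"
    using assms F by (intro cost_locator) auto
  moreover have "cost m i_compan (enc_ctx f t z zv ;; enc_vec c) \<le> 2000 * pw N 4"
    using assms c by (intro cost_compan) auto
  moreover have "cost m i_take (enc_unary t ;; enc_vec F) \<le> 40 * N"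
    using assms by (intro cost_take) auto
  moreover have "cost m i_consnz (enc_vec (take t F) ;; enc_mat []) \<le> 400 * pw N 2"
    using tF by (intro cost_consnz)
  moreover have "cost m i_sloop (enc_ctx f t z zv ;; enc_mat M ;; enc_el z ;;
      enc_el (unit_elem z) ;; enc_mat L) \<le> 3500 * pw N 7"
    using assms M L u by (intro cost_sloop) auto
  moreover have "cost m i_heads (enc_el z ;; enc_mat K) \<le> 250 * pw N 2"
    using assms K by (intro cost_heads) (auto simp: mb_def)
  moreover have "cost m i_togall (enc_vec H ;; enc_vec []) \<le> 300 * pw N 3"
    using cost_togall[OF H, of "[]"] by simp
  moreover note call_consnz[of m "take t F" "[]", unfolded enc_list_simps(1), folded L_def, simp]
    call_sloop[of m f t z zv M enc_bool z "unit_elem z" L,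
      unfolded unit_elem_def enc_list_simps enc_bool_simps, folded unit_elem_def, folded K_def, simp]
    call_togall[of m H "[]", unfolded enc_list_simps(1), simp]
    F_def[symmetric, simp] c_def[symmetric, simp] M_def[symmetric, simp] H_def[symmetric, simp]
  ultimately show ?thesis
    by (intro cost_leI, subst unf_decode) (use pw_chain in \<open>simp add: unit_elem_def\<close>)
qed

text \<open>The syndromes of the candidate are recomputed even if decoding has failed, so the size
  of the candidate has to be bounded for arbitrary \<open>S\<close>.\<close>

lemma vb_decode:
  assumes "length z < N" "Suc t < N" "0 < length z" "vb N S" "2 * length S < N"
  shows "vb N (decode f t z zv S)"
proof -
  define F where "F = full f t S S"
  define M where "M = compan f t z (locator f t z F)"
  define L where "L = consnz (take t F) []"
  define K where "K = sloop f t z zv M (length z) (unit_elem z) L"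
  define H where "H = heads z K"
  have "vb N F" unfolding F_def using assms by (intro vb_full) auto
  then have "vb N (take t F)" using assms by (auto simp: vb_def dest: in_set_takeD)
  then have L: "mb N L" using assms by (auto simp: L_def consnz_def mb_def)
  have "vb N (locator f t z F)" unfolding locator_def using assms
    by (intro vb_lastd mb_eloop mb_ident) auto
  then have M: "mb N M" unfolding M_def using assms by (intro mb_compan) auto
  have "mb N K" unfolding K_def using assms M L by (intro mb_sloop) (auto simp: unit_elem_def)
  then have "vb N H" unfolding H_def using assms by (intro vb_heads) (auto simp: mb_def)
  then have "vb N (togall H [])"
    using set_togall_subset[of H "[]"] length_togall_le[of H "[]"] by (auto simp: vb_def)
  then show ?thesis by (simp add: decode_def Let_def F_def M_def L_def H_def K_def)
qed

end

section \<open>Step counts of the two main functions\<close>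

lemma cost_ss_main:
  assumes "length f < N" "t < N" "\<forall>x\<in>set xs. length x < N"
  shows "cost ss_main 0 ((enc_el f ;; enc_unary t) ;; enc_vec xs)
    \<le> Suc (length xs) * (2000 * pw N 3)"
proof -
  define z where "z = bxor (tl f) (tl f)"
  define D where "D = Suc (length xs) * (900 * pw N 3)"
  have N: "0 < N" using assms by simp
  have z: "length z < N" using assms by (simp add: z_def)
  have zv: "vb N (replicate t z)" using assms z by (auto simp: vb_def)
  have vb: "vb N (ssum f t (replicate t z) xs)" using assms zv by (intro vb_ssum)
  have "cost ss_main i_mkctx (enc_el f ;; enc_unary t) \<le> 200 * N"
    using N assms by (intro cost_mkctx)
  moreover have "cost ss_main i_ssum (enc_ctx f t z (replicate t z) ;; enc_vec xs) \<le> D"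
    unfolding D_def using N assms zv by (intro cost_ssum)
  moreover have "cost ss_main i_concat (enc_vec (ssum f t (replicate t z) xs)) \<le> 60 * pw N 2"
    using N vb by (intro cost_concat) (auto simp: vb_def)
  moreover have "900 * pw N 3 \<le> D" by (simp add: D_def)
  ultimately have "cost ss_main 0 ((enc_el f ;; enc_unary t) ;; enc_vec xs) \<le> D + 500 * pw N 3"
    by (intro cost_leI, subst unf_ss_main)
      (use pw_chain[OF N] in \<open>simp add: body_ss_main_def z_def[symmetric]\<close>)
  also have "\<dots> \<le> Suc (length xs) * (2000 * pw N 3)" by (simp add: D_def algebra_simps)
  finally show ?thesis .
qed

text \<open>\<open>2 * t < N\<close> makes room for the completed list of syndromes, and
  \<open>Suc t < N\<close> for the \<open>t + 1\<close> rows of the elimination.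
  \<open>Suc 0 < length f\<close> makes the zero string nonempty, so that the unit element is no
  longer than it.\<close>

lemma cost_rec_main:
  assumes "Suc 0 < length f" "length f < N" "2 * t < N" "Suc t < N" "\<forall>x\<in>set xs. length x < N"
  shows "cost rec_main 0 ((enc_el f ;; enc_unary t) ;; enc_vec xs ;; enc_el s)
    \<le> Suc (length xs) * (20000 * pw N 7)"
proof -
  define z where "z = bxor (tl f) (tl f)"
  define zv where "zv = replicate t z"
  define \<sigma> where "\<sigma> = vadd (ssum f t zv xs) (parse z t s)"
  define v where "v = decode f t z zv \<sigma>"
  define D where "D = Suc (length xs) * (900 * pw N 3)"
  define E where "E = Suc (length xs) * (300 * pw N 3)"
  have N: "0 < N" using assms by simp
  have z: "length z < N" "0 < length z" using assms by (simp_all add: z_def)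
  have zv: "vb N zv" using assms z by (auto simp: vb_def zv_def)
  have vb1: "vb N (ssum f t zv xs)" using assms zv by (intro vb_ssum) auto
  have "length (ssum f t zv xs) \<le> t" by (induction xs) (auto simp: zv_def)
  then have \<sigma>: "vb N \<sigma>" "2 * length \<sigma> < N" using vb1 assms by (auto simp: \<sigma>_def intro: vb_vadd)
  have v: "vb N v" unfolding v_def using assms z zv \<sigma> N by (intro vb_decode) auto
  have vb2: "vb N (ssum f t zv v)" using assms zv v by (intro vb_ssum) (auto simp: vb_def)
  have "cost rec_main i_mkctx (enc_el f ;; enc_unary t) \<le> 200 * N"
    using N assms by (intro cost_mkctx) auto
  moreover have "cost rec_main i_ssum (enc_ctx f t z zv ;; enc_vec xs) \<le> D"
    unfolding D_def using N assms zv by (intro cost_ssum) auto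
  moreover have "cost rec_main i_parse (enc_el z ;; enc_unary t ;; enc_el s) \<le> 200 * pw N 2"
    using N assms z by (intro cost_parse) auto
  moreover have "cost rec_main i_vadd (enc_vec (ssum f t zv xs) ;; enc_vec (parse z t s))
      \<le> 80 * pw N 2"
    using N vb1 by (intro cost_vadd)
  moreover have "cost rec_main i_decode (enc_ctx f t z zv ;; enc_vec \<sigma>) \<le> 11000 * pw N 7"
    using N assms z zv \<sigma> by (intro cost_decode) auto
  moreover have "cost rec_main i_ssum (enc_ctx f t z zv ;; enc_vec v) \<le> 900 * pw N 4"
  proof -
    have "cost rec_main i_ssum (enc_ctx f t z zv ;; enc_vec v) \<le> Suc (length v) * (900 * pw N 3)"
      using N assms zv v by (intro cost_ssum) (auto simp: vb_def)
    also have "\<dots> \<le> 900 * pw N 4"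
        by (rule loop_bound(3)[OF order_refl]) (use v in \<open>simp_all add: vb_def\<close>)
    finally show ?thesis .
  qed
  moreover have "cost rec_main i_eq (enc_vec (ssum f t zv v) ;; enc_vec \<sigma>) \<le> 150 * pw N 2"
    using N vb2 by (intro cost_eq_vec)
  moreover have "cost rec_main i_togall (enc_vec v ;; enc_vec xs) \<le> E"
    unfolding E_def using N v by (intro cost_togall)
  ultimately have "cost rec_main 0 ((enc_el f ;; enc_unary t) ;; enc_vec xs ;; enc_el s)
      \<le> D + E + 15000 * pw N 7"
    by (intro cost_leI, subst unf_rec_main)
      (use pw_chain[OF N] in \<open>cases "ssum f t zv v
          = \<sigma>"; simp add: body_rec_main_def z_def[symmetric] zv_def[symmetric]
        \<sigma>_def[symmetric] v_def[symmetric]\<close>)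
  also have "\<dots> \<le> Suc (length xs) * (1200 * pw N 7) + Suc (length xs) * (15000 * pw N 7)"
  proof (rule add_mono)
    have "D + E = Suc (length xs) * (1200 * pw N 3)" by (simp add: D_def E_def algebra_simps)
    also have "\<dots> \<le> Suc (length xs) * (1200 * pw N 7)"
      using pw_chain[OF N] by (intro mult_left_mono) auto
    finally show "D + E \<le> Suc (length xs) * (1200 * pw N 7)" .
  qed simp
  also have "\<dots> \<le> Suc (length xs) * (20000 * pw N 7)" by (simp add: algebra_simps)
  finally show ?thesis .
qed

section \<open>Correctness of the decoder\<close>

text \<open>The product \<open>p\<close> of the linear factors for all points except
  \<open>y\<close> has degree below \<open>card A\<close>. The equations therefore combine to a
  vanishing sum of \<open>c x * poly p x\<close>, in which only the term at \<open>y\<close>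
  survives.\<close>

lemma vandermonde_zero:
  fixes c :: "'k::field \<Rightarrow> 'k"
  assumes "finite A" and z: "\<And>i. i < card A \<Longrightarrow> (\<Sum>x\<in>A. c x * x ^ i) = 0" and "y \<in> A"
  shows "c y = 0"
proof -
  define p where "p = (\<Prod>x\<in>A - {y}. [:- x, 1:])"
  have deg: "degree p = card (A - {y})"
    unfolding p_def by (subst degree_prod_eq_sum_degree) auto
  then have dlt: "degree p < card A"
    using assms(1,3) by (metis card_Diff1_less)
  have "(\<Sum>x\<in>A. c x * poly p x) = (\<Sum>x\<in>A. \<Sum>i\<le>degree p. coeff p i * (c x * x ^ i))"
    by (simp add: poly_altdef sum_distrib_left mult.left_commute)
  also have "\<dots> = (\<Sum>i\<le>degree p. coeff p i * (\<Sum>x\<in>A. c x * x ^ i))"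
    by (subst sum.swap) (simp add: sum_distrib_left)
  also have "\<dots> = 0"
    using z dlt by (intro sum.neutral) auto
  finally have "(\<Sum>x\<in>A. c x * poly p x) = 0" .
  moreover have "poly p x = 0" if "x \<in> A - {y}" for x
    using that assms(1) by (auto simp: p_def poly_prod)
  then have "(\<Sum>x\<in>A. c x * poly p x) = c y * poly p y"
    using assms(1,3) by (subst sum.remove[OF assms(1,3)]) auto
  moreover have "poly p y \<noteq> 0"
    using assms(1) by (auto simp: p_def poly_prod)
  ultimately show ?thesis by simp
qed

text \<open>The linear span. Adding one multiple of a generator at a time gives the induction along
  which an elimination step transforms a combination of rows.\<close>

inductive_set pspan :: "'k::field poly set \<Rightarrow> 'k poly set" for R where
  zero: "0 \<in> pspan R"
| add: "p \<in> R \<Longrightarrow> q \<in> pspan R \<Longrightarrow> smult a p + q \<in> pspan R"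

lemma pspan_add: "p \<in> pspan R \<Longrightarrow> q \<in> pspan R \<Longrightarrow> p + q \<in> pspan R"
  by (induction rule: pspan.induct) (auto simp: add.assoc intro: pspan.add)

lemma pspan_base: "p \<in> R \<Longrightarrow> smult a p \<in> pspan R"
  using pspan.add[OF _ pspan.zero] by fastforce

lemma pspan_smult: "p \<in> pspan R \<Longrightarrow> smult a p \<in> pspan R"
  by (induction rule: pspan.induct) (auto simp: smult_add_right intro: pspan.intros)

lemma pspan_insertE:
  assumes "p \<in> pspan (insert r R)"
  obtains a q where "p = smult a r + q" "q \<in> pspan R"
proof -
  have "\<exists>a q. p = smult a r + q \<and> q \<in> pspan R"
    using assms
  proof (induction rule: pspan.induct)
    case zero
    then show ?case by (intro exI[of _ 0]) (auto intro: pspan.zero)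
  next
    case (add p q b)
    then obtain a q' where q: "q = smult a r + q'" "q' \<in> pspan R" by blast
    show ?case
    proof (cases "p = r")
      case True
      then have "smult b p + q = smult (b + a) r + q'" by (simp add: q smult_add_left add.assoc)
      then show ?thesis using q by blast
    next
      case False
      then have "smult b p + q = smult a r + (smult b p + q')" by (simp add: q algebra_simps)
      then show ?thesis using q False add.hyps by (blast intro: pspan.add)
    qed
  qed
  then show ?thesis using that by blast
qed

lemma pspan_sum: "(\<And>i. i \<in> I \<Longrightarrow> g i \<in> pspan R) \<Longrightarrow> sum g I \<in> pspan R"
  by (induction I rule: infinite_finite_induct) (auto intro: pspan.zero pspan_add)

lemma pspan_monoms: "degree p \<le> t \<Longrightarrow> p \<in> pspan (monom 1 ` {..t})"
proof -
  assume "degree p \<le> t"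
  then have "p = (\<Sum>i\<le>t. smult (coeff p i) (monom 1 i))"
    by (simp add: poly_as_sum_of_monoms' smult_monom)
  also have "\<dots> \<in> pspan (monom 1 ` {..t})" by (intro pspan_sum pspan_base) auto
  finally show ?thesis .
qed

text \<open>Used contrapositively: a polynomial of degree \<open>t\<close> in the span of the rows
  forces some row to have a nonzero coefficient at \<open>t\<close>.\<close>

lemma pspan_coeff_zero: "p \<in> pspan R \<Longrightarrow> (\<And>r. r \<in> R \<Longrightarrow> coeff r n = 0) \<Longrightarrow> coeff p n = 0"
  by (induction rule: pspan.induct) auto

text \<open>The value at \<open>\<alpha>\<close> of the polynomial whose coefficients are the given bits.\<close>

fun val_of :: "'k::field \<Rightarrow> bool list \<Rightarrow> 'k" where
  "val_of \<alpha> [] = 0"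
| "val_of \<alpha> (b # x) = of_bool b + \<alpha> * val_of \<alpha> x"

definition kdot :: "'k::field list \<Rightarrow> 'k list \<Rightarrow> 'k" where
  "kdot u w = sum_list (map2 (*) u w)"

lemma kdot_simps [simp]:
  "kdot [] w = 0" "kdot u [] = 0" "kdot (x # u) (y # w) = x * y + kdot u w"
  by (simp_all add: kdot_def)

lemma kdot_scale: "kdot u (map ((*) \<mu>) w) = \<mu> * kdot u w"
proof (induction u arbitrary: w)
  case (Cons x u) then show ?case by (cases w) (auto simp: algebra_simps)
qed simp

lemma kdot_conv_sum: "kdot u w = (\<Sum>i<min (length u) (length w). u ! i * w ! i)"
proof (induction u arbitrary: w)
  case (Cons x u) then show ?case
    by (cases w) (auto simp: sum.lessThan_Suc_shift simp del: sum.lessThan_Suc)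
qed simp

lemma bxor_self: "bxor x x = replicate (length x) False"
  by (induction x) auto

lemma bxor_eq_Nil [simp]: "bxor x y = [] \<longleftrightarrow> x = [] \<or> y = []"
  by (cases x; cases y) auto

lemma length_ident [simp]: "length (ident z n) = n"
  by (induction n) auto

lemma finite_bools: "finite {x :: bool list. length x = n}"
    and card_bools: "card {x :: bool list. length x = n} = 2 ^ n"
  using finite_lists_length_eq[of "UNIV :: bool set" n] card_lists_length_eq[of "UNIV :: bool set" n]
  by simp_all

text \<open>The ambient field may be much larger, such as an algebraic closure, with \<alpha> a root
  of the modulus in it. Of irreducibility only the injectivity of evaluation on strings of the
  length of field elements is kept; the values of these strings are the finite field
  \<open>F\<close>.\<close>

locale binary_field =
  fixes \<alpha> :: "'k::field" and f :: "bool list"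
  assumes char2: "(1 :: 'k) + 1 = 0"
    and length_f: "2 \<le> length f" and last_f: "last f" and val_f: "val_of \<alpha> f = 0"
    and inj: "inj_on (val_of \<alpha>) {x. length x = length f - 1}"
begin

definition "a = length f - 1"
abbreviation "v \<equiv> val_of \<alpha>"
abbreviation "V \<equiv> map v"
definition "z = replicate a False"
definition elems :: "vec \<Rightarrow> bool" where "elems u \<longleftrightarrow> (\<forall>x\<in>set u. length x = a)"
definition F :: "'k set" where "F = v ` {x. length x = a}"

lemma a_pos: "0 < a" using length_f by (simp add: a_def)
lemma len_f: "length f = Suc a" using length_f by (simp add: a_def)

section \<open>Arithmetic in characteristic 2\<close>

lemma add_self [simp]: "(x :: 'k) + x = 0"
proof -
  have "x + x = x * (1 + 1)" by (simp only: distrib_left mult_1_right)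
  then show ?thesis by (simp only: char2 mult_zero_right)
qed

lemma two_eq_0 [simp]: "(2 :: 'k) = 0"
  using char2 by (simp only: one_add_one)

lemma uminus_eq: "- (x :: 'k) = x"
  using add_self[of x] by (simp only: add_eq_0_iff2)

lemma add_self_left [simp]: "(x :: 'k) + (x + y) = y"
  by (simp add: add.assoc[symmetric])

lemma minus_eq: "(x :: 'k) - y = x + y"
  using uminus_eq[of y] by (metis diff_conv_add_uminus)

lemma add_eq_0: "(x :: 'k) + y = 0 \<longleftrightarrow> x = y"
  using minus_eq[of x y] by (metis eq_iff_diff_eq_0)

lemma sq_add: "((x :: 'k) + y)\<^sup>2 = x\<^sup>2 + y\<^sup>2"
proof -
  have "(x + y)\<^sup>2 = x\<^sup>2 + (x * y + x * y) + y\<^sup>2" by (simp only: power2_eq_square algebra_simps)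
  then show ?thesis by simp
qed

lemma sq_sum: "(\<Sum>x\<in>A. g x :: 'k)\<^sup>2 = (\<Sum>x\<in>A. (g x)\<^sup>2)"
  by (induction A rule: infinite_finite_induct) (auto simp: sq_add)

lemma pow2_add: "((x :: 'k) + y) ^ (2 ^ k) = x ^ (2 ^ k) + y ^ (2 ^ k)"
  by (induction k) (simp_all add: power_mult sq_add mult.commute[of 2])

section \<open>Bit strings as field elements\<close>

lemma v_replicate [simp]: "v (replicate n False) = 0"
  by (induction n) auto

lemma v_z [simp]: "v z = 0" by (simp add: z_def)
lemma length_z [simp]: "length z = a" by (simp add: z_def)

lemma v_bxor: "length x = length y \<Longrightarrow> v (bxor x y) = v x + v y"
proof (induction x y rule: bxor.induct)
  case (1 b x c y)
  then show ?case by (cases b; cases c) (auto simp: algebra_simps char2)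
qed auto

lemma v_append: "v (x @ y) = v x + \<alpha> ^ length x * v y"
  by (induction x) (auto simp: algebra_simps)

lemma bxor_truncate: "bxor x y = bxor x (take (length x) y)"
  by (induction x y rule: bxor.induct) auto

lemma v_inj: "length x = a \<Longrightarrow> length y = a \<Longrightarrow> v x = v y \<longleftrightarrow> x = y"
  using inj by (auto simp: a_def inj_on_def)

lemma bshift:
  assumes "length x = a"
  shows "length (bshift f x) = a" "v (bshift f x) = \<alpha> * v x"
proof -
  define y where "y = (if last x then bxor f (False # x) else False # x)"
  have x: "x \<noteq> []" using assms a_pos by auto
  have y: "length y = Suc a" using assms len_f by (simp add: y_def)
  have bs: "bshift f x = bxor (bxor x x) y" using x by (simp add: bshift_def y_def)
  show "length (bshift f x) = a" using bs y assms by simp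
  have last_bxor: "length u = length w \<Longrightarrow> u \<noteq> [] \<Longrightarrow> last (bxor u w) = (last u \<noteq> last w)" for u w
    by (induction u w rule: bxor.induct) auto
  have "f \<noteq> []" using len_f by auto
  \<comment> \<open>If the top bit of \<open>x\<close> is set, it meets the top bit of the modulus
    and cancels. Hence cutting back to \<open>a\<close> bits does not change the value.\<close>
  then have "\<not> last y" using last_bxor[of f "False # x"] last_f x assms len_f by (auto simp: y_def)
  have "v y = \<alpha> * v x" using assms len_f v_bxor[of f "False # x"] val_f by (simp add: y_def)
  moreover have "v y = v (take a y)"
  proof -
    have "y = butlast y @ [last y]" using y
        by (metis append_butlast_last_id length_0_conv nat.distinct(1))
    moreover have "butlast y = take a y" using y by (simp add: butlast_conv_take)
    ultimately have "v y = v (take a y @ [last y])" by simp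
    then show ?thesis using \<open>\<not> last y\<close> by (simp add: v_append)
  qed
  moreover have "v (bshift f x) = v (take a y)"
    unfolding bs using y assms
    by (subst bxor_truncate, subst v_bxor) (auto simp: bxor_self)
  ultimately show "v (bshift f x) = \<alpha> * v x" by simp
qed

lemma bmul:
  assumes "length x = a"
  shows "length (bmul f x y) = a \<and> v (bmul f x y) = v x * v y"
  using assms by (induction y) (auto simp: bshift v_bxor bxor_self algebra_simps)

lemmas length_bmul [simp] = bmul[THEN conjunct1]
lemmas v_bmul [simp] = bmul[THEN conjunct2]

section \<open>Vectors and matrices of field elements\<close>

lemma elems_Cons [simp]: "elems (x # u) \<longleftrightarrow> length x = a \<and> elems u"
  and elems_Nil [simp]: "elems []"
  by (auto simp: elems_def)

lemma vadd:
  "length u = length w \<Longrightarrow> elems u \<Longrightarrow> elems w \<Longrightarrow>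
     elems (vadd u w) \<and> V (vadd u w) = map2 (+) (V u) (V w)"
  by (induction u w rule: vadd.induct) (auto simp: v_bxor)

lemma smul: "length c = a \<Longrightarrow> elems (smul f c u) \<and> V (smul f c u) = map ((*) (v c)) (V u)"
  by (induction u) (auto simp: smul_def)

lemma kdot_map2_add:
  "length u = length w \<Longrightarrow> kdot (map2 (+) u w) y = kdot u y + kdot w y"
proof (induction u w arbitrary: y rule: list_induct2)
  case (Cons b u c w) then show ?case by (cases y) (auto simp: algebra_simps)
qed simp

lemma kdot_scale_left: "kdot (map ((*) c) u) y = c * kdot u y"
proof (induction u arbitrary: y)
  case (Cons b u) then show ?case by (cases y) (auto simp: algebra_simps)
qed simp

lemma kdot_scale_left' [simp]: "kdot (map ((*) c \<circ> g) u) y = c * kdot (map g u) y"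
  using kdot_scale_left[of c "map g u"] by simp

lemma kdot_zero: "kdot (replicate n 0) y = 0"
proof (induction n arbitrary: y)
  case (Suc n) then show ?case by (cases y) auto
qed simp

lemma dot:
  "elems u \<Longrightarrow> elems w \<Longrightarrow> length (dot f z u w) = a \<and> v (dot f z u w) = kdot (V u) (V w)"
  by (induction u w rule: vadd.induct) (auto simp: v_bxor)

definition wfm :: "nat \<Rightarrow> mat \<Rightarrow> bool" where
  "wfm n A \<longleftrightarrow> (\<forall>r\<in>set A. length r = n \<and> elems r)"

lemma wfm_Cons [simp]: "wfm n (r # A) \<longleftrightarrow> length r = n \<and> elems r \<and> wfm n A"
  and wfm_Nil [simp]: "wfm n []"
  by (auto simp: wfm_def)

text \<open>Matrices are described by their action on vectors over the ambient field, which avoids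
  formulas for the entries of a product.\<close>

definition app :: "mat \<Rightarrow> 'k list \<Rightarrow> 'k list" where
  "app A w = map (\<lambda>r. kdot (V r) w) A"

lemma length_app [simp]: "length (app A w) = length A" by (simp add: app_def)

lemma length_smul [simp]: "length (smul f c u) = length u" by (simp add: smul_def)

lemma lincomb:
  assumes "elems cs" "wfm n rs" "zv = replicate n z"
  shows "elems (lincomb f zv cs rs) \<and> length (lincomb f zv cs rs) = n \<and>
    kdot (V (lincomb f zv cs rs)) w = kdot (V cs) (app rs w)"
  using assms
proof (induction cs rs rule: list_induct2')
  case (4 c cs r rs)
  then show ?case
    using vadd[of "smul f c r" "lincomb f zv cs rs"] smul[of c r]
    by (auto simp: app_def kdot_map2_add kdot_scale_left)
qed (auto simp: elems_def kdot_zero app_def)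

lemma matmul:
  assumes "wfm k A" "wfm n B"
  shows "wfm n (matmul f (replicate n z) A B)"
    "app (matmul f (replicate n z) A B) w = app A (app B w)"
  using lincomb[OF _ assms(2) refl] assms(1) by (auto simp: matmul_def wfm_def app_def)

lemma madd:
  "length A = length B \<Longrightarrow> wfm n A \<Longrightarrow> wfm n B \<Longrightarrow>
    wfm n (madd A B) \<and> app (madd A B) w = map2 (+) (app A w) (app B w) \<and> length (madd A B)
        = length A"
proof (induction A B rule: madd.induct)
  case (1 u A w B)
  then show ?case using vadd[of u w] by (auto simp: app_def kdot_map2_add)
qed (auto simp: app_def)

lemma msmul:
  assumes "length c = a" "wfm n A"
  shows "wfm n (msmul f c A)" "app (msmul f c A) w = map ((*) (v c)) (app A w)"
  using assms smul[OF assms(1)] by (auto simp: msmul_def wfm_def app_def kdot_scale_left)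

lemma app_scale: "app A (map ((*) \<mu>) w) = map ((*) \<mu>) (app A w)"
  by (simp add: app_def kdot_scale)

text \<open>The recursion squares the matrix and with it the eigenvalue, so the powers
  \<open>\<mu> ^ 2 ^ i\<close> add up. Eigenvectors are enough, since vectors of power sums are sums
  of them.\<close>

lemma trmat:
  assumes "wfm n B" "length B = n"
  shows "wfm n (trmat f (replicate n z) k B) \<and> length (trmat f (replicate n z) k B) = n \<and>
    (app B w = map ((*) \<mu>) w \<longrightarrow> app (trmat f (replicate n z) k B) w = map ((*) (\<Sum>i<k. \<mu> ^ 2 ^ i)) w)"
  using assms
proof (induction k arbitrary: B \<mu>)
  case 0
  then show ?case using madd[of B B n w] by (auto intro!: nth_equalityI)
next
  case (Suc k)
  define C where "C = matmul f (replicate n z) B B"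
  have C: "wfm n C" "length C = n" "app C w = app B (app B w)"
    using matmul[OF Suc.prems(1) Suc.prems(1)] Suc.prems by (auto simp: C_def matmul_def)
  define T where "T = trmat f (replicate n z) k C"
  have T: "wfm n T" "length T = n"
    "app C w = map ((*) (\<mu>\<^sup>2)) w \<longrightarrow> app T w = map ((*) (\<Sum>i<k. (\<mu>\<^sup>2) ^ 2 ^ i)) w"
    using Suc.IH[OF C(1,2), of "\<mu>\<^sup>2"] by (auto simp: T_def)
  have *: "wfm n (madd B T) \<and> app (madd B T) w = map2 (+) (app B w) (app T w) \<and> length (madd B T)
      = n"
    using madd[of B T n w] Suc.prems T by simp
  have "app (madd B T) w = map ((*) (\<Sum>i<Suc k. \<mu> ^ 2 ^ i)) w" if "app B w = map ((*) \<mu>) w"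
  proof -
    have "app C w = map ((*) (\<mu>\<^sup>2)) w"
      using that by (simp add: C(3) app_scale o_def power2_eq_square mult.assoc)
    then have "app T w = map ((*) (\<Sum>i<k. (\<mu>\<^sup>2) ^ 2 ^ i)) w" using T by simp
    moreover have "(\<Sum>i<Suc k. \<mu> ^ 2 ^ i) = \<mu> + (\<Sum>i<k. (\<mu>\<^sup>2) ^ 2 ^ i)"
      by (subst sum.lessThan_Suc_shift) (simp add: power_mult[symmetric])
    ultimately show ?thesis using * that
      by (auto intro!: nth_equalityI simp: algebra_simps)
  qed
  then show ?case using * by (simp add: C_def[symmetric] T_def[symmetric])
qed

lemma matvec:
  assumes "wfm n A" "elems u"
  shows "elems (matvec f z A u)" "V (matvec f z A u) = app A (V u)"
  using assms dot by (auto simp: matvec_def wfm_def app_def elems_def)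

section \<open>The finite field and its trace\<close>

lemma F_add: "x \<in> F \<Longrightarrow> y \<in> F \<Longrightarrow> x + y \<in> F"
proof -
  assume "x \<in> F" "y \<in> F"
  then obtain p q where pq: "x = v p" "y = v q" "length p = a" "length q = a" by (auto simp: F_def)
  then show ?thesis by (auto simp: F_def v_bxor intro!: image_eqI[of _ _ "bxor p q"])
qed

lemma F_mult: "x \<in> F \<Longrightarrow> y \<in> F \<Longrightarrow> x * y \<in> F"
proof -
  assume "x \<in> F" "y \<in> F"
  then obtain p q where pq: "x = v p" "y = v q" "length p = a" "length q = a" by (auto simp: F_def)
  then show ?thesis by (auto simp: F_def intro!: image_eqI[of _ _ "bmul f p q"])
qed

lemma finite_F: "finite F" by (simp add: F_def finite_bools)

lemma card_F: "card F = 2 ^ a"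
  using card_image[OF inj] by (simp add: F_def a_def card_bools)

lemma zero_F: "0 \<in> F" unfolding F_def by (rule image_eqI[of _ _ z]) auto

text \<open>Multiplication by a nonzero \<open>y\<close> permutes the \<open>2 ^ a - 1\<close>
  nonzero elements of \<open>F\<close>. Comparing the products before and after gives
  \<open>y ^ (2 ^ a - 1) = 1\<close>.\<close>

lemma F_frobenius:
  assumes "y \<in> F"
  shows "y ^ 2 ^ a = y"
proof (cases "y = 0")
  case False
  define G where "G = F - {0}"
  have G: "finite G" "0 \<notin> G" "card G = 2 ^ a - 1"
    using finite_F card_F zero_F by (auto simp: G_def)
  have "inj_on ((*) y) G" using False by (auto simp: inj_on_def)
  moreover have "(*) y ` G \<subseteq> G" using False assms by (auto simp: G_def F_mult)
  ultimately have img: "(*) y ` G = G" using G(1) by (simp add: endo_inj_surj)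
  have "\<Prod>G = (\<Prod>x\<in>(*) y ` G. x)" by (simp add: img)
  also have "\<dots> = (\<Prod>x\<in>G. y * x)"
    using \<open>inj_on ((*) y) G\<close> by (subst prod.reindex) auto
  also have "\<dots> = y ^ (2 ^ a - 1) * \<Prod>G" by (simp add: prod.distrib G(3))
  finally have "y ^ (2 ^ a - 1) = 1" using G by (simp add: prod_zero_iff)
  then have "y * y ^ (2 ^ a - 1) = y" by simp
  then show ?thesis by (simp add: power_Suc[symmetric] del: power_Suc)
qed (use a_pos in simp)

definition Tr :: "'k \<Rightarrow> 'k" where "Tr y = (\<Sum>i<a. y ^ 2 ^ i)"

text \<open>Squaring shifts the sum by one place and \<open>y ^ 2 ^ a = y\<close> closes the cycle,
  so the trace equals its own square.\<close>

lemma Tr_cases: "y \<in> F \<Longrightarrow> Tr y = 0 \<or> Tr y = 1"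
proof -
  assume y: "y \<in> F"
  have "(Tr y)\<^sup>2 + y = (\<Sum>i<a. y ^ 2 ^ Suc i) + y"
    by (simp add: Tr_def sq_sum power_mult[symmetric] mult.commute[of 2])
  also have "\<dots> = (\<Sum>i<Suc a. y ^ 2 ^ i)"
    by (subst sum.lessThan_Suc_shift) simp
  also have "\<dots> = Tr y + y" using F_frobenius[OF y] by (simp add: Tr_def)
  finally have "Tr y * (Tr y - 1) = 0" by (simp add: algebra_simps power2_eq_square)
  then show ?thesis by auto
qed

lemma Tr_add: "Tr (x + y) = Tr x + Tr y"
  by (simp add: Tr_def pow2_add sum.distrib)

lemma Tr_zero [simp]: "Tr 0 = 0"
  by (simp add: Tr_def zero_power)

text \<open>Otherwise the trace polynomial, of degree \<open>2\<^sup>a\<^sup>-\<^sup>1\<close>, would vanish on all \<open>2\<^sup>a\<close> field elements.\<close>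

lemma Tr_nondegenerate:
  assumes d: "d \<in> F" and tr: "\<And>j. j < a \<Longrightarrow> Tr (\<alpha> ^ j * d) = 0"
  shows "d = 0"
proof (rule ccontr)
  assume nz: "d \<noteq> 0"
  \<comment> \<open>Additivity extends the hypothesis from powers of \<alpha> to all bit strings.
    The offset \<open>k\<close> records which power the first bit of \<open>x\<close> belongs
    to.\<close>
  have "k + length x \<le> a \<Longrightarrow> Tr (\<alpha> ^ k * v x * d) = 0" for k x
  proof (induction x arbitrary: k)
    case (Cons b x)
    have "\<alpha> ^ k * v (b # x) * d = of_bool b * (\<alpha> ^ k * d) + \<alpha> ^ Suc k * v x * d"
      by (simp add: algebra_simps)
    moreover have "Tr (of_bool b * (\<alpha> ^ k * d)) = 0" using tr[of k] Cons.prems by (cases b) auto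
    moreover have "Tr (\<alpha> ^ Suc k * v x * d) = 0" using Cons.IH[of "Suc k"] Cons.prems by simp
    ultimately show ?case by (simp only: Tr_add) simp
  qed simp
  note ind = this
  have tr0: "Tr (c * d) = 0" if "c \<in> F" for c
  proof -
    from that obtain x where "c = v x" "length x = a" by (auto simp: F_def)
    then show ?thesis using ind[of 0 x] by simp
  qed
  have "inj_on (\<lambda>c. c * d) F" using nz by (auto simp: inj_on_def)
  moreover have "(\<lambda>c. c * d) ` F \<subseteq> F" using d F_mult by auto
  ultimately have img: "(\<lambda>c. c * d) ` F = F" using finite_F by (simp add: endo_inj_surj)
  define p :: "'k poly" where "p = (\<Sum>i<a. monom 1 (2 ^ i))"
  \<comment> \<open>Only the summand for \<open>i = 0\<close> has degree 1, so the trace polynomial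
    is not zero.\<close>
  have "coeff p 1 = (\<Sum>i<a. if i = 0 then 1 else 0)"
    unfolding p_def coeff_sum coeff_monom by (intro sum.cong refl if_cong) simp_all
  also have "\<dots> = 1" using a_pos by (subst sum.delta) auto
  finally have "p \<noteq> 0" by auto
  have "degree p \<le> 2 ^ (a - 1)" unfolding p_def
  proof (rule degree_sum_le)
    fix i assume "i \<in> {..<a}"
    then have "(2::nat) ^ i \<le> 2 ^ (a - 1)" by (intro power_increasing) auto
    then show "degree (monom (1 :: 'k) (2 ^ i)) \<le> 2 ^ (a - 1)" by (simp add: degree_monom_eq)
  qed simp
  also have "\<dots> < 2 ^ a" using a_pos by simp
  finally have deg: "degree p < card F" by (simp add: card_F)
  have "F \<subseteq> {x. poly p x = 0}"
  proof
    fix y assume "y \<in> F"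
    then have "Tr y = 0" using tr0 img by (metis imageE)
    then show "y \<in> {x. poly p x = 0}" by (simp add: p_def poly_sum poly_monom Tr_def)
  qed
  then have "card F \<le> card {x. poly p x = 0}"
    by (rule card_mono[OF poly_roots_finite[OF \<open>p \<noteq> 0\<close>]])
  also have "\<dots> \<le> degree p" by (rule card_poly_roots_bound[OF \<open>p \<noteq> 0\<close>])
  finally have "card F \<le> degree p" .
  with deg show False by simp
qed

section \<open>Power sums and their splitting by trace values\<close>

definition psums :: "nat \<Rightarrow> 'k set \<Rightarrow> 'k list" where
  "psums t u = map (\<lambda>i. \<Sum>x\<in>u. x ^ Suc i) [0..<t]"

lemma length_psums [simp]: "length (psums t u) = t" by (simp add: psums_def)

text \<open>Taking one factor \<open>x\<close> out of each power leaves a Vandermonde system with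
  the weights \<open>x\<close>, which are nonzero.\<close>

lemma psums_zero_imp_empty:
  assumes "finite u" "card u \<le> t" "0 \<notin> u" "psums t u = replicate t 0"
  shows "u = {}"
proof (rule ccontr)
  assume "u \<noteq> {}"
  then obtain y where y: "y \<in> u" by blast
  have "(\<Sum>x\<in>u. x * x ^ i) = 0" if "i < card u" for i
  proof -
    have "psums t u ! i = replicate t 0 ! i" using assms by simp
    then show ?thesis using that assms(2) by (simp add: psums_def)
  qed
  from vandermonde_zero[OF assms(1) this y] y assms(3) show False by simp
qed

definition consne :: "'k set \<Rightarrow> 'k set list \<Rightarrow> 'k set list" where
  "consne u us = (if u = {} then us else u # us)"

lemma consne_props:
  "{} \<in> set (consne u us) \<longleftrightarrow> {} \<in> set us" "\<Union>(set (consne u us)) = u \<union> \<Union>(set us)"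
  "sum_list (map card (consne u us)) = card u + sum_list (map card us)"
  "set (consne u us) \<subseteq> insert u (set us)"
  by (auto simp: consne_def)

definition rep :: "nat \<Rightarrow> vec \<Rightarrow> 'k set \<Rightarrow> bool" where
  "rep t \<phi> u \<longleftrightarrow> elems \<phi> \<and> V \<phi> = psums t u"

text \<open>The test for the zero vector detects exactly the empty set, because at most
  \<open>t\<close> nonzero elements are involved.\<close>

lemma consnz_rep:
  assumes "rep t \<phi> u" "list_all2 (rep t) L us" "finite u" "card u \<le> t" "0 \<notin> u"
  shows "list_all2 (rep t) (consnz \<phi> L) (consne u us)"
proof -
  have el: "elems \<phi>" and V: "V \<phi> = psums t u" using assms(1) by (auto simp: rep_def)
  have "\<phi> = vadd \<phi> \<phi> \<longleftrightarrow> V \<phi> = replicate (length \<phi>) 0"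
    using el by (induction \<phi>) (auto simp: bxor_self v_inj[of _ z, simplified] z_def[symmetric])
  moreover have "length \<phi> = t" using V by (metis length_map length_psums)
  ultimately have "\<phi> = vadd \<phi> \<phi> \<longleftrightarrow> u = {}"
    using psums_zero_imp_empty[OF assms(3-5)] V
    by (auto simp: psums_def map_replicate_const)
  then show ?thesis using assms by (simp add: consnz_def consne_def)
qed

text \<open>What \<open>splits\<close> does to the sets behind the vectors. Writing the second part
  with \<open>\<tau> x \<noteq> 1\<close> makes the two parts complementary for every
  \<open>\<tau>\<close>.\<close>

fun ssets :: "('k \<Rightarrow> 'k) \<Rightarrow> 'k set list \<Rightarrow> 'k set list" where
  "ssets \<tau> [] = []"
| "ssets \<tau> (u # us) = consne {x\<in>u. \<tau> x = 1} (consne {x\<in>u. \<tau> x \<noteq> 1} (ssets \<tau> us))"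

text \<open>Disjointness of the classes is not stated as such; it is carried by the sum of the
  cardinalities together with the union.\<close>

lemma ssets_props:
  assumes "\<forall>u\<in>set us. finite u"
  shows "{} \<notin> set (ssets \<tau> us)" "\<Union>(set (ssets \<tau> us)) = \<Union>(set us)"
    "sum_list (map card (ssets \<tau> us)) = sum_list (map card us)"
    "w \<in> set (ssets \<tau> us) \<Longrightarrow> \<exists>u\<in>set us. w = {x\<in>u. \<tau> x = 1} \<or> w = {x\<in>u. \<tau> x \<noteq> 1}"
proof -
  show "{} \<notin> set (ssets \<tau> us)" by (induction us) (simp_all add: consne_props(1))
  show "\<Union>(set (ssets \<tau> us)) = \<Union>(set us)"
  proof (induction us)
    case (Cons u us)
    have "{x\<in>u. \<tau> x = 1} \<union> ({x\<in>u. \<tau> x \<noteq> 1} \<union> Y) = u \<union> Y" for Y by auto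
    with Cons show ?case by (simp only: ssets.simps consne_props(2) list.set Union_insert)
  qed simp
  show "sum_list (map card (ssets \<tau> us)) = sum_list (map card us)"
    using assms
  proof (induction us)
    case (Cons u us)
    have "card u = card ({x\<in>u. \<tau> x = 1} \<union> {x\<in>u. \<tau> x \<noteq> 1})" by (rule arg_cong[of _ _ card]) auto
    also have "\<dots> = card {x\<in>u. \<tau> x = 1} + card {x\<in>u. \<tau> x \<noteq> 1}"
      using Cons.prems by (intro card_Un_disjoint) auto
    finally show ?case using Cons by (simp add: consne_props(3))
  qed simp
  show "w \<in> set (ssets \<tau> us) \<Longrightarrow> \<exists>u\<in>set us. w = {x\<in>u. \<tau> x = 1} \<or> w = {x\<in>u. \<tau> x \<noteq> 1}"
  proof (induction us)
    case (Cons u us)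
    from Cons.prems consider "w = {x\<in>u. \<tau> x = 1}" | "w = {x\<in>u. \<tau> x \<noteq> 1}"
      | "w \<in> set (ssets \<tau> us)"
      unfolding ssets.simps consne_def by (auto split: if_splits simp del: Collect_empty_eq)
    then show ?case
    proof cases
      case 3
      then show ?thesis using Cons.IH by simp
    qed simp_all
  qed simp
qed

text \<open>A vector of power sums is the sum of the vectors \<open>psums t {x}\<close>, and the dot
  product is linear.\<close>

lemma kdot_psums: "finite u \<Longrightarrow> kdot r (psums t u) = (\<Sum>x\<in>u. kdot r (psums t {x}))"
proof -
  have "kdot r (psums t u) = (\<Sum>i<min (length r) t. r ! i * (\<Sum>x\<in>u. x ^ Suc i))"
    by (simp add: kdot_conv_sum psums_def del: power_Suc)
  also have "\<dots> = (\<Sum>x\<in>u. \<Sum>i<min (length r) t. r ! i * x ^ Suc i)"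
    by (subst sum.swap) (simp add: sum_distrib_left)
  also have "\<dots> = (\<Sum>x\<in>u. kdot r (psums t {x}))"
    by (simp add: kdot_conv_sum psums_def del: power_Suc)
  finally show ?thesis .
qed

text \<open>On a sum of eigenvectors, \<open>T\<close> keeps those with eigenvalue 1 and kills those
  with eigenvalue 0. Adding the original vector leaves the complementary sum, as the characteristic
  is 2.\<close>

lemma split_rep:
  assumes T: "wfm t T" "length T = t"
    and eig: "\<And>x. x \<in> u \<Longrightarrow> app T (psums t {x}) = map ((*) (\<tau> x)) (psums t {x})"
    and \<tau>: "\<And>x. x \<in> u \<Longrightarrow> \<tau> x = 0 \<or> \<tau> x = 1"
    and u: "finite u" and \<phi>: "rep t \<phi> u"
  shows "rep t (matvec f z T \<phi>) {x\<in>u. \<tau> x = 1}"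
    "rep t (vadd \<phi> (matvec f z T \<phi>)) {x\<in>u. \<tau> x \<noteq> 1}"
proof -
  have el: "elems \<phi>" and V: "V \<phi> = psums t u" using \<phi> by (auto simp: rep_def)
  have len: "length \<phi> = t" using V by (metis length_map length_psums)
  have "app T (psums t u) = psums t {x\<in>u. \<tau> x = 1}"
  proof (rule nth_equalityI)
    fix i assume "i < length (app T (psums t u))"
    then have i: "i < t" by (simp add: T)
    have *: "kdot (V (T ! i)) (psums t {x}) = \<tau> x * x ^ Suc i" if "x \<in> u" for x
    proof -
      have "app T (psums t {x}) ! i = map ((*) (\<tau> x)) (psums t {x}) ! i" by (simp add: eig[OF that])
      then show ?thesis using i T by (simp add: app_def psums_def)
    qed
    have "app T (psums t u) ! i = (\<Sum>x\<in>u. \<tau> x * x ^ Suc i)"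
      using i T * u by (simp add: app_def kdot_psums[OF u] del: power_Suc)
    also have "\<dots> = (\<Sum>x\<in>u. if \<tau> x = 1 then x ^ Suc i else 0)"
      using \<tau> by (intro sum.cong) auto
    also have "\<dots> = psums t {x\<in>u. \<tau> x = 1} ! i"
      using i u by (simp add: psums_def sum.If_cases Int_def del: power_Suc)
    finally show "app T (psums t u) ! i = psums t {x\<in>u. \<tau> x = 1} ! i" .
  qed (simp add: T)
  then show 1: "rep t (matvec f z T \<phi>) {x\<in>u. \<tau> x = 1}"
    using matvec[OF T(1) el] V by (simp add: rep_def)
  have "map2 (+) (psums t u) (psums t {x\<in>u. \<tau> x = 1}) = psums t {x\<in>u. \<tau> x \<noteq> 1}"
  proof (rule nth_equalityI)
    fix i assume "i < length (map2 (+) (psums t u) (psums t {x\<in>u. \<tau> x = 1}))"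
    then have i: "i < t" by simp
    have "(\<Sum>x\<in>u. x ^ Suc i) = (\<Sum>x\<in>{x\<in>u. \<tau> x = 1} \<union> {x\<in>u. \<tau> x \<noteq> 1}. x ^ Suc i)"
      by (rule sum.cong) auto
    also have "\<dots> = (\<Sum>x\<in>{x\<in>u. \<tau> x = 1}. x ^ Suc i) + (\<Sum>x\<in>{x\<in>u. \<tau> x \<noteq> 1}. x ^ Suc i)"
      using u by (intro sum.union_disjoint) auto
    finally show "map2 (+) (psums t u) (psums t {x\<in>u. \<tau> x = 1}) ! i = psums t {x\<in>u. \<tau> x \<noteq> 1} ! i"
      using i by (simp add: psums_def del: power_Suc)
  qed simp
  moreover have "length (matvec f z T \<phi>) = length \<phi>" using T len by (simp add: matvec_def)
  ultimately show "rep t (vadd \<phi> (matvec f z T \<phi>)) {x\<in>u. \<tau> x \<noteq> 1}"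
    using 1 vadd[of \<phi> "matvec f z T \<phi>"] el V by (simp add: rep_def)
qed

lemma splits_rep:
  assumes T: "wfm t T" "length T = t"
    and eig: "\<And>x. x \<in> S \<Longrightarrow> app T (psums t {x}) = map ((*) (\<tau> x)) (psums t {x})"
    and \<tau>: "\<And>x. x \<in> S \<Longrightarrow> \<tau> x = 0 \<or> \<tau> x = 1"
    and S: "finite S" "card S \<le> t" "0 \<notin> S"
    and L: "list_all2 (rep t) L us" "\<Union>(set us) \<subseteq> S"
  shows "list_all2 (rep t) (splits f z T L) (ssets \<tau> us)"
  using L
proof (induction L us rule: list_all2_induct)
  case (Cons \<phi> L u us)
  have u: "u \<subseteq> S" "finite u" using Cons.prems S finite_subset by auto
  have sub: "finite w \<and> card w \<le> t \<and> 0 \<notin> w" if "w \<subseteq> S" for w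
    using that S finite_subset card_mono[OF S(1) that] by auto
  have w: "{x\<in>u. \<tau> x = 1} \<subseteq> S" "{x\<in>u. \<tau> x \<noteq> 1} \<subseteq> S" using u by auto
  from Cons have IH: "list_all2 (rep t) (splits f z T L) (ssets \<tau> us)" by auto
  have r: "rep t (matvec f z T \<phi>) {x\<in>u. \<tau> x = 1}"
    "rep t (vadd \<phi> (matvec f z T \<phi>)) {x\<in>u. \<tau> x \<noteq> 1}"
    by (rule split_rep[OF T _ _ u(2) Cons.hyps(1)]; use eig \<tau> u in blast)+
  show ?case
    unfolding splits.simps ssets.simps
    using sub[OF w(1)] sub[OF w(2)] r IH by (intro consnz_rep) auto
qed simp

text \<open>The classes \<open>us\<close> partition \<open>S\<close> (by the count of elements), and the first \<open>j\<close> traces do not separate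
  elements of the same class.\<close>

definition good :: "nat \<Rightarrow> 'k set \<Rightarrow> 'k \<Rightarrow> nat \<Rightarrow> mat \<Rightarrow> 'k set list \<Rightarrow> bool" where
  "good t S \<mu> j L us \<longleftrightarrow> list_all2 (rep t) L us \<and> {} \<notin> set us \<and> \<Union>(set us) = S \<and>
     sum_list (map card us) = card S \<and>
     (\<forall>u\<in>set us. \<forall>x\<in>u. \<forall>y\<in>u. \<forall>i<j. Tr (\<alpha> ^ i * (\<mu> * x)) = Tr (\<alpha> ^ i * (\<mu> * y)))"

lemma length_le_sum_card:
  "\<forall>u\<in>set us. finite u \<Longrightarrow> {} \<notin> set us \<Longrightarrow> length us \<le> sum_list (map card us)"
proof (induction us)
  case (Cons u us)
  then have "1 \<le> card u" by (auto simp: Suc_le_eq card_gt_0_iff)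
  with Cons show ?case by simp
qed simp

text \<open>Round \<open>j\<close> acts on the eigenvector of \<open>x\<close> by the trace of
  \<open>\<alpha> ^ j * (\<mu> * x)\<close> and refines the classes by it. The factor \<mu> is there
  because the companion matrix is scaled.\<close>

lemma sloop_good:
  assumes M: "wfm t M" "length M = t"
    and eig: "\<forall>x\<in>S. app M (psums t {x}) = map ((*) (\<mu> * x)) (psums t {x})"
    and S: "finite S" "card S \<le> t" "0 \<notin> S" "S \<subseteq> F" and \<mu>: "\<mu> \<in> F"
    and L: "good t S \<mu> j L us" and b: "length b = a" "v b = \<alpha> ^ j"
  shows "\<exists>us'. good t S \<mu> (j + n) (sloop f t z (replicate t z) M n b L) us'"
  using L b
proof (induction n arbitrary: j b L us)
  case (Suc n)
  define B where "B = msmul f b M"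
  define T where "T = trmat f (replicate t z) a B"
  define \<tau> where "\<tau> x = Tr (\<alpha> ^ j * (\<mu> * x))" for x
  have B: "wfm t B" "length B = t"
    using msmul(1)[OF Suc.prems(2) M(1)] M by (auto simp: B_def msmul_def)
  have appB: "app B (psums t {x}) = map ((*) (\<alpha> ^ j * (\<mu> * x))) (psums t {x})" if "x \<in> S" for x
    using msmul(2)[OF Suc.prems(2) M(1)] bspec[OF eig that] Suc.prems(3)
    by (simp add: B_def o_def mult.assoc)
  have T: "wfm t T" "length T = t" using trmat[OF B, of a] by (simp_all add: T_def)
  have appT: "app T (psums t {x}) = map ((*) (\<tau> x)) (psums t {x})" if "x \<in> S" for x
    using trmat[OF B, of a "psums t {x}"] appB[OF that] by (simp add: T_def \<tau>_def Tr_def)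
  have \<tau>: "\<tau> x = 0 \<or> \<tau> x = 1" if "x \<in> S" for x
  proof -
    have "\<alpha> ^ j \<in> F" using Suc.prems by (auto simp: F_def intro!: image_eqI[of _ _ b])
    then show ?thesis unfolding \<tau>_def using that S \<mu> by (intro Tr_cases F_mult) auto
  qed
  have us: "list_all2 (rep t) L us" "\<Union>(set us) = S" "sum_list (map card us) = card S"
    and sep: "\<And>u x y i. u \<in> set us \<Longrightarrow> x \<in> u \<Longrightarrow> y \<in> u \<Longrightarrow> i < j \<Longrightarrow>
      Tr (\<alpha> ^ i * (\<mu> * x)) = Tr (\<alpha> ^ i * (\<mu> * y))"
    using Suc.prems(1) unfolding good_def by blast+
  have fin: "\<forall>u\<in>set us. finite u" using us(2) S(1) by (auto intro: finite_subset[of _ S])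
  define us' where "us' = ssets \<tau> us"
  define L' where "L' = splits f z T L"
  note ss = ssets_props[OF fin, where \<tau> = \<tau>, folded us'_def]
  have L': "list_all2 (rep t) L' us'" unfolding L'_def us'_def
    by (rule splits_rep[OF T _ _ S(1-3) us(1)]) (use appT \<tau> us in auto)
  have "\<forall>u\<in>set us'. finite u"
  proof
    fix u assume "u \<in> set us'"
    then obtain w where "w \<in> set us" "u = {x\<in>w. \<tau> x = 1} \<or> u = {x\<in>w. \<tau> x \<noteq> 1}" using ss(4) by blast
    then show "finite u" using fin by auto
  qed
  \<comment> \<open>The classes are nonempty and their sizes add up to \<open>card S\<close>, so
    cutting the list at \<open>t\<close> removes nothing.\<close>
  then have "length us' \<le> t"
    using length_le_sum_card[of us'] ss(1,3) us(3) S(2) by simp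
  then have "take t L' = L'" using list_all2_lengthD[OF L'] by simp
  moreover have "good t S \<mu> (Suc j) L' us'"
    unfolding good_def
  proof (intro conjI ballI allI impI)
    fix u x y i assume *: "u \<in> set us'" "x \<in> u" "y \<in> u" "i < Suc j"
    obtain w where w: "w \<in> set us" "u = {x\<in>w. \<tau> x = 1} \<or> u = {x\<in>w. \<tau> x \<noteq> 1}"
      using ss(4)[OF *(1)] by blast
    have xy: "x \<in> w" "y \<in> w" "x \<in> S" "y \<in> S" using w * us(2) by auto
    \<comment> \<open>As \<open>\<tau>\<close> takes only the values 0 and 1 on \<open>S\<close>, it
      is constant on the part defined by \<open>\<tau> x \<noteq> 1\<close>, too.\<close>
    have "\<tau> x = \<tau> y" using w(2) * \<tau>[OF xy(3)] \<tau>[OF xy(4)] by auto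
    then show "Tr (\<alpha> ^ i * (\<mu> * x)) = Tr (\<alpha> ^ i * (\<mu> * y))"
      using sep[OF w(1) xy(1,2), of i] *(4) by (cases "i = j") (auto simp: \<tau>_def)
  qed (use L' ss(1-3) us in auto)
  moreover have "length (bshift f b) = a" "v (bshift f b) = \<alpha> ^ Suc j"
    using bshift[OF Suc.prems(2)] Suc.prems(3) by auto
  ultimately have "\<exists>us'. good t S \<mu> (Suc j + n)
      (sloop f t z (replicate t z) M n (bshift f b) (take t L')) us'"
    by (intro Suc.IH) simp_all
  then show ?case by (simp add: L'_def T_def B_def)
qed auto

text \<open>For two elements of a class, the difference of their multiples by \<mu> has trace zero
  against every power of \<alpha>. Nondegeneracy makes the multiples equal, and \<mu> can be
  cancelled.\<close>

lemma good_singletons: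
  assumes "good t S \<mu> a L us" "S \<subseteq> F" "\<mu> \<in> F" "\<mu> \<noteq> 0" "u \<in> set us"
  shows "\<exists>x\<in>S. u = {x}"
proof -
  have us: "{} \<notin> set us" "\<Union>(set us) = S"
    using assms(1) unfolding good_def by blast+
  have sep: "\<forall>u\<in>set us. \<forall>x\<in>u. \<forall>y\<in>u. \<forall>i<a. Tr (\<alpha> ^ i * (\<mu> * x)) = Tr (\<alpha> ^ i * (\<mu> * y))"
    using assms(1) unfolding good_def by blast
  have uS: "u \<subseteq> S" unfolding us(2)[symmetric] using assms(5) by (rule Union_upper)
  have "u \<noteq> {}"
  proof
    assume "u = {}"
    then show False using us(1) assms(5) by simp
  qed
  then obtain x where x: "x \<in> u" by blast
  have "y = x" if y: "y \<in> u" for y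
  proof -
    have xy: "x \<in> F" "y \<in> F"
        using subsetD[OF assms(2) subsetD[OF uS x]] subsetD[OF assms(2) subsetD[OF uS y]] .
    have "\<mu> * x + \<mu> * y = 0"
    proof (rule Tr_nondegenerate)
      show "\<mu> * x + \<mu> * y \<in> F" using xy assms(3) by (intro F_add F_mult)
      fix i assume i: "i < a"
      have "Tr (\<alpha> ^ i * (\<mu> * x)) = Tr (\<alpha> ^ i * (\<mu> * y))"
        by (rule sep[rule_format, OF assms(5) x y i])
      then show "Tr (\<alpha> ^ i * (\<mu> * x + \<mu> * y)) = 0" by (simp add: distrib_left Tr_add)
    qed
    then have "\<mu> * x = \<mu> * y" by (simp only: add_eq_0)
    then show ?thesis using assms(4) by simp
  qed
  then have "u = {x}" using x by blast
  moreover have "x \<in> S" using x uS by (rule subsetD[rotated])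
  ultimately show ?thesis by (rule bexI)
qed

lemma pad_same: "length x = length y \<Longrightarrow> pad y x = x"
  by (induction x y rule: list_induct2) auto

text \<open>The first power sum of a singleton is its element, and \<open>1 \<le> t\<close> provides
  that coordinate.\<close>

lemma heads_singletons:
  assumes "list_all2 (rep t) L us" "\<forall>u\<in>set us. \<exists>x. u = {x} \<and> x \<noteq> 0" "1 \<le> t"
  shows "elems (heads z L) \<and> map (\<lambda>x. {v x}) (heads z L) = us"
  using assms(1,2)
proof (induction L us rule: list_all2_induct)
  case (Cons \<phi> L u us)
  obtain x where x: "u = {x}" "x \<noteq> 0" using Cons.prems by auto
  have \<phi>: "elems \<phi>" "V \<phi> = psums t {x}" using Cons.hyps x by (auto simp: rep_def)
  have "psums t {x} = x # map (\<lambda>i. x ^ Suc (Suc i)) [0..<t - 1]"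
    using assms(3) by (intro nth_equalityI) (auto simp: psums_def nth_Cons split: nat.split)
  then obtain p \<phi>' where p: "\<phi> = p # \<phi>'" "v p = x" using \<phi>(2) by auto
  have "length p = a" using p \<phi>(1) by auto
  moreover have "p \<noteq> z" using p x by auto
  ultimately show ?case using Cons p x by (auto simp: hdd_def pad_same)
qed simp

lemma length_heads_le: "length (heads y L) \<le> length L"
  by (induction L) auto

lemma toggle_props:
  "distinct L \<Longrightarrow> distinct (toggle x L) \<and> set (toggle x L) = sym_diff {x} (set L)"
  by (induction L) auto

lemma distinct_togall: "distinct L \<Longrightarrow> distinct (togall vs L)"
  by (induction vs) (auto simp: togall_def toggle_props)

lemma set_togall:
  "distinct vs \<Longrightarrow> distinct L \<Longrightarrow> set (togall vs L) = sym_diff (set vs) (set L)"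
proof (induction vs)
  case (Cons x vs)
  have "distinct (togall vs L)" using Cons.prems by (intro distinct_togall)
  from toggle_props[OF this, of x] Cons show ?case by (auto simp: togall_def)
qed (simp add: togall_def)

text \<open>Two roles are served: the rows, read as monomials, start the elimination, and the matrix
  without its first row is the shift inside the companion matrix.\<close>

lemma ident:
  "wfm n (ident z n)" "map (\<lambda>r. Poly (V r)) (ident z n) = map (monom 1) [0..<n]"
  "length w = n \<Longrightarrow> app (ident z n) w = w"
proof -
  have tl_z: "tl z = replicate (a - 1) False" by (cases a) (auto simp: z_def)
  show "wfm n (ident z n)" by (induction n) (auto simp: wfm_def tl_z elems_def a_pos)
  show "map (\<lambda>r. Poly (V r)) (ident z n) = map (monom 1) [0..<n]"
  proof (induction n)
    case (Suc n)
    have "Poly (replicate n (0::'k)) = 0" by (induction n) auto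
    then have "map (\<lambda>r. Poly (V r)) (ident z (Suc n)) =
        monom 1 0 # map (\<lambda>p. pCons 0 p) (map (\<lambda>r. Poly (V r)) (ident z n))"
      by (simp add: tl_z map_replicate_const monom_0)
    also have "\<dots> = monom 1 0 # map (\<lambda>k. monom 1 (Suc k)) [0..<n]"
      by (simp only: Suc.IH map_map o_def monom_Suc)
    also have "\<dots> = map (monom 1) [0..<Suc n]"
      by (simp only: upt_conv_Cons[OF zero_less_Suc] map_Suc_upt[symmetric] list.map map_map o_def)
    finally show ?case .
  qed simp
  show "length w = n \<Longrightarrow> app (ident z n) w = w"
  proof (induction n arbitrary: w)
    case (Suc n)
    then obtain y w' where w: "w = y # w'" "length w' = n" by (cases w) auto
    have "kdot (replicate n 0) w' = 0" by (rule kdot_zero)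
    with Suc.IH[OF w(2)] show ?case
      by (simp add: app_def w(1) tl_z map_replicate_const o_def)
  qed (simp add: app_def)
qed

text \<open>All rows but the last shift the powers of \<open>x\<close> by one and scale by the
  leading coefficient. For the last row, the vanishing of the polynomial at \<open>x\<close> says in
  characteristic 2 that the lower terms add up to the leading one.\<close>

lemma compan:
  assumes c: "elems c" "length c = Suc t" and t: "1 \<le> t"
  shows "wfm t (compan f t z c)" "length (compan f t z c) = t"
    "(\<Sum>k\<le>t. v (c ! k) * x ^ k) = 0 \<Longrightarrow>
      app (compan f t z c) (psums t {x}) = map ((*) (v (last c) * x)) (psums t {x})"
proof -
  have c0: "c \<noteq> []" using c by auto
  have lc: "length (last c) = a" using c c0 by (auto simp: elems_def)
  have lst: "last c = c ! t" using c c0 by (simp add: last_conv_nth)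
  define I where "I = tl (ident z t)"
  have I: "wfm t I" "length I = t - 1"
    using ident(1)[of t] length_ident[of z t]
        by (cases "ident z t"; auto simp: I_def simp del: length_ident)+
  have M: "compan f t z c = msmul f (last c) I @ [take t c]"
    using c0 by (simp add: compan_def lastd_def I_def)
  show "wfm t (compan f t z c)"
    using msmul(1)[OF lc I(1)] c by (auto simp: M wfm_def elems_def dest: in_set_takeD)
  show len: "length (compan f t z c) = t" using I t by (simp add: M msmul_def)
  assume x: "(\<Sum>k\<le>t. v (c ! k) * x ^ k) = 0"
  define w where "w = psums t {x}"
  have w: "length w = t" "\<And>i. i < t \<Longrightarrow> w ! i = x ^ Suc i" by (auto simp: w_def psums_def)
  have appI: "app I w = tl w" using ident(3)[OF w(1)] by (simp add: I_def app_def map_tl)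
  have "app (msmul f (last c) I @ [take t c]) w
      = map ((*) (v (last c))) (tl w) @ [kdot (V (take t c)) w]"
    using msmul(2)[OF lc I(1), of w, unfolded appI] by (simp add: app_def)
  also have "\<dots> = map ((*) (v (last c) * x)) w"
  proof (rule nth_equalityI)
    fix i assume "i < length (map ((*) (v (last c))) (tl w) @ [kdot (V (take t c)) w])"
    then have i: "i < t" using w t by simp
    show "(map ((*) (v (last c))) (tl w) @ [kdot (V (take t c)) w]) ! i
        = map ((*) (v (last c) * x)) w ! i"
    proof (cases "i < t - 1")
      case True
      then show ?thesis using w by (simp add: nth_append nth_tl algebra_simps)
    next
      case False
      then have i: "i = t - 1" using i by simp
      have "kdot (V (take t c)) w = (\<Sum>k<t. v (c ! k) * x ^ Suc k)"
        using c w by (simp add: kdot_conv_sum del: power_Suc)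
      also have "\<dots> = x * (\<Sum>k<t. v (c ! k) * x ^ k)"
        by (simp add: sum_distrib_left mult.left_commute)
      also have "(\<Sum>k<t. v (c ! k) * x ^ k) = v (c ! t) * x ^ t"
        using x by (simp add: lessThan_Suc_atMost[symmetric] add_eq_0)
      finally have "kdot (V (take t c)) w = v (last c) * x * x ^ Suc (t - 1)"
        using t by (simp add: lst del: power_Suc)
      then show ?thesis using i w t by (simp add: nth_append del: power_Suc)
    qed
  qed (use w t in auto)
  finally show "app (compan f t z c) (psums t {x}) = map ((*) (v (last c) * x)) (psums t {x})"
    by (simp add: M w_def)
qed

section \<open>Completing the syndromes\<close>

lemma inter_nth:
  "i < length u \<Longrightarrow> inter u w ! (2 * i) = u ! i \<and>
     inter u w ! Suc (2 * i) = (if i < length w then w ! i else [])"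
proof (induction u w arbitrary: i rule: inter.induct)
  case (2 x os es)
  then show ?case by (cases i; cases es) (auto simp: hdd_def)
qed simp

lemma elems_inter: "elems u \<Longrightarrow> elems w \<Longrightarrow> length u \<le> length w \<Longrightarrow> elems (inter u w)"
proof (induction u w rule: inter.induct)
  case (2 x os es)
  then show ?case by (cases es) (auto simp: hdd_def)
qed simp

text \<open>Position \<open>i\<close> holds the syndrome with index \<open>i + 1\<close>, so
  position \<open>2 * j + 1\<close> receives the square of the entry at position \<open>j\<close>.
  Correctness up to position \<open>2 * k\<close> thus extends to \<open>2 * (k + 1)\<close> in one
  round; the decoder starts with \<open>k = 0\<close>, where only position 0 has to be
  right.\<close>

lemma full:
  assumes S: "finite S" and \<sigma>: "elems \<sigma>" "length \<sigma> = t" "\<And>i. i < t \<Longrightarrow> v (\<sigma> ! i)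
      = (\<Sum>x\<in>S. x ^ (2 * i + 1))"
    and G: "elems G" "t \<le> length G"
      "\<And>i. i < length G \<Longrightarrow> i \<le> 2 * k \<Longrightarrow> v (G ! i) = (\<Sum>x\<in>S. x ^ Suc i)"
    and n: "1 \<le> n"
  shows "elems (full f n \<sigma> G) \<and> length (full f n \<sigma> G) = 2 * t \<and>
    (\<forall>i<2 * t. i \<le> 2 * (k + n) \<longrightarrow> v (full f n \<sigma> G ! i) = (\<Sum>x\<in>S. x ^ Suc i))"
  using G n
proof (induction n arbitrary: k G)
  case (Suc n)
  define H where "H = inter \<sigma> (sqs f G)"
  have sq: "elems (sqs f G)" "length (sqs f G) = length G" using Suc.prems(1)
      by (auto simp: sqs_def elems_def)
  have H: "elems H" "length H = 2 * t"
    using elems_inter[OF \<sigma>(1) sq(1)] sq(2) Suc.prems(2) \<sigma>(2) by (auto simp: H_def length_inter)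
  have vH: "v (H ! i) = (\<Sum>x\<in>S. x ^ Suc i)" if i: "i < 2 * t" "i \<le> 2 * Suc k" for i
  proof (cases "even i")
    case True
    then obtain j where j: "i = 2 * j" by blast
    then show ?thesis using i \<sigma> inter_nth[of j \<sigma> "sqs f G"] by (simp add: H_def)
  next
    case False
    then obtain j where j: "i = Suc (2 * j)" using oddE by fastforce
    have jt: "j < t" "j \<le> 2 * k" using i j by auto
    have "j < length G" using jt Suc.prems(2) by simp
    have el: "length (G ! j) = a" using Suc.prems(1) \<open>j < length G\<close> by (auto simp: elems_def)
    have "v (H ! i) = (v (G ! j))\<^sup>2"
      using inter_nth[of j \<sigma> "sqs f G"] jt \<open>j < length G\<close> \<sigma>(2) el
      by (simp add: H_def j sqs_def power2_eq_square)
    also have "\<dots> = (\<Sum>x\<in>S. (x ^ Suc j)\<^sup>2)"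
      using Suc.prems(3)[OF \<open>j < length G\<close> jt(2)] by (simp only: sq_sum)
    also have "\<dots> = (\<Sum>x\<in>S. x ^ Suc i)"
      by (rule sum.cong) (simp_all add: j power_mult[symmetric] mult.commute[of _ 2] del: power_Suc)
    finally show ?thesis .
  qed
  show ?case
  proof (cases "n = 0")
    case True
    then show ?thesis using H vH by (simp add: H_def)
  next
    case False
    have "elems (full f n \<sigma> H) \<and> length (full f n \<sigma> H) = 2 * t \<and>
      (\<forall>i<2 * t. i \<le> 2 * (Suc k + n) \<longrightarrow> v (full f n \<sigma> H ! i) = (\<Sum>x\<in>S. x ^ Suc i))"
      by (rule Suc.IH) (use H vH False in auto)
    then show ?thesis by (simp add: H_def)
  qed
qed simp

section \<open>Elimination and the locator polynomial\<close>

abbreviation Pv :: "vec \<Rightarrow> 'k poly" where "Pv c \<equiv> Poly (V c)"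

lemma poly_Poly: "poly (Poly (xs :: 'k list)) x = (\<Sum>k<length xs. xs ! k * x ^ k)"
proof (induction xs)
  case (Cons y xs)
  then show ?case
    by (simp add: sum.lessThan_Suc_shift sum_distrib_left mult.left_commute del: sum.lessThan_Suc)
qed simp

lemma Poly_map2_add: "length xs = length ys \<Longrightarrow> Poly (map2 (+) xs ys)
    = Poly xs + Poly (ys :: 'k list)"
  by (induction xs ys rule: list_induct2) auto

lemma Poly_map_scale: "Poly (map ((*) c) xs) = smult c (Poly (xs :: 'k list))"
  by (induction xs) auto

lemma Pv_combine:
  assumes "length d = a" "length e = a" "length u = length w"
  shows "elems (vadd (smul f d u) (smul f e w))"
    "Pv (vadd (smul f d u) (smul f e w)) = smult (v d) (Pv u) + smult (v e) (Pv w)"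
  using vadd[of "smul f d u" "smul f e w"] smul[OF assms(1), of u] smul[OF assms(2), of w] assms(3)
  by (auto simp: Poly_map2_add Poly_map_scale simp del: map_map)

text \<open>\<open>D\<close> is the functional to be eliminated; \<open>E\<close> stands for earlier
  ones and for the top coefficient. If \<open>p = c * w + q\<close> with pivot \<open>w\<close> and
  \<open>D p = 0\<close>, then \<open>D(w) * p = D(w) * q + D(q) * w\<close>, and the right-hand
  side combines the new rows just as \<open>q\<close> combines the old ones. So dropping the pivot
  loses nothing of the kernel of \<open>D\<close>. Rows other than the last are combined only with a
  pivot above them, never with the last row, which gives the claim on
  \<open>butlast\<close>.\<close>

lemma elim_step:
  fixes D :: "'k poly \<Rightarrow> 'k"
  assumes lin: "\<And>p q. D (p + q) = D p + D q" "\<And>c p. D (smult c p) = c * D p"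
    and dot': "\<forall>w. length w = n \<and> elems w \<longrightarrow> length (dot f z w S) = a \<and> v (dot f z w S) = D (Pv w)"
    and ws: "wfm n ws"
  shows "wfm n (elim f z S ws)"
    "\<forall>w\<in>set (elim f z S ws). D (Pv w) = 0"
    "p \<in> pspan (Pv ` set ws) \<Longrightarrow> D p = 0 \<Longrightarrow> p \<in> pspan (Pv ` set (elim f z S ws))"
    "(\<And>p q. E (p + q) = E p + E q) \<Longrightarrow> (\<And>c p. E (smult c p) = c * E p) \<Longrightarrow>
       \<forall>w\<in>set ws. E (Pv w) = (0::'k) \<Longrightarrow> \<forall>w\<in>set (elim f z S ws). E (Pv w) = 0"
    "(\<And>p q. E (p + q) = E p + E q) \<Longrightarrow> (\<And>c p. E (smult c p) = c * E p) \<Longrightarrow>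
       \<forall>w\<in>set (butlast ws). E (Pv w) = (0::'k) \<Longrightarrow> \<forall>w\<in>set (butlast (elim f z S ws)). E (Pv w) = 0"
proof -
  define d where "d w = dot f z w S" for w
  define g where "g w u = vadd (smul f (d w) u) (smul f (d u) w)" for w u
  have elimmap: "elimmap f z S w (dot f z w S) ws = map (g w) ws" for w ws
    by (simp add: elimmap_def g_def d_def)
  have test: "d w = bxor (d w) (d w) \<longleftrightarrow> D (Pv w) = 0" if "length w = n" "elems w" for w
  proof -
    have "length (d w) = a" "v (d w) = D (Pv w)" using dot' that by (auto simp: d_def)
    then show ?thesis using v_inj[of "d w" z] by (simp add: bxor_self z_def)
  qed
  have g: "length (g w u) = n" "elems (g w u)" "Pv (g w u)
      = smult (D (Pv w)) (Pv u) + smult (D (Pv u)) (Pv w)"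
    if "length w = n" "elems w" "length u = n" "elems u" for w u
    using Pv_combine[of "d w" "d u" u w] dot' that by (auto simp: g_def d_def)
  have elim_Cons: "elim f z S (w # ws) = (if D (Pv w) = 0 then w # elim f z S ws else map (g w) ws)"
    if "length w = n" "elems w" for w ws
    using test[OF that] by (simp add: elimmap d_def)
  have D0: "D 0 = 0" using lin(2)[of 0 0] by simp
  show "wfm n (elim f z S ws)"
    using ws by (induction ws) (simp_all add: elim_Cons del: elim.simps(2), auto simp: wfm_def g)
  show "\<forall>w\<in>set (elim f z S ws). D (Pv w) = 0"
    using ws
  proof (induction ws)
    case (Cons w ws)
    then show ?case
      by (cases "D (Pv w) = 0")
          (auto simp: elim_Cons wfm_def g lin algebra_simps simp del: elim.simps(2))
  qed simp
  show "p \<in> pspan (Pv ` set (elim f z S ws))" if "p \<in> pspan (Pv ` set ws)" "D p = 0"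
    using ws that
  proof (induction ws arbitrary: p)
    case (Cons w ws)
    have w: "length w = n" "elems w" "wfm n ws" using Cons.prems by auto
    obtain c q where q: "p = smult c (Pv w) + q" "q \<in> pspan (Pv ` set ws)"
      using pspan_insertE[of p "Pv w" "Pv ` set ws"] Cons.prems by auto
    have Dq: "c * D (Pv w) = D q" using Cons.prems(3) by (simp add: q lin add_eq_0)
    show ?case
    proof (cases "D (Pv w) = 0")
      case True
      then have "q \<in> pspan (Pv ` set (elim f z S ws))" using Dq q w by (intro Cons.IH) auto
      moreover have "pspan R \<subseteq> pspan (insert r R)" for r :: "'k poly" and R
      proof
        fix x assume "x \<in> pspan R"
        then show "x \<in> pspan (insert r R)" by induction (auto intro: pspan.intros)
      qed
      ultimately have "q \<in> pspan (Pv ` set (elim f z S (w # ws)))"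
        using True w by (auto simp: elim_Cons simp del: elim.simps(2))
      then show ?thesis unfolding q(1) using True w
        by (intro pspan.add) (auto simp: elim_Cons simp del: elim.simps(2))
    next
      case False
      have comb: "smult (D (Pv w)) q + smult (D q) (Pv w) \<in> pspan (Pv ` set (map (g w) ws))"
        using q(2)
      proof (induction rule: pspan.induct)
        case zero
        then show ?case by (simp add: D0 pspan.zero)
      next
        case (add r q b)
        then obtain u where u: "u \<in> set ws" "r = Pv u" by auto
        have "smult (D (Pv w)) (smult b r + q) + smult (D (smult b r + q)) (Pv w) =
            smult b (Pv (g w u)) + (smult (D (Pv w)) q + smult (D q) (Pv w))"
          using u w by (simp add: lin g wfm_def smult_add_left smult_add_right algebra_simps)
        then show ?case using add.IH u by (auto intro: pspan.add)
      qed
      have "smult (D q) (Pv w) = smult (D (Pv w)) (smult c (Pv w))"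
          by (simp add: Dq[symmetric] mult.commute)
      then have "smult (D (Pv w)) q + smult (D q) (Pv w) = smult (D (Pv w)) p"
        by (simp add: q(1) smult_add_right add.commute)
      \<comment> \<open>The algorithm does not divide, but the proof may: the span is closed under
        scaling by the inverse.\<close>
      with comb have "smult (inverse (D (Pv w))) (smult (D (Pv w)) p) \<in> pspan (Pv ` set (map (g w) ws))"
        by (intro pspan_smult[of "smult (D (Pv w)) p"]) simp
      then show ?thesis using False w by (simp add: elim_Cons del: elim.simps(2))
    qed
  qed simp
  assume E: "\<And>p q. E (p + q) = E p + E q" "\<And>c p. E (smult c p) = c * E p"
  show "\<forall>w\<in>set (elim f z S ws). E (Pv w) = 0" if "\<forall>w\<in>set ws. E (Pv w) = 0"
    using ws that
    by (induction ws) (simp_all add: elim_Cons del: elim.simps(2), auto simp: wfm_def g E)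
  show "\<forall>w\<in>set (butlast (elim f z S ws)). E (Pv w) = 0" if "\<forall>w\<in>set (butlast ws). E (Pv w) = 0"
    using ws that
  proof (induction ws)
    case (Cons w ws)
    have sub: "set (butlast xs) \<subseteq> set xs" for xs :: mat by (auto dest: in_set_butlastD)
    have w: "length w = n" "elems w" "wfm n ws" using Cons.prems by auto
    show ?case
    proof (cases "ws = []")
      case True
      then show ?thesis using w by (auto simp: elim_Cons simp del: elim.simps(2))
    next
      case False
      then have E0: "E (Pv w) = 0" "\<forall>w\<in>set (butlast ws). E (Pv w) = 0" using Cons.prems by auto
      have "E (Pv (g w u)) = 0" if "u \<in> set (butlast ws)" for u
        using that w E0 sub[of ws] by (auto simp: g wfm_def E)
      then show ?thesis using w E0 Cons.IH
        by (auto simp: elim_Cons map_butlast[symmetric] simp del: elim.simps(2))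
    qed
  qed simp
qed

lemma locator:
  assumes S: "finite S" "card S \<le> t" "0 \<notin> S" "S \<subseteq> F" and t: "1 \<le> t"
    and G: "elems G" "length G = 2 * t" "\<forall>i<2 * t. v (G ! i) = (\<Sum>x\<in>S. x ^ Suc i)"
  defines "c \<equiv> locator f t z G"
  shows "elems c" "length c = Suc t" "v (last c) \<noteq> 0" "x \<in> S \<Longrightarrow> (\<Sum>k\<le>t. v (c ! k) * x ^ k) = 0"
proof -
  \<comment> \<open>This is the pairing of the coefficients of \<open>p\<close> with the syndromes
    from index \<open>j + 1\<close> on, expressed through the values of \<open>p\<close> on
    \<open>S\<close>.\<close>
  define D where "D j p = (\<Sum>x\<in>S. x ^ Suc j * poly p x)" for j p
  have lin: "D j (p + q) = D j p + D j q" "D j (smult b p) = b * D j p" for j p q b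
    by (simp_all add: D_def distrib_left sum.distrib sum_distrib_left mult.left_commute del: power_Suc)
  have dotD: "length (dot f z w (drop j G)) = a \<and> v (dot f z w (drop j G)) = D j (Pv w)"
    if "j < t" "length w = Suc t" "elems w" for j w
  proof -
    have "elems (drop j G)" using G(1) by (auto simp: elems_def dest: in_set_dropD)
    note d = dot[OF that(3) this]
    have "kdot (V w) (V (drop j G)) = (\<Sum>k<Suc t. V w ! k * (\<Sum>x\<in>S. x ^ Suc (j + k)))"
      using that G by (simp add: kdot_conv_sum min_absorb1 del: power_Suc sum.lessThan_Suc)
    also have "\<dots> = (\<Sum>x\<in>S. \<Sum>k<Suc t. V w ! k * x ^ Suc (j + k))"
      by (subst sum.swap) (simp add: sum_distrib_left del: power_Suc sum.lessThan_Suc)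
    also have "\<dots> = D j (Pv w)"
      unfolding D_def poly_Poly using that
      by (simp add: sum_distrib_left power_add ac_simps del: sum.lessThan_Suc)
    finally show ?thesis using d by simp
  qed
  \<comment> \<open>\<open>p\<close> is monic of degree \<open>t\<close> and lies in the kernel of every \<open>D j\<close>, so it stays in the span of the rows
    throughout the elimination. Hence some final row has degree \<open>t\<close>.\<close>
  define p where "p = monom 1 (t - card S) * (\<Prod>x\<in>S. [:- x, 1:])"
  have prod0: "(\<Prod>x\<in>S. [:- x, 1:]) \<noteq> (0 :: 'k poly)" using S(1) by auto
  have "degree (\<Prod>x\<in>S. [:- x, 1 :: 'k:]) = card S"
    by (subst degree_prod_eq_sum_degree) auto
  then have deg: "degree p = t" using S(2) prod0
    by (simp add: p_def degree_mult_eq monom_eq_0_iff degree_monom_eq)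
  have "lead_coeff p = 1" by (simp add: p_def lead_coeff_mult lead_coeff_prod degree_monom_eq)
  then have pt: "coeff p t = 1" by (simp add: deg)
  have Dp: "D j p = 0" for j
    unfolding D_def using S(1) by (intro sum.neutral) (auto simp: p_def poly_prod)
  define Q where "Q j ws \<longleftrightarrow> wfm (Suc t) ws \<and> p \<in> pspan (Pv ` set ws) \<and>
    (\<forall>i<j. \<forall>w\<in>set ws. D i (Pv w) = 0) \<and> (\<forall>w\<in>set (butlast ws). coeff (Pv w) t = 0)" for j ws
  have "Q (j + n) (eloop f z n (drop j G) ws)" if "Q j ws" "j + n \<le> t" for j n ws
    using that
  proof (induction n arbitrary: j ws)
    case (Suc n)
    have jt: "j < t" using Suc.prems by simp
    have q: "wfm (Suc t) ws" "p \<in> pspan (Pv ` set ws)"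
      "\<And>i. i < j \<Longrightarrow> \<forall>w\<in>set ws. D i (Pv w) = 0" "\<forall>w\<in>set (butlast ws). coeff (Pv w) t = 0"
      using Suc.prems(1) by (simp_all add: Q_def)
    have dotj: "\<forall>w. length w = Suc t \<and> elems w \<longrightarrow>
        length (dot f z w (drop j G)) = a \<and> v (dot f z w (drop j G)) = D j (Pv w)"
      using dotD[OF jt] by blast
    note es = elim_step[where D = "D j" and S = "drop j G" and n = "Suc t", OF lin dotj q(1)]
    have "D i (Pv w) = 0" if "i < Suc j" "w \<in> set (elim f z (drop j G) ws)" for i w
      using es(2) es(4)[where E = "D i", OF lin] q(3)[of i] that by (cases "i = j") auto
    moreover have "\<forall>w\<in>set (butlast (elim f z (drop j G) ws)). coeff (Pv w) t = 0"
      by (rule es(5)[where E = "\<lambda>p. coeff p t", OF _ _ q(4)]) simp_all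
    ultimately have "Q (Suc j) (elim f z (drop j G) ws)"
      using es(1) es(3)[OF q(2) Dp] by (simp add: Q_def)
    from Suc.IH[OF this] Suc.prems(2) show ?case by (simp add: drop_Suc tl_drop)
  qed simp
  moreover have "Q 0 (ident z (Suc t))"
  proof -
    have id: "map Pv (ident z (Suc t)) = map (monom 1) [0..<Suc t]" by (rule ident(2))
    have "Pv ` set (ident z (Suc t)) = monom 1 ` {..t}"
      using arg_cong[OF id, of set]
          by (simp add: atLeast0LessThan lessThan_Suc_atMost del: ident.simps upt_Suc)
    moreover have "map Pv (butlast (ident z (Suc t))) = map (monom 1) [0..<t]"
      using arg_cong[OF id, of butlast] by (simp add: map_butlast del: ident.simps)
    then have "Pv ` set (butlast (ident z (Suc t))) = monom 1 ` {..<t}"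
      using arg_cong[of _ _ set] by (metis atLeast_upt list.set_map)
    then have "coeff (Pv w) t = 0" if "w \<in> set (butlast (ident z (Suc t)))" for w
    proof -
      have "Pv w \<in> monom 1 ` {..<t}"
        using that \<open>Pv ` set (butlast (ident z (Suc t))) = monom 1 ` {..<t}\<close> by blast
      then show ?thesis by (auto simp del: coeff_Poly_eq)
    qed
    ultimately show ?thesis
      unfolding Q_def using ident(1)[of "Suc t"] pspan_monoms[of p t] deg by simp
  qed
  ultimately have Q: "Q t (eloop f z t G (ident z (Suc t)))"
    by (metis add.left_neutral drop0 order_refl)
  define ws where "ws = eloop f z t G (ident z (Suc t))"
  have q: "wfm (Suc t) ws" "p \<in> pspan (Pv ` set ws)"
      "\<And>i. i < t \<Longrightarrow> \<forall>w\<in>set ws. D i (Pv w) = 0" "\<forall>w\<in>set (butlast ws). coeff (Pv w) t = 0"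
    using Q by (simp_all add: Q_def ws_def del: ident.simps)
  have "\<exists>w\<in>set ws. coeff (Pv w) t \<noteq> 0"
    using pspan_coeff_zero[OF q(2), of t] pt by (auto simp del: coeff_Poly_eq)
  then obtain w where w: "w \<in> set ws" "coeff (Pv w) t \<noteq> 0" by blast
  then have ws0: "ws \<noteq> []" by auto
  then have "set ws = insert (last ws) (set (butlast ws))"
    by (metis append_butlast_last_id list.simps(15) rotate1.simps(2) set_rotate1)
  \<comment> \<open>All other rows have top coefficient 0, so the row just found is the one that
    \<open>locator\<close> returns.\<close>
  then have wl: "w = last ws" using w q(4) by auto
  have c: "c = w" using ws0
      by (simp add: c_def locator_def lastd_def ws_def[symmetric] wl del: ident.simps)
  show el: "elems c" and len: "length c = Suc t" using q(1) w(1) by (auto simp: c wfm_def)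
  have "coeff (Pv c) t = v (last c)"
    using len by (simp add: nth_default_nth last_conv_nth[of c] flip: length_0_conv)
  then show "v (last c) \<noteq> 0" using w by (simp add: c)
  assume x: "x \<in> S"
  have "x * poly (Pv c) x = 0"
  proof (rule vandermonde_zero[OF S(1) _ x])
    fix i assume "i < card S"
    then have "D i (Pv c) = 0" using q(3)[of i] w(1) S(2) by (auto simp: c)
    then show "(\<Sum>x\<in>S. x * poly (Pv c) x * x ^ i) = 0" by (simp add: D_def ac_simps)
  qed
  then have "poly (Pv c) x = 0" using x S(3) by auto
  then show "(\<Sum>k\<le>t. v (c ! k) * x ^ k) = 0"
    by (simp add: poly_Poly len lessThan_Suc_atMost del: sum.lessThan_Suc)
qed

lemma decode:
  assumes S: "finite S" "card S \<le> t" "0 \<notin> S" "S \<subseteq> F" and t: "1 \<le> t"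
    and \<sigma>: "elems \<sigma>" "length \<sigma> = t" "\<And>i. i < t \<Longrightarrow> v (\<sigma> ! i) = (\<Sum>x\<in>S. x ^ (2 * i + 1))"
  shows "v ` set (decode f t z (replicate t z) \<sigma>) = S"
proof -
  define G where "G = full f t \<sigma> \<sigma>"
  have "elems G \<and> length G = 2 * t \<and> (\<forall>i<2 * t. i \<le> 2 * (0 + t) \<longrightarrow> v (G ! i) = (\<Sum>x\<in>S. x ^ Suc i))"
    unfolding G_def
  proof (rule full[OF S(1) \<sigma>(1) \<sigma>(2) \<sigma>(3) \<sigma>(1) _ _ t])
    fix i assume "i < length \<sigma>" "i \<le> 2 * 0"
    then show "v (\<sigma> ! i) = (\<Sum>x\<in>S. x ^ Suc i)" using \<sigma>(3)[of 0] t by simp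
  qed (use \<sigma> in auto)
  then have G: "elems G" "length G = 2 * t" "\<forall>i<2 * t. v (G ! i) = (\<Sum>x\<in>S. x ^ Suc i)" by auto
  define c where "c = locator f t z G"
  note c = locator[OF S t G, folded c_def]
  define \<mu> where "\<mu> = v (last c)"
  have \<mu>: "\<mu> \<in> F" "\<mu> \<noteq> 0"
  proof -
    have "last c \<in> set c" using c(2) by (intro last_in_set) auto
    then show "\<mu> \<in> F" using c(1) by (auto simp: \<mu>_def F_def elems_def)
  qed (use c(3) in \<open>simp add: \<mu>_def\<close>)
  define M where "M = compan f t z c"
  note M = compan[OF c(1,2) t, folded M_def \<mu>_def]
  have "elems (take t G)" using G(1) by (auto simp: elems_def dest: in_set_takeD)
  moreover have "V (take t G) = psums t S"
    using G by (intro nth_equalityI) (auto simp: psums_def simp del: power_Suc)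
  ultimately have r: "rep t (take t G) S" by (simp add: rep_def)
  define L where "L = consnz (take t G) []"
  have "good t S \<mu> 0 L (consne S [])"
    using consnz_rep[OF r _ S(1-3), of "[]" "[]"] by (auto simp: good_def L_def consne_def)
  moreover have "length (unit_elem z) = a" "v (unit_elem z) = \<alpha> ^ 0"
    by (auto simp: unit_elem_def z_def a_pos tl_replicate)
  moreover have "\<forall>x\<in>S. app M (psums t {x}) = map ((*) (\<mu> * x)) (psums t {x})"
    using M(3) c(4) by blast
  ultimately obtain us where us: "good t S \<mu> a (sloop f t z (replicate t z) M a (unit_elem z) L) us"
    using sloop_good[OF M(1,2) _ S \<mu>(1), of 0 L "consne S []" "unit_elem z" a] by auto
  define H where "H = heads z (sloop f t z (replicate t z) M a (unit_elem z) L)"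
  have sing: "\<exists>x. u = {x} \<and> x \<noteq> 0" if "u \<in> set us" for u
    using good_singletons[OF us S(4) \<mu> that] S(3) by auto
  have u: "list_all2 (rep t) (sloop f t z (replicate t z) M a (unit_elem z) L) us"
    "\<Union>(set us) = S" "sum_list (map card us) = card S"
    using us unfolding good_def by blast+
  have H: "map (\<lambda>x. {v x}) H = us"
  proof -
    have "\<forall>u\<in>set us. \<exists>x. u = {x} \<and> x \<noteq> 0" using sing by blast
    from heads_singletons[OF u(1) this t] show ?thesis by (simp add: H_def)
  qed
  have vH: "v ` set H = S" using u(2) unfolding H[symmetric] by auto
  \<comment> \<open>There are as many heads as elements of \<open>S\<close>, and every element
    occurs. Hence the heads are distinct and \<open>togall\<close> cancels none of them.\<close>
  have "length H = card S" using u(3) unfolding H[symmetric] by (simp add: o_def sum_list_triv)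
  then have "card (set (map v H)) = length (map v H)" using vH by simp
  then have "distinct (map v H)" by (rule card_distinct)
  then have "distinct H" by (simp add: distinct_map)
  then have "set (togall H []) = set H" by (simp add: set_togall)
  then show ?thesis using vH
    by (simp add: decode_def Let_def G_def H_def L_def M_def c_def)
qed

end

section \<open>Leakage of average min-entropy\<close>

definition max_joint :: "('a \<times> 'b) pmf \<Rightarrow> 'b \<Rightarrow> real" where
  "max_joint J b = (SUP a. pmf J (a, b))"

lemma bdd_above_pmf: "bdd_above (range (\<lambda>a. pmf J (a, b)))"
  by (rule bdd_aboveI[of _ 1]) (auto simp: pmf_le_1)

lemma max_joint_upper: "pmf J (a, b) \<le> max_joint J b"
  unfolding max_joint_def by (rule cSUP_upper[OF UNIV_I bdd_above_pmf])

lemma max_joint_nonneg: "0 \<le> max_joint J b"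
  by (rule order_trans[OF pmf_nonneg max_joint_upper])

lemma joint_eq_cond:
  assumes "b \<in> set_pmf (map_pmf snd J)"
  shows "\<P>(x in measure_pmf J. fst x = a \<bar> snd x = b) = pmf J (a, b) / pmf (map_pmf snd J) b"
proof -
  have "{x \<in> space (measure_pmf J). fst x = a \<and> snd x = b} = {(a, b)}" by auto
  moreover have "{x \<in> space (measure_pmf J). snd x = b} = snd -` {b}" by auto
  ultimately show ?thesis
    by (simp add: cond_prob_def pmf_map measure_pmf_single)
qed

definition guess :: "('a \<times> 'b) pmf \<Rightarrow> real" where
  "guess J = measure_pmf.expectation (map_pmf snd J)
     (\<lambda>b. SUP a. \<P>(x in measure_pmf J. fst x = a \<bar> snd x = b))"

text \<open>Averaging the conditional maxima amounts to adding up the maxima of the joint probabilities.\<close>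

lemma ennreal_guess: "ennreal (guess J) = (\<integral>\<^sup>+b. ennreal (max_joint J b) \<partial>count_space UNIV)"
proof -
  let ?q = "map_pmf snd J"
  define g where "g b = (SUP a. \<P>(x in measure_pmf J. fst x = a \<bar> snd x = b))" for b
  have le1: "\<P>(x in measure_pmf J. fst x = a \<bar> snd x = b) \<le> 1" for a b
    unfolding cond_prob_def by (rule divide_le_eq_1[THEN iffD2])
      (auto simp: zero_less_measure_iff intro!: measure_pmf.finite_measure_mono)
  have nn: "0 \<le> \<P>(x in measure_pmf J. fst x = a \<bar> snd x = b)" for a b
    unfolding cond_prob_def by simp
  have bdd: "bdd_above (range (\<lambda>a. \<P>(x in measure_pmf J. fst x = a \<bar> snd x = b)))" for b
    by (rule bdd_aboveI[of _ 1]) (auto simp: le1)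
  have g1: "g b \<le> 1" for b unfolding g_def by (rule cSUP_least) (auto simp: le1)
  have g0: "0 \<le> g b" for b
    unfolding g_def using nn by (rule order_trans[OF _ cSUP_upper[OF UNIV_I bdd]])
  \<comment> \<open>Multiplying by the probability of \<open>b\<close> undoes the conditioning.
    Values \<open>b\<close> of probability 0 need a case of their own, in which both sides
    vanish.\<close>
  have qg: "pmf ?q b * g b = max_joint J b" for b
  proof (cases "b \<in> set_pmf ?q")
    case True
    then have pos: "0 < pmf ?q b" by (simp add: pmf_positive)
    have "g b = (SUP a. pmf J (a, b) / pmf ?q b)"
      unfolding g_def using True by (simp add: joint_eq_cond)
    moreover have "\<dots> = max_joint J b / pmf ?q b"
    proof (rule antisym)
      show "(SUP a. pmf J (a, b) / pmf ?q b) \<le> max_joint J b / pmf ?q b"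
        by (rule cSUP_least) (auto intro!: divide_right_mono max_joint_upper)
      have "max_joint J b \<le> pmf ?q b * (SUP a. pmf J (a, b) / pmf ?q b)"
        unfolding max_joint_def
      proof (rule cSUP_least)
        fix a
        have "bdd_above (range (\<lambda>a. pmf J (a, b) / pmf ?q b))"
          using bdd[of b] True by (simp add: joint_eq_cond)
        then have "pmf J (a, b) / pmf ?q b \<le> (SUP a. pmf J (a, b) / pmf ?q b)"
          by (rule cSUP_upper[OF UNIV_I])
        then show "pmf J (a, b) \<le> pmf ?q b * (SUP a. pmf J (a, b) / pmf ?q b)"
          using pos by (simp add: field_simps)
      qed simp
      then show "max_joint J b / pmf ?q b \<le> (SUP a. pmf J (a, b) / pmf ?q b)"
        using pos by (simp add: field_simps)
    qed
    ultimately show ?thesis using pos by simp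
  next
    case False
    then have "pmf ?q b = 0" unfolding pmf_eq_0_set_pmf .
    moreover have "pmf J (a, b) = 0" for a
    proof (rule ccontr)
      assume "pmf J (a, b) \<noteq> 0"
      then have "(a, b) \<in> set_pmf J" by (simp add: set_pmf_iff)
      with False show False by force
    qed
    ultimately show ?thesis by (simp add: max_joint_def)
  qed
  have "integrable (measure_pmf ?q) g"
    by (rule measure_pmf.integrable_const_bound[where B = 1]) (auto simp: g0 g1)
  then have "ennreal (guess J) = (\<integral>\<^sup>+b. ennreal (g b) \<partial>measure_pmf ?q)"
    unfolding guess_def g_def[symmetric] by (subst nn_integral_eq_integral) (auto simp: g0)
  also have "\<dots> = (\<integral>\<^sup>+b. ennreal (pmf ?q b) * ennreal (g b) \<partial>count_space UNIV)"
    by (rule nn_integral_measure_pmf)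
  also have "\<dots> = (\<integral>\<^sup>+b. ennreal (max_joint J b) \<partial>count_space UNIV)"
    by (simp add: ennreal_mult[symmetric] g0 qg)
  finally show ?thesis .
qed

text \<open>Positivity is needed to pass to logarithms.\<close>

lemma guess_pos: "0 < guess J"
proof -
  obtain a b where ab: "(a, b) \<in> set_pmf J" using set_pmf_not_empty[of J] by fast
  then have "0 < pmf J (a, b)" by (simp add: pmf_positive)
  then have pos: "0 < max_joint J b" using max_joint_upper[of J a b] by linarith
  have "0 < ennreal (max_joint J b)" using pos by simp
  also have "\<dots> = (\<integral>\<^sup>+c. ennreal (max_joint J b) * indicator {b} c \<partial>count_space UNIV)"
    by (simp add: nn_integral_cmult_indicator)
  also have "\<dots> \<le> (\<integral>\<^sup>+c. ennreal (max_joint J c) \<partial>count_space UNIV)"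
    by (rule nn_integral_mono) (auto split: split_indicator)
  also have "\<dots> = ennreal (guess J)" by (rule ennreal_guess[symmetric])
  finally show ?thesis by simp
qed

text \<open>For fixed \<open>i\<close>, each of the at most \<open>card S\<close> possible values
  \<open>s\<close> contributes no more than the maximum that the original distribution has at
  \<open>i\<close>.\<close>

lemma avg_min_entropy_leakage:
  fixes g :: "'a \<Rightarrow> 'b" and J :: "('a \<times> 'c) pmf"
  assumes "finite S" "g ` fst ` set_pmf J \<subseteq> S"
  shows "avg_min_entropy J - log 2 (real (card S)) \<le>
    avg_min_entropy (map_pmf (\<lambda>(w, i). (w, (g w, i))) J)"
proof -
  let ?J = "map_pmf (\<lambda>(w, i). (w, (g w, i))) J"
  have pm: "pmf ?J (w, (s, i)) = (if s = g w then pmf J (w, i) else 0)" for w s i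
  proof -
    have inj: "inj (\<lambda>(w, i). (w, (g w, i)))" by (auto simp: inj_on_def)
    show ?thesis
    proof (cases "s = g w")
      case True
      then show ?thesis using pmf_map_inj'[OF inj, of J "(w, i)"] by simp
    next
      case False
      then have "(w, (s, i)) \<notin> set_pmf ?J" by auto
      then have "pmf ?J (w, (s, i)) = 0" unfolding pmf_eq_0_set_pmf .
      then show ?thesis using False by simp
    qed
  qed
  have mj: "max_joint ?J (s, i) \<le> indicator S s * max_joint J i" for s i
    unfolding max_joint_def[of ?J]
  proof (rule cSUP_least)
    fix w
    show "pmf ?J (w, (s, i)) \<le> indicator S s * max_joint J i"
    proof (cases "s = g w \<and> pmf J (w, i) \<noteq> 0")
      case True
      then have "(w, i) \<in> set_pmf J" by (simp add: set_pmf_iff)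
      then have "s \<in> S" using True assms(2) by force
      then show ?thesis using True max_joint_upper[of J w i] by (simp add: pm)
    next
      case False
      then show ?thesis by (auto simp: pm max_joint_nonneg)
    qed
  qed simp
  have "ennreal (guess ?J) = (\<integral>\<^sup>+si. ennreal (max_joint ?J si) \<partial>count_space UNIV)"
    by (rule ennreal_guess)
  also have "\<dots> \<le> (\<integral>\<^sup>+(s, i). indicator S s * ennreal (max_joint J i) \<partial>count_space UNIV)"
  proof (rule nn_integral_mono, clarify)
    fix s i
    have "ennreal (max_joint ?J (s, i)) \<le> ennreal (indicator S s * max_joint J i)"
      by (rule ennreal_leI[OF mj])
    then show "ennreal (max_joint ?J (s, i)) \<le> indicator S s * ennreal (max_joint J i)"
      by (simp split: split_indicator_asm split_indicator)
  qed
  also have "\<dots>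
      = (\<integral>\<^sup>+s. \<integral>\<^sup>+i. indicator S s * ennreal (max_joint J i) \<partial>count_space UNIV \<partial>count_space UNIV)"
    by (subst nn_integral_fst_count_space[symmetric]) simp
  also have "\<dots> = (\<integral>\<^sup>+s. ennreal (guess J) * indicator S s \<partial>count_space UNIV)"
    by (simp add: nn_integral_cmult ennreal_guess mult.commute)
  also have "\<dots> = ennreal (guess J) * of_nat (card S)"
    using assms(1) by (simp add: nn_integral_cmult_indicator)
  also have "\<dots> = ennreal (guess J * real (card S))"
    using guess_pos[of J] by (simp add: ennreal_mult ennreal_of_nat_eq_real_of_nat)
  finally have le: "guess ?J \<le> guess J * real (card S)"
    using guess_pos[of J] by (subst (asm) ennreal_le_iff) auto
  have "S \<noteq> {}" using assms(2) set_pmf_not_empty[of J] by auto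
  then have c: "0 < real (card S)" using assms(1) by (simp add: card_gt_0_iff)
  have "log 2 (guess ?J) \<le> log 2 (guess J * real (card S))"
    using le guess_pos[of ?J] by simp
  also have "\<dots> = log 2 (guess J) + log 2 (real (card S))"
    using guess_pos[of J] c by (simp add: log_mult)
  finally show ?thesis by (simp add: avg_min_entropy_def guess_def)
qed

section \<open>PinSketch\<close>

text \<open>The field of \<open>2\<^sup>a\<close> elements is embedded into the algebraic closure of the two-element field.\<close>

definition gf_root :: "bit poly \<Rightarrow> bit alg_closure" where
  "gf_root f = (SOME x. poly (map_poly to_ac f) x = 0)"

definition emb :: "bit poly \<Rightarrow> bit poly \<Rightarrow> bit alg_closure" where
  "emb f p = poly (map_poly to_ac p) (gf_root f)"

lemma emb_0 [simp]: "emb f 0 = 0" by (simp add: emb_def)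

lemma emb_pCons [simp]: "emb f (pCons c p) = to_ac c + gf_root f * emb f p"
  by (simp add: emb_def map_poly_pCons)

lemma emb_1 [simp]: "emb f 1 = 1" by (simp add: one_pCons)

lemma emb_add [simp]: "emb f (p + q) = emb f p + emb f q"
  by (induction p q rule: poly_induct2)
    (simp_all only: add_pCons emb_pCons to_ac_add emb_0, simp_all add: algebra_simps)

lemma emb_smult [simp]: "emb f (smult c p) = to_ac c * emb f p"
  by (induction p) (simp_all add: algebra_simps)

lemma emb_mult [simp]: "emb f (p * q) = emb f p * emb f q"
  by (induction p) (simp_all add: mult_pCons_left algebra_simps)

lemma bit_poly_add_self [simp]: "(p :: bit poly) + p = 0"
proof (rule poly_eqI)
  have "c + c = 0" for c :: bit by (cases "c = 0") auto
  then show "coeff (p + p) i = coeff 0 i" for i by (simp only: coeff_add coeff_0)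
qed

lemma bit_poly_uminus [simp]: "- (p :: bit poly) = p"
  by (rule poly_eqI) simp

section \<open>Residues as bit strings\<close>

lemma coeff_elem_bits_inject:
  "degree p < n \<Longrightarrow> degree q < n \<Longrightarrow> elem_bits n p = elem_bits n q \<longleftrightarrow> p = q"
proof
  assume pq: "degree p < n" "degree q < n" and eq: "elem_bits n p = elem_bits n q"
  show "p = q"
  proof (rule poly_eqI)
    fix i
    show "coeff p i = coeff q i"
    proof (cases "i < n")
      case True
      then have "(coeff p i = 1) = (coeff q i = 1)" using eq by (simp add: elem_bits_def)
      then show ?thesis using bit_not_one_iff by metis
    next
      case False
      then show ?thesis using pq by (simp add: coeff_eq_0)
    qed
  qed
qed simp

lemma length_elem_bits [simp]: "length (elem_bits n p) = n" by (simp add: elem_bits_def)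

lemma nth_elem_bits [simp]: "i < n \<Longrightarrow> elem_bits n p ! i \<longleftrightarrow> coeff p i = 1"
  by (simp add: elem_bits_def)

lemma coeff_bits_elem: "coeff (bits_elem x) i = of_bool (i < length x \<and> x ! i)"
  by (simp add: bits_elem_def nth_default_def)

lemma degree_bits_elem: "length x \<le> n \<Longrightarrow> 0 < n \<Longrightarrow> degree (bits_elem x) < n"
proof -
  assume n: "length x \<le> n" "0 < n"
  then have "degree (bits_elem x) \<le> n - 1" by (intro degree_le) (auto simp: coeff_bits_elem)
  then show ?thesis using n by simp
qed

lemma elem_bits_bits_elem: "length x = n \<Longrightarrow> elem_bits n (bits_elem x) = x"
  by (rule nth_equalityI) (auto simp: coeff_bits_elem)

lemma bits_elem_elem_bits: "degree p < n \<Longrightarrow> bits_elem (elem_bits n p) = p"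
proof (rule poly_eqI)
  fix i assume "degree p < n"
  then show "coeff (bits_elem (elem_bits n p)) i = coeff p i"
    by (cases "i < n") (auto simp: coeff_bits_elem coeff_eq_0)
qed

lemma elem_bits_add: "elem_bits n (p + q) = bxor (elem_bits n p) (elem_bits n q)"
proof (rule nth_equalityI)
  have nth_bxor: "i < length x \<Longrightarrow> i < length y \<Longrightarrow> bxor x y ! i = (x ! i \<noteq> y ! i)" for i x y
    by (induction x y arbitrary: i rule: bxor.induct) (auto simp: nth_Cons split: nat.split)
  fix i assume "i < length (elem_bits n (p + q))"
  then show "elem_bits n (p + q) ! i = bxor (elem_bits n p) (elem_bits n q) ! i"
    by (auto simp: nth_bxor)
qed simp

text \<open>A bound on the degree would exclude the base case \<open>n = 0\<close>, in which
  \<open>p\<close> is zero; hence the hypothesis on coefficients.\<close>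

lemma val_of_elem_bits:
  "(\<And>i. n \<le> i \<Longrightarrow> coeff p i = 0) \<Longrightarrow> val_of (gf_root f) (elem_bits n p) = emb f p"
proof (induction n arbitrary: p)
  case 0
  then have "p = 0" by (intro poly_eqI) simp
  then show ?case by (simp add: elem_bits_def)
next
  case (Suc n)
  obtain c q where p: "p = pCons c q" by (cases p)
  have "coeff q i = 0" if "n \<le> i" for i using Suc.prems[of "Suc i"] that by (simp add: p)
  then have IH: "val_of (gf_root f) (elem_bits n q) = emb f q" by (rule Suc.IH)
  have "elem_bits (Suc n) p = (c = 1) # elem_bits n q"
    by (simp add: elem_bits_def p upt_conv_Cons map_Suc_upt[symmetric] o_def del: upt_Suc)
  moreover have "to_ac c = of_bool (c = 1)" by (cases c) auto
  ultimately show ?case using IH by (simp add: p)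
qed

text \<open>\<open>R\<close> is the residue field as a record and \<open>B\<close> the same field on
  bit strings. They are compared in the algebraic closure, into which \<open>em\<close> maps the one
  and \<open>B.v\<close> the other.\<close>

locale gf =
  fixes f :: "bit poly"
  assumes irr: "irreducible f"
begin

abbreviation "n \<equiv> degree f"
abbreviation "fb \<equiv> elem_bits (Suc n) f"
abbreviation "eb \<equiv> elem_bits n"
abbreviation "\<beta> \<equiv> gf_root f"
abbreviation "em \<equiv> emb f"

lemma f0: "f \<noteq> 0" using irr by auto

lemma n_pos: "0 < n"
  using irr f0 by (auto simp: irreducible_def is_unit_iff_degree)

sublocale R: Ring.field "GF f" by (rule field_GF[OF irr])

lemma carrier_GF: "p \<in> carrier (GF f) \<longleftrightarrow> degree p < n" by (simp add: GF_def)
lemma zero_GF [simp]: "\<zero>\<^bsub>GF f\<^esub> = 0" and one_GF [simp]: "\<one>\<^bsub>GF f\<^esub> = 1"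
  and add_GF [simp]: "p \<oplus>\<^bsub>GF f\<^esub> q = p + q" and mult_GF: "p \<otimes>\<^bsub>GF f\<^esub> q = p * q mod f"
  by (simp_all add: GF_def)

lemma GF_units_iff: "p \<in> GF_units f \<longleftrightarrow> degree p < n \<and> p \<noteq> 0"
  by (auto simp: GF_units_def carrier_GF)

lemma emb_f: "em f = 0"
proof -
  have "degree (map_poly to_ac f) = n" by (rule degree_map_poly) auto
  then have "\<exists>x. poly (map_poly to_ac f) x = 0"
    using n_pos by (intro alg_closed_imp_poly_has_root) simp
  then have "poly (map_poly to_ac f) (gf_root f) = 0" unfolding gf_root_def by (rule someI_ex)
  then show ?thesis by (simp add: emb_def)
qed

lemma emb_mod: "em (p mod f) = em p"
proof -
  have "em p = em (p div f * f + p mod f)" by simp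
  then show ?thesis by (simp only: emb_add emb_mult emb_f) simp
qed

text \<open>A nonzero residue has an inverse modulo \<open>f\<close>, and reduction modulo
  \<open>f\<close> does not change the value at the root, so that value is invertible.\<close>

lemma emb_eq_0: "degree p < n \<Longrightarrow> em p = 0 \<longleftrightarrow> p = 0"
proof
  assume p: "degree p < n" "em p = 0"
  show "p = 0"
  proof (rule ccontr)
    assume "p \<noteq> 0"
    then have "p \<in> Units (GF f)" using p by (simp add: R.field_Units carrier_GF)
    then obtain q where "p \<otimes>\<^bsub>GF f\<^esub> q = \<one>\<^bsub>GF f\<^esub>" using R.Units_r_inv by blast
    then have "em (p * q mod f) = 1" by (simp add: mult_GF)
    then show False using p(2) by (simp add: emb_mod)
  qed
qed simp

lemma emb_inject: "degree p < n \<Longrightarrow> degree q < n \<Longrightarrow> em p = em q \<longleftrightarrow> p = q"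
proof
  assume pq: "degree p < n" "degree q < n" "em p = em q"
  have two: "x + x = 0" for x :: "bit alg_closure"
  proof -
    have "x + x = to_ac (1 + 1) * x" by (simp only: to_ac_add to_ac_1 distrib_right mult_1_left)
    then show ?thesis by simp
  qed
  have "em (p + q) = 0" using pq two by simp
  then have "p + q = 0" using pq emb_eq_0[of "p + q"] by (simp add: degree_add_less)
  then show "p = q" by (metis add_eq_0_iff bit_poly_uminus)
qed simp

sublocale B: binary_field \<beta> fb
proof
  show "(1 :: bit alg_closure) + 1 = 0"
  proof -
    have "(1 :: bit alg_closure) + 1 = to_ac (1 + 1)" by (simp only: to_ac_add to_ac_1)
    then show ?thesis by simp
  qed
  show "2 \<le> length fb" using n_pos by simp
  have "coeff f n \<noteq> 0" using f0 by simp
  then have "coeff f n = 1" using bit_not_one_iff by metis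
  then show "last fb" by (simp add: elem_bits_def)
  show "val_of \<beta> fb = 0" using emb_f val_of_elem_bits[of "Suc n" f f] by (simp add: coeff_eq_0)
  show "inj_on (val_of \<beta>) {x. length x = length fb - 1}"
  proof (rule inj_onI, clarsimp)
    fix x y assume x: "length x = n" and y: "length y = n" and eq: "val_of \<beta> x = val_of \<beta> y"
    have d: "degree (bits_elem x) < n" "degree (bits_elem y) < n"
      using x y n_pos by (auto intro: degree_bits_elem)
    have "val_of \<beta> u = em (bits_elem u)" if "length u = n" for u
      using val_of_elem_bits[of n "bits_elem u" f] degree_bits_elem[of u n] that n_pos
      by (simp add: elem_bits_bits_elem coeff_eq_0)
    then have "bits_elem x = bits_elem y" using eq x y emb_inject[OF d] by simp
    then show "x = y" using elem_bits_bits_elem x y by metis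
  qed
qed

lemma a_eq [simp]: "B.a = n" by (simp add: B.a_def)

lemma val_eb: "degree p < n \<Longrightarrow> B.v (eb p) = em p"
  by (rule val_of_elem_bits) (simp add: coeff_eq_0)

lemma zero_bits: "bxor (tl fb) (tl fb) = B.z"
  by (simp add: bxor_self B.z_def)

lemma eb_0: "eb 0 = B.z"
  unfolding B.z_def a_eq by (simp add: elem_bits_def map_replicate_const)

lemma pow_GF: "degree x < n \<Longrightarrow> degree (x [^]\<^bsub>GF f\<^esub> (i::nat)) < n \<and> em (x [^]\<^bsub>GF f\<^esub> i) = em x ^ i"
proof (induction i)
  case (Suc i)
  have "x [^]\<^bsub>GF f\<^esub> Suc i \<in> carrier (GF f)" using Suc.prems
      by (intro R.nat_pow_closed) (simp add: carrier_GF)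
  moreover have "em (x [^]\<^bsub>GF f\<^esub> Suc i) = em x ^ Suc i"
    using Suc by (simp add: mult_GF emb_mod mult.commute)
  ultimately show ?case by (simp only: carrier_GF)
qed (use n_pos in simp)

section \<open>Power sums and syndromes of sets of residues\<close>

lemma power_sum:
  "finite w \<Longrightarrow> w \<subseteq> carrier (GF f) \<Longrightarrow>
     degree (power_sum f i w) < n \<and> em (power_sum f i w) = (\<Sum>x\<in>w. em x ^ i)"
proof (induction w rule: finite_induct)
  case empty
  then show ?case using n_pos by (simp add: power_sum_def)
next
  case (insert x w)
  have cl: "(\<lambda>x. x [^]\<^bsub>GF f\<^esub> i) \<in> insert x w \<rightarrow> carrier (GF f)" using insert.prems by auto
  have "power_sum f i (insert x w) = x [^]\<^bsub>GF f\<^esub> i + power_sum f i w"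
    unfolding power_sum_def using insert.hyps cl by (subst R.finsum_insert) auto
  moreover have "degree x < n" using insert.prems by (simp add: carrier_GF)
  ultimately show ?case using insert pow_GF[of x i] by (simp add: degree_add_less)
qed

lemma GF_units_subset: "GF_units f \<subseteq> carrier (GF f)" by (auto simp: GF_units_def)

lemma finite_GF_units: "finite (GF_units f)"
  using card_GF_units[OF n_pos] card_GF[OF n_pos] GF_units_subset
  by (metis card.infinite finite_subset power_not_zero zero_neq_numeral)

lemma syndromes:
  assumes "w \<subseteq> GF_units f"
  shows "B.elems (map eb (syndromes f t w))" "length (syndromes f t w) = t"
    "i < t \<Longrightarrow> B.v (map eb (syndromes f t w) ! i) = (\<Sum>x\<in>em ` w. x ^ (2 * i + 1))"
    "set (syndromes f t w) \<subseteq> carrier (GF f)"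
proof -
  have w: "finite w" "w \<subseteq> carrier (GF f)"
    using assms finite_GF_units GF_units_subset finite_subset by blast+
  show "B.elems (map eb (syndromes f t w))" by (auto simp: B.elems_def)
  show "length (syndromes f t w) = t" by (simp add: syndromes_def)
  show "set (syndromes f t w) \<subseteq> carrier (GF f)"
    using power_sum[OF w] by (auto simp: syndromes_def carrier_GF)
  have inj: "inj_on em w"
    using assms by (intro inj_onI) (metis GF_units_iff emb_inject subsetD)
  assume "i < t"
  then have "B.v (map eb (syndromes f t w) ! i) = em (power_sum f (2 * i + 1) w)"
    using power_sum[OF w, of "2 * i + 1"] by (simp add: syndromes_def val_eb)
  also have "\<dots> = (\<Sum>x\<in>em ` w. x ^ (2 * i + 1))"
    using power_sum[OF w, of "2 * i + 1"] inj by (subst sum.reindex) (simp_all add: o_def)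
  finally show "B.v (map eb (syndromes f t w) ! i) = (\<Sum>x\<in>em ` w. x ^ (2 * i + 1))" .
qed

lemma elems_eqI:
  assumes "B.elems u" "B.elems u'" "length u = length u'"
    "\<And>i. i < length u \<Longrightarrow> B.v (u ! i) = B.v (u' ! i)"
  shows "u = u'"
proof (rule nth_equalityI)
  fix i assume i: "i < length u"
  have "length (u ! i) = B.a" "length (u' ! i) = B.a"
    using assms(1-3) i unfolding B.elems_def by (metis nth_mem)+
  then show "u ! i = u' ! i" using assms(4)[OF i] B.v_inj by blast
qed (rule assms(3))

lemma pows:
  "length p = n \<Longrightarrow> B.elems (pows fb k p q) \<and> length (pows fb k p q) = k \<and>
     (\<forall>i<k. B.v (pows fb k p q ! i) = B.v p * B.v q ^ i)"
proof (induction k arbitrary: p)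
  case (Suc k)
  have "length (bmul fb p q) = n" "B.v (bmul fb p q) = B.v p * B.v q"
    using B.bmul[of p q] Suc.prems by auto
  with Suc.IH[of "bmul fb p q"] Suc.prems show ?case
    by (auto simp: nth_Cons split: nat.split)
qed simp

lemma ssum:
  assumes "B.elems xs"
  shows "B.elems (ssum fb t (replicate t B.z) xs) \<and> length (ssum fb t (replicate t B.z) xs) = t \<and>
    (\<forall>i<t. B.v (ssum fb t (replicate t B.z) xs ! i) = (\<Sum>x\<leftarrow>xs. B.v x ^ (2 * i + 1)))"
  using assms
proof (induction xs)
  case Nil
  then show ?case by (auto simp: B.elems_def)
next
  case (Cons x xs)
  define p where "p = pows fb t x (bmul fb x x)"
  define r where "r = ssum fb t (replicate t B.z) xs"
  have x: "length x = n" using Cons.prems by simp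
  have p: "B.elems p" "length p = t" "\<forall>i<t. B.v (p ! i) = B.v x ^ (2 * i + 1)"
    using pows[OF x, of t "bmul fb x x"] B.bmul[of x x] x
    by (auto simp: p_def mult_2 power_add power_mult_distrib)
  have r: "B.elems r" "length r = t" "\<forall>i<t. B.v (r ! i) = (\<Sum>x\<leftarrow>xs. B.v x ^ (2 * i + 1))"
    using Cons by (auto simp: r_def)
  have va: "B.elems (vadd p r)" "map (val_of \<beta>) (vadd p r)
      = map2 (+) (map (val_of \<beta>) p) (map (val_of \<beta>) r)"
    using B.vadd[of p r] p r by auto
  have "B.v (vadd p r ! i) = B.v (p ! i) + B.v (r ! i)" if "i < t" for i
    using arg_cong[OF va(2), of "\<lambda>l. l ! i"] p(2) r(2) that by simp
  then show ?case using va(1) p r by (simp add: p_def[symmetric] r_def[symmetric])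
qed

lemma map_eb_props:
  assumes "distinct xs" "set xs = w" "w \<subseteq> GF_units f"
  shows "B.elems (map eb xs)" "(\<Sum>x\<leftarrow>map eb xs. B.v x ^ i) = (\<Sum>x\<in>em ` w. x ^ i)"
proof -
  show "B.elems (map eb xs)" by (auto simp: B.elems_def)
  have deg: "degree x < n" if "x \<in> w" for x using that assms by (auto simp: GF_units_iff)
  have inj: "inj_on em w"
    using assms by (intro inj_onI) (metis GF_units_iff emb_inject subsetD)
  have "(\<Sum>x\<leftarrow>map eb xs. B.v x ^ i) = (\<Sum>x\<leftarrow>xs. em x ^ i)"
    using deg assms(2) by (auto simp: val_eb o_def intro!: arg_cong[of _ _ sum_list])
  also have "\<dots> = (\<Sum>x\<in>w. em x ^ i)" using assms by (simp add: sum_list_distinct_conv_sum_set)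
  also have "\<dots> = (\<Sum>x\<in>em ` w. x ^ i)" using inj by (simp add: sum.reindex)
  finally show "(\<Sum>x\<leftarrow>map eb xs. B.v x ^ i) = (\<Sum>x\<in>em ` w. x ^ i)" .
qed

lemma ssum_syndromes:
  assumes "distinct xs" "set xs = w" "w \<subseteq> GF_units f"
  shows "ssum fb t (replicate t B.z) (map eb xs) = map eb (syndromes f t w)"
proof (rule elems_eqI)
  note s = ssum[OF map_eb_props(1)[OF assms], of t]
  show "B.elems (ssum fb t (replicate t B.z) (map eb xs))" using s by (rule conjunct1)
  show "B.elems (map eb (syndromes f t w))" by (rule syndromes[OF assms(3)])
  show "length (ssum fb t (replicate t B.z) (map eb xs)) = length (map eb (syndromes f t w))"
    using s syndromes(2)[OF assms(3), of t] by simp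
  fix i assume "i < length (ssum fb t (replicate t B.z) (map eb xs))"
  then have i: "i < t" using s by simp
  then have "B.v (ssum fb t (replicate t B.z) (map eb xs) ! i) =
      (\<Sum>x\<leftarrow>map eb xs. B.v x ^ (2 * i + 1))" using s by blast
  also have "\<dots> = (\<Sum>x\<in>em ` w. x ^ (2 * i + 1))" by (rule map_eb_props(2)[OF assms])
  also have "\<dots> = B.v (map eb (syndromes f t w) ! i)"
    by (rule syndromes(3)[OF assms(3) i, symmetric])
  finally show "B.v (ssum fb t (replicate t B.z) (map eb xs) ! i) =
      B.v (map eb (syndromes f t w) ! i)" .
qed

lemma ss_alg_correct:
  assumes "distinct xs" "set xs = w" "w \<subseteq> GF_units f"
  shows "ss_alg fb t (map eb xs) = pinsketch_SS f t w"
  using ssum_syndromes[OF assms, of t] unfolding ss_alg_def zero_bits Let_def pinsketch_SS_def by simp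

section \<open>Parsing and subtracting syndromes\<close>

lemma nth_pad: "i < length z \<Longrightarrow> pad z s ! i = (i < length s \<and> s ! i)"
proof (induction z s arbitrary: i rule: pad.induct)
  case (2 b z s)
  then show ?case by (cases i; cases s) auto
qed simp

lemma parse_correct: "parse B.z t s = map eb (parse_syndromes n t s)"
proof -
  have pad: "pad B.z s = eb (bits_elem (take n s))" for s
    by (rule nth_equalityI) (auto simp: nth_pad coeff_bits_elem)
  have "parse B.z t s = map (\<lambda>j. pad B.z (drop (j * n) s)) [0..<t]"
  proof (induction t arbitrary: s)
    case (Suc t)
    show ?case
      by (simp add: Suc upt_conv_Cons map_Suc_upt[symmetric] add.commute o_def del: upt_Suc)
  qed simp
  then show ?thesis by (simp add: pad parse_syndromes_def)
qed

lemma parse_syndromes_carrier: "set (parse_syndromes n t s) \<subseteq> carrier (GF f)"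
  using n_pos by (auto simp: parse_syndromes_def carrier_GF intro!: degree_bits_elem)

definition diff_syndromes :: "nat \<Rightarrow> bit poly set \<Rightarrow> bool list \<Rightarrow> bit poly list" where
  "diff_syndromes t w s = map2 (\<lambda>x' x. x' \<ominus>\<^bsub>GF f\<^esub> x) (syndromes f t w) (parse_syndromes n t s)"

lemma minus_GF:
  assumes "x \<in> carrier (GF f)" "y \<in> carrier (GF f)"
  shows "x \<ominus>\<^bsub>GF f\<^esub> y = x + y"
proof -
  have "\<ominus>\<^bsub>GF f\<^esub> y = y" using assms by (intro R.minus_equality) auto
  then show ?thesis by (simp add: a_minus_def)
qed

lemma diff_syndromes_bits:
  assumes "w \<subseteq> GF_units f"
  shows "map eb (diff_syndromes t w s) = vadd (map eb (syndromes f t w)) (parse B.z t s)"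
    "length (diff_syndromes t w s) = t" "set (diff_syndromes t w s) \<subseteq> carrier (GF f)"
proof -
  have len: "length (syndromes f t w) = length (parse_syndromes n t s)"
    by (simp add: syndromes_def parse_syndromes_def)
  have "map eb (map2 (\<lambda>x' x. x' \<ominus>\<^bsub>GF f\<^esub> x) us vs) = vadd (map eb us) (map eb vs)"
    if "length us = length vs" "set us \<subseteq> carrier (GF f)" "set vs \<subseteq> carrier (GF f)" for us vs
    using that by (induction us vs rule: list_induct2) (auto simp: minus_GF elem_bits_add)
  from this[OF len syndromes(4)[OF assms] parse_syndromes_carrier]
  show "map eb (diff_syndromes t w s) = vadd (map eb (syndromes f t w)) (parse B.z t s)"
    by (simp add: diff_syndromes_def parse_correct)
  show "length (diff_syndromes t w s) = t"
    by (simp add: diff_syndromes_def syndromes_def parse_syndromes_def)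
  show "set (diff_syndromes t w s) \<subseteq> carrier (GF f)"
    using syndromes(4)[OF assms, of t] parse_syndromes_carrier[of t s]
    by (auto simp: diff_syndromes_def elim!: in_set_zipE intro!: R.minus_closed)
qed

lemma length_sloop_le: "length L \<le> t \<Longrightarrow> length (sloop g t y zv M k b L) \<le> t"
  by (induction k arbitrary: b L) auto

lemma heads_elems: "x \<in> set (heads y L) \<Longrightarrow> length x = length y \<and> x \<noteq> y"
  by (induction L) (auto split: if_splits)

text \<open>Holds for every \<sigma>: whatever the decoder returns is an admissible candidate, so
  that comparing syndromes alone tells whether it decodes \<sigma>.\<close>

lemma decode_list:
  fixes \<sigma> :: "bit poly list"
  assumes t: "1 \<le> t"
  defines "d \<equiv> decode fb t B.z (replicate t B.z) (map eb \<sigma>)"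
  obtains vs where "d = map eb vs" "distinct vs" "set vs \<subseteq> GF_units f" "length vs \<le> t"
proof
  define H where "H = heads B.z (sloop fb t B.z (replicate t B.z)
    (compan fb t B.z (locator fb t B.z (full fb t (map eb \<sigma>) (map eb \<sigma>)))) (length B.z) (unit_elem B.z)
    (consnz (take t (full fb t (map eb \<sigma>) (map eb \<sigma>))) []))"
  have d: "d = togall H []" by (simp add: d_def decode_def Let_def H_def)
  have "length H \<le> t"
    unfolding H_def using t
        by (intro order_trans[OF B.length_heads_le] length_sloop_le) (simp add: consnz_def)
  then have len: "length d \<le> t" using length_togall_le[of H "[]"] by (simp add: d)
  have dist: "distinct d" by (simp add: d B.distinct_togall)
  have el: "length x = n \<and> x \<noteq> B.z" if "x \<in> set d" for x
    using that set_togall_subset[of H "[]"] heads_elems[of x B.z] by (auto simp: d H_def)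
  show "d = map eb (map bits_elem d)"
    using el by (auto simp: elem_bits_bits_elem intro!: map_idI[symmetric])
  show "distinct (map bits_elem d)"
    using dist el by (auto simp: distinct_map intro!: inj_onI) (metis elem_bits_bits_elem)
  show "length (map bits_elem d) \<le> t" using len by simp
  show "set (map bits_elem d) \<subseteq> GF_units f"
  proof
    fix p assume "p \<in> set (map bits_elem d)"
    then obtain x where x: "x \<in> set d" "p = bits_elem x" by auto
    have "degree p < n" using el[OF x(1)] n_pos x(2) by (auto intro: degree_bits_elem)
    moreover have "p \<noteq> 0" using el[OF x(1)] x(2) eb_0 elem_bits_bits_elem by metis
    ultimately show "p \<in> GF_units f" by (simp add: GF_units_iff)
  qed
qed

text \<open>The output depends on \<sigma> only, so all sets that decode \<sigma> agree with it.
  This also determines the set chosen by \<open>SOME\<close> in the recovery.\<close>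

lemma decode_unique:
  assumes t: "1 \<le> t" and d: "decodes_to f t \<sigma> w"
    and vs: "decode fb t B.z (replicate t B.z) (map eb \<sigma>) = map eb vs" "set vs \<subseteq> GF_units f"
  shows "set vs = w"
proof -
  have w: "w \<subseteq> GF_units f" "card w \<le> t" "syndromes f t w = \<sigma>" using d by (auto simp: decodes_to_def)
  have deg: "degree x < n" if "x \<in> GF_units f" for x using that by (simp add: GF_units_iff)
  have fin: "finite w" using w(1) finite_GF_units by (rule finite_subset)
  have "B.v ` set (decode fb t B.z (replicate t B.z) (map eb \<sigma>)) = em ` w"
  proof (rule B.decode)
    show "card (em ` w) \<le> t" using card_image_le[OF fin] w(2) by (rule order_trans)
    show "0 \<notin> em ` w"
    proof
      assume "0 \<in> em ` w"
      then obtain x where "x \<in> w" "em x = 0" by auto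
      then show False using w(1) emb_eq_0[of x] by (auto simp: GF_units_iff)
    qed
    show "em ` w \<subseteq> B.F"
    proof
      fix y assume "y \<in> em ` w"
      then obtain x where "x \<in> w" "y = em x" by auto
      then show "y \<in> B.F" using w(1) deg val_eb[of x]
        by (auto simp: B.F_def intro!: image_eqI[of _ _ "eb x"])
    qed
    show "B.elems (map eb \<sigma>)" using syndromes(1)[OF w(1), of t] w(3) by simp
    show "length (map eb \<sigma>) = t" using syndromes(2)[OF w(1), of t] w(3) by simp
    show "B.v (map eb \<sigma> ! i) = (\<Sum>x\<in>em ` w. x ^ (2 * i + 1))" if "i < t" for i
      using syndromes(3)[OF w(1) that] w(3) by simp
  qed (use fin t in auto)
  moreover have "(\<lambda>x. B.v (eb x)) ` set vs = em ` set vs"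
    by (rule image_cong) (use vs(2) deg val_eb in auto)
  ultimately have img: "em ` set vs = em ` w" by (simp only: vs(1) set_map image_image)
  have "inj_on em (GF_units f)" by (intro inj_onI) (simp add: emb_inject deg)
  then show ?thesis using img by (simp only: inj_on_image_eq_iff[OF _ vs(2) w(1)])
qed

lemma SOME_decodes:
  assumes "1 \<le> t" "decodes_to f t \<sigma> w"
  shows "(SOME v. decodes_to f t \<sigma> v) = w"
proof -
  obtain vs where vs: "decode fb t B.z (replicate t B.z) (map eb \<sigma>)
      = map eb vs" "set vs \<subseteq> GF_units f"
    using decode_list[OF assms(1), of \<sigma>] by metis
  show ?thesis
    using decode_unique[OF assms(1) _ vs] assms(2) by (metis someI)
qed

text \<open>Toggling commutes with injective maps, so work on bit strings amounts to work on
  residues.\<close>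

lemma togall_map: "inj_on g (set vs \<union> set L) \<Longrightarrow> togall (map g vs) (map g L) = map g (togall vs L)"
proof (induction vs)
  case (Cons x vs)
  have "toggle (g x) (map g M) = map g (toggle x M)" if "inj_on g (insert x (set M))" for M
    using that by (induction M) (auto simp: inj_on_def)
  moreover have "inj_on g (insert x (set (togall vs L)))"
    using Cons.prems set_togall_subset[of vs L] by (auto intro: inj_on_subset)
  moreover have "togall (map g vs) (map g L) = map g (togall vs L)"
    using Cons.prems by (intro Cons.IH) (auto intro: inj_on_subset)
  ultimately show ?case by (simp add: togall_def)
qed (simp add: togall_def)

lemma inj_on_eb: "S \<subseteq> carrier (GF f) \<Longrightarrow> inj_on eb S"
  by (intro inj_onI) (metis carrier_GF coeff_elem_bits_inject subsetD)

lemma rec_alg_correct: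
  assumes t: "1 \<le> t" and xs: "distinct xs" "set xs = w" "w \<subseteq> GF_units f"
  obtains ys where "list_of_set ys (pinsketch_Rec f t w s)"
    "rec_alg fb t (map eb xs) s = map eb ys"
proof -
  define \<sigma> where "\<sigma> = diff_syndromes t w s"
  note \<sigma> = diff_syndromes_bits[OF xs(3), of t s, folded \<sigma>_def]
  obtain vs where vs: "decode fb t B.z (replicate t B.z) (map eb \<sigma>) = map eb vs"
    "distinct vs" "set vs \<subseteq> GF_units f" "length vs \<le> t"
    using decode_list[OF t, of \<sigma>] by metis
  have check: "map eb (syndromes f t (set vs)) = map eb \<sigma> \<longleftrightarrow> decodes_to f t \<sigma> (set vs)"
  proof -
    have "inj_on eb (set (syndromes f t (set vs)) \<union> set \<sigma>)"
      using syndromes(4)[OF vs(3)] \<sigma>(3) by (intro inj_on_eb) auto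
    then have "map eb (syndromes f t (set vs)) = map eb \<sigma> \<longleftrightarrow> syndromes f t (set vs) = \<sigma>"
      by (rule inj_on_map_eq_map)
    moreover have "card (set vs) \<le> t" using card_length[of vs] vs(4) by simp
    ultimately show ?thesis using vs(3) by (simp add: decodes_to_def)
  qed
  have alg: "rec_alg fb t (map eb xs) s =
    (if decodes_to f t \<sigma> (set vs) then togall (map eb vs) (map eb xs) else map eb xs)"
    unfolding rec_alg_def Let_def zero_bits ssum_syndromes[OF xs] \<sigma>(1)[symmetric] vs(1)
      ssum_syndromes[OF vs(2) refl vs(3)] check ..
  have Rec: "pinsketch_Rec f t w s =
    (if \<exists>v. decodes_to f t \<sigma> v then sym_diff w (SOME v. decodes_to f t \<sigma> v) else w)"
    unfolding pinsketch_Rec_def Let_def \<sigma>_def diff_syndromes_def ..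
  show thesis
  proof (cases "decodes_to f t \<sigma> (set vs)")
    case True
    have "inj_on eb (set vs \<union> set xs)" using vs(3) xs GF_units_subset by (intro inj_on_eb) auto
    then have "rec_alg fb t (map eb xs) s = map eb (togall vs xs)"
      using True by (simp add: alg togall_map)
    moreover have "list_of_set (togall vs xs) (pinsketch_Rec f t w s)"
      using True SOME_decodes[OF t True] B.distinct_togall[OF xs(1)] B.set_togall[OF vs(2) xs(1)] xs(2)
      by (auto simp: list_of_set_def Rec)
    ultimately show ?thesis using that by blast
  next
    case False
    \<comment> \<open>Any solution would be the candidate itself, which has been rejected.\<close>
    have "\<not> decodes_to f t \<sigma> v" for v
      using False decode_unique[OF t _ vs(1,3)] by metis
    then have "pinsketch_Rec f t w s = w" by (simp add: Rec)
    then show ?thesis using that[of xs] False xs by (simp add: alg list_of_set_def)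
  qed
qed

lemma Rec_SS:
  assumes t: "1 \<le> t" and w: "w \<subseteq> GF_units f" "w' \<subseteq> GF_units f" and d: "sdif_dist w w' \<le> t"
  shows "pinsketch_Rec f t w' (pinsketch_SS f t w) = w"
proof -
  define u where "u = sym_diff w w'"
  have parse_SS: "parse_syndromes n t (pinsketch_SS f t w) = syndromes f t w"
  proof (rule nth_equalityI)
    show "length (parse_syndromes n t (pinsketch_SS f t w)) = length (syndromes f t w)"
      by (simp add: parse_syndromes_def syndromes_def)
    fix j assume "j < length (parse_syndromes n t (pinsketch_SS f t w))"
    then have j: "j < t" by (simp add: parse_syndromes_def)
    have chunk: "take n (drop (j * n) (concat (map eb ys)))
        = eb (ys ! j)" if "j < length ys" for j ys
      using that
    proof (induction ys arbitrary: j)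
      case (Cons y ys)
      then show ?case by (cases j) simp_all
    qed simp
    have len: "length (syndromes f t w) = t" by (rule syndromes(2)[OF w(1)])
    have "degree (syndromes f t w ! j) < n"
      using syndromes(4)[OF w(1), of t] j len carrier_GF by (metis nth_mem subsetD)
    then have "bits_elem (eb (syndromes f t w ! j)) = syndromes f t w ! j"
        by (rule bits_elem_elem_bits)
    then show "parse_syndromes n t (pinsketch_SS f t w) ! j = syndromes f t w ! j"
      using j len by (simp add: parse_syndromes_def pinsketch_SS_def chunk)
  qed
  have uU: "u \<subseteq> GF_units f" using w by (auto simp: u_def)
  have fin: "finite w" "finite w'" using w finite_GF_units finite_subset by blast+
  have two: "x + x = 0" for x :: "bit alg_closure" by (rule B.add_self)
  \<comment> \<open>Common elements of \<open>w\<close> and \<open>w'\<close> contribute twice and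
    cancel in characteristic 2, which leaves the power sum of the symmetric difference.\<close>
  have ps: "power_sum f i w' + power_sum f i w = power_sum f i u" for i
  proof -
    have wc: "w \<subseteq> carrier (GF f)" "w' \<subseteq> carrier (GF f)" "u \<subseteq> carrier (GF f)" "finite u"
      using w uU fin GF_units_subset by (auto simp: u_def)
    note p = power_sum[OF fin(1) wc(1), of i] power_sum[OF fin(2) wc(2), of i] power_sum[OF wc(4,3), of i]
    have "(\<Sum>x\<in>w'. em x ^ i) = (\<Sum>x\<in>w' - w. em x ^ i) + (\<Sum>x\<in>w \<inter> w'. em x ^ i)"
      using fin by (subst sum.union_disjoint[symmetric]) (auto intro!: sum.cong)
    moreover have "(\<Sum>x\<in>w. em x ^ i) = (\<Sum>x\<in>w - w'. em x ^ i) + (\<Sum>x\<in>w \<inter> w'. em x ^ i)"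
      using fin by (subst sum.union_disjoint[symmetric]) (auto intro!: sum.cong)
    moreover have "(\<Sum>x\<in>u. em x ^ i) = (\<Sum>x\<in>w - w'. em x ^ i) + (\<Sum>x\<in>w' - w. em x ^ i)"
      unfolding u_def using fin by (subst sum.union_disjoint) auto
    ultimately have "em (power_sum f i w' + power_sum f i w) =
        em (power_sum f i u) + ((\<Sum>x\<in>w \<inter> w'. em x ^ i) + (\<Sum>x\<in>w \<inter> w'. em x ^ i))"
      using p by (simp only: emb_add ac_simps)
    then have "em (power_sum f i w' + power_sum f i w) = em (power_sum f i u)"
        by (simp only: two add_0_right)
    then show ?thesis using p by (intro emb_inject[THEN iffD1]) (auto intro: degree_add_less)
  qed
  have "map2 (\<lambda>x' x. x' \<ominus>\<^bsub>GF f\<^esub> x) (syndromes f t w') (syndromes f t w) = syndromes f t u"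
  proof (rule nth_equalityI)
    fix i assume "i < length (map2 (\<lambda>x' x. x' \<ominus>\<^bsub>GF f\<^esub> x) (syndromes f t w') (syndromes f t w))"
    then have i: "i < t" by (simp add: syndromes_def)
    have "syndromes f t w' ! i \<in> carrier (GF f)" "syndromes f t w ! i \<in> carrier (GF f)"
      using syndromes(2,4) w i by (metis nth_mem subsetD)+
    then show "map2 (\<lambda>x' x. x' \<ominus>\<^bsub>GF f\<^esub> x) (syndromes f t w') (syndromes f t w) ! i
        = syndromes f t u ! i"
      using i ps[of "2 * i + 1"] by (simp add: minus_GF syndromes_def)
  qed (simp add: syndromes_def)
  moreover have "card u \<le> t" using d by (simp add: u_def sdif_dist_def)
  ultimately have dec: "decodes_to f t (map2 (\<lambda>x' x. x' \<ominus>\<^bsub>GF f\<^esub> x) (syndromes f t w')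
      (parse_syndromes n t (pinsketch_SS f t w))) u"
    using uU by (simp add: decodes_to_def parse_SS)
  have "pinsketch_Rec f t w' (pinsketch_SS f t w) = sym_diff w' u"
    unfolding pinsketch_Rec_def Let_def SOME_decodes[OF t dec] using dec by metis
  also have "\<dots> = w" by (auto simp: u_def)
  finally show ?thesis .
qed

lemma length_SS: "length (pinsketch_SS f t w) = t * n"
proof -
  have "length (concat (map eb ys)) = length ys * n" for ys by (induction ys) auto
  from this[of "syndromes f t w"] show ?thesis
    by (simp only: pinsketch_SS_def) (simp add: syndromes_def)
qed

lemma secure:
  assumes t: "1 \<le> t"
  shows "average_case_secure_sketch (sdif (GF_units f)) sdif_dist m (m - real t * real n) t
    (\<lambda>w. return_pmf (pinsketch_SS f t w)) (\<lambda>w' s. return_pmf (pinsketch_Rec f t w' s))"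
  unfolding average_case_secure_sketch_def
proof (intro conjI ballI allI impI)
  fix w w' s
  assume "w \<in> sdif (GF_units f)" "w' \<in> sdif (GF_units f)" "sdif_dist w w' \<le> t"
    "s \<in> set_pmf (return_pmf (pinsketch_SS f t w))"
  then show "return_pmf (pinsketch_Rec f t w' s) = return_pmf w"
    using Rec_SS[OF t] by (simp add: sdif_def)
next
  fix J :: "(bit poly set \<times> bool list) pmf"
  assume m: "m \<le> avg_min_entropy J"
  define S where "S = {s :: bool list. length s = t * n}"
  have S: "finite S" "card S = 2 ^ (t * n)" by (simp_all add: S_def finite_bools card_bools)
  have "avg_min_entropy J - log 2 (real (card S)) \<le>
      avg_min_entropy (map_pmf (\<lambda>(w, i). (w, (pinsketch_SS f t w, i))) J)"
    by (rule avg_min_entropy_leakage[OF S(1)]) (auto simp: S_def length_SS)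
  moreover have "log 2 (real (card S)) = real t * real n" by (simp add: S(2) log_nat_power)
  moreover have "bind_pmf J (\<lambda>(w, i). map_pmf (\<lambda>s. (w, (s, i))) (return_pmf (pinsketch_SS f t w))) =
      map_pmf (\<lambda>(w, i). (w, (pinsketch_SS f t w, i))) J"
    by (simp add: map_pmf_def case_prod_unfold bind_return_pmf)
  ultimately show "m - real t * real n \<le>
      avg_min_entropy (bind_pmf J (\<lambda>(w, i). map_pmf (\<lambda>s. (w, (s, i))) (return_pmf (pinsketch_SS f t w))))"
    using m by simp
qed

end

section \<open>Polynomial running time of both programs\<close>

lemma enc_list_map: "enc_list e (map g xs) = enc_list (\<lambda>x. e (g x)) xs"
  by (induction xs) (auto simp: enc_list_def)

lemma enc_elems_map: "enc_elems f xs = enc_vec (map (elem_bits (degree f)) xs)"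
  by (simp add: enc_elems_def enc_list_map enc_bits_def)

lemma computes_withinI:
  assumes "call P 0 x = Some (y, k)" "real (k + 2) \<le> T"
  shows "computes_within P x y T"
proof -
  have "run P [x] (Call 0 (Var 0)) = Some (y, k + 2)" using assms(1) by simp
  then show ?thesis unfolding computes_within_def run_eq_Some using assms(2) by blast
qed

text \<open>There are \<open>2 ^ n - 1 \<ge> 2 ^ (n - 1)\<close> units, so their logarithm is at
  least \<open>n - 1\<close>. With \<open>1 \<le> n\<close> this gives
  \<open>n + 2 * t + 3 \<le> 4 * x\<close> for the base \<open>x\<close> of the time bound, whence
  the factor \<open>4 ^ 7\<close>. The constant 20002 leaves room for the two steps of the outer
  call.\<close>

lemma time_bound_ge:
  assumes f: "irreducible f" and k: "k \<le> Suc l * (20000 * pw (degree f + 2 * t + 3) 7)"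
  shows "real (k + 2) \<le> time_bound (20002 * 4 ^ 7) 7 (card (GF_units f)) t l"
proof -
  interpret gf f by unfold_locales (rule f)
  define N where "N = n + 2 * t + 3"
  define x where "x = 1 + real t + log 2 (real (card (GF_units f)))"
  have card: "card (GF_units f) = 2 ^ n - 1" by (rule card_GF_units[OF n_pos])
  have "(2::nat) ^ (n - 1) \<le> card (GF_units f)" unfolding card using n_pos by (cases n) auto
  then have "real (2 ^ (n - 1)) \<le> real (card (GF_units f))" by (simp only: of_nat_le_iff)
  then have "log 2 (real (2 ^ (n - 1))) \<le> log 2 (real (card (GF_units f)))"
    by (intro log_mono) auto
  then have "real n - 1 \<le> log 2 (real (card (GF_units f)))"
    using n_pos by (simp add: log_nat_power of_nat_diff)
  moreover have "1 \<le> real n" using n_pos by simp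
  ultimately have x: "real N \<le> 4 * x" by (simp add: N_def x_def)
  have "real (k + 2) \<le> real (Suc l * (20002 * pw N 7))"
  proof -
    have "1 \<le> pw N 7" by (simp add: pw_def N_def)
    then have "2 \<le> Suc l * (2 * pw N 7)" by simp
    then have "k + 2 \<le> Suc l * (20002 * pw N 7)" using k unfolding N_def[symmetric]
        by (simp add: algebra_simps)
    then show ?thesis by (simp only: of_nat_le_iff)
  qed
  also have "\<dots> = 20002 * real N ^ 7 * (1 + real l)" by (simp add: pw_def algebra_simps)
  also have "\<dots> \<le> 20002 * (4 * x) ^ 7 * (1 + real l)"
    using x by (intro mult_right_mono mult_left_mono power_mono) auto
  also have "\<dots> = time_bound (20002 * 4 ^ 7) 7 (card (GF_units f)) t l"
    by (simp only: time_bound_def x_def power_mult_distrib mult.assoc)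
  finally show ?thesis .
qed

lemma SS_polytime_ss_main: "SS_polytime (prog ss_main)"
  unfolding SS_polytime_def
proof (rule exI[of _ "20002 * 4 ^ 7"], rule exI[of _ 7], intro allI impI)
  fix f t w xs
  assume irr: "irreducible f" and t: "(1::nat) \<le> t" and w: "w \<in> sdif (GF_units f)"
      and xs: "list_of_set xs w"
  interpret gf f by unfold_locales (rule irr)
  define x where "x = SS_input f t xs"
  have x: "x = (enc_el fb ;; enc_unary t) ;; enc_vec (map eb xs)"
    by (simp add: x_def SS_input_def enc_params_def enc_elems_map enc_bits_def)
  have dw: "distinct xs" "set xs = w" "w \<subseteq> GF_units f" using xs w
      by (auto simp: list_of_set_def sdif_def)
  have "call (prog ss_main) 0 x = Some (enc_bits (pinsketch_SS f t w), cost ss_main 0 x)"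
    unfolding x call_ss_main ss_alg_correct[OF dw] enc_bits_def ..
  moreover have "cost ss_main 0 x \<le> Suc (length (map eb xs)) * (2000 * pw (n + 2 * t + 3) 3)"
    unfolding x by (rule cost_ss_main) auto
  then have "cost ss_main 0 x \<le> Suc (length xs) * (20000 * pw (n + 2 * t + 3) 7)"
  proof (rule order_trans)
    have "pw (n + 2 * t + 3) 3 \<le> pw (n + 2 * t + 3) 7" unfolding pw_def
        by (rule power_increasing) auto
    then show "Suc (length (map eb xs)) * (2000 * pw (n + 2 * t + 3) 3) \<le>
        Suc (length xs) * (20000 * pw (n + 2 * t + 3) 7)"
      by (intro mult_mono) auto
  qed
  ultimately show "computes_within (prog ss_main) (SS_input f t xs) (enc_bits (pinsketch_SS f t w))
      (time_bound (20002 * 4 ^ 7) 7 (card (GF_units f)) t (length xs))"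
    unfolding x_def[symmetric] by (intro computes_withinI time_bound_ge[OF irr])
qed

lemma Rec_polytime_rec_main: "Rec_polytime (prog rec_main)"
  unfolding Rec_polytime_def
proof (rule exI[of _ "20002 * 4 ^ 7"], rule exI[of _ 7], intro allI impI)
  fix f t w xs s
  assume irr: "irreducible f" and t: "(1::nat) \<le> t" and w: "w \<in> sdif (GF_units f)"
      and xs: "list_of_set xs w"
  interpret gf f by unfold_locales (rule irr)
  define x where "x = Rec_input f t xs s"
  have x: "x = (enc_el fb ;; enc_unary t) ;; enc_vec (map eb xs) ;; enc_el s"
    by (simp add: x_def Rec_input_def enc_params_def enc_elems_map enc_bits_def)
  have dw: "distinct xs" "set xs = w" "w \<subseteq> GF_units f" using xs w
      by (auto simp: list_of_set_def sdif_def)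
  obtain ys where ys: "list_of_set ys (pinsketch_Rec f t w s)" "rec_alg fb t (map eb xs) s
      = map eb ys"
    by (rule rec_alg_correct[OF t dw])
  have "call (prog rec_main) 0 x = Some (enc_elems f ys, cost rec_main 0 x)"
    unfolding x call_rec_main ys(2) enc_elems_map ..
  moreover have "cost rec_main 0 x \<le> Suc (length (map eb xs)) * (20000 * pw (n + 2 * t + 3) 7)"
    unfolding x by (rule cost_rec_main) (use n_pos in auto)
  then have "cost rec_main 0 x \<le> Suc (length xs) * (20000 * pw (n + 2 * t + 3) 7)" by simp
  ultimately have "computes_within (prog rec_main) x (enc_elems f ys)
      (time_bound (20002 * 4 ^ 7) 7 (card (GF_units f)) t (length xs))"
    by (intro computes_withinI time_bound_ge[OF irr])
  with ys(1) show "\<exists>ys. list_of_set ys (pinsketch_Rec f t w s) \<and>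
      computes_within (prog rec_main) (Rec_input f t xs s) (enc_elems f ys)
      (time_bound (20002 * 4 ^ 7) 7 (card (GF_units f)) t (length xs))"
    unfolding x_def by blast
qed

theorem theorem6p3:
  shows
    "(\<forall>(a::nat) n t (f :: bit poly) (m::real).
        a \<ge> 1 \<longrightarrow> n = 2 ^ a - 1 \<longrightarrow> irreducible f \<longrightarrow> degree f = a \<longrightarrow> t \<ge> 1 \<longrightarrow>
        card (GF_units f) = n \<and>
        average_case_secure_sketch (sdif (GF_units f)) sdif_dist
          m (m - real t * log 2 (real n + 1)) t
          (\<lambda>w. return_pmf (pinsketch_SS f t w))
          (\<lambda>w' s. return_pmf (pinsketch_Rec f t w' s)) \<and>
        (\<forall>w \<in> sdif (GF_units f).
           real (length (pinsketch_SS f t w)) = real t * log 2 (real n + 1))) \<and>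
     (\<exists>P. SS_polytime P) \<and>
     (\<exists>P. Rec_polytime P)"
proof (intro conjI allI impI)
  fix a n t :: nat and f :: "bit poly" and m :: real
  assume a: "1 \<le> a" and n: "n = 2 ^ a - 1" and f: "irreducible f" "degree f = a" and t: "1 \<le> t"
  interpret gf f by unfold_locales (rule f(1))
  have log: "log 2 (real n + 1) = real a"
    by (simp add: n of_nat_diff log_nat_power)
  show "card (GF_units f) = n" using card_GF_units[of f] a f by (simp add: n)
  show "average_case_secure_sketch (sdif (GF_units f)) sdif_dist
      m (m - real t * log 2 (real n + 1)) t
      (\<lambda>w. return_pmf (pinsketch_SS f t w)) (\<lambda>w' s. return_pmf (pinsketch_Rec f t w' s))"
    unfolding log f(2)[symmetric] by (rule secure[OF t])
  show "\<forall>w\<in>sdif (GF_units f). real (length (pinsketch_SS f t w)) = real t * log 2 (real n + 1)"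
    unfolding log by (simp add: length_SS f(2))
qed (use SS_polytime_ss_main Rec_polytime_rec_main in blast)+

end
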